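(* Consider any of the eight families (Cases 1 to 8) of real planar quadratic systems $\dot x=P(x,y),\ \dot y=Q(x,y)$ listed in the context, each one with its associated invariant algebraic curve $f(x,y)=0$. Each system in these families has at most one limit cycle, and when it exists it is the algebraic limit cycle contained in the corresponding curve $\{f(x,y)=0\}$.
   Context: A limit cycle is an isolated periodic orbit; it is algebraic if it is contained in an invariant algebraic curve, that is, in the zero set of a polynomial $f$ with $\frac{\partial f}{\partial x}P+\frac{\partial f}{\partial y}Q=kf$ for some polynomial $k$. In each case the letters $a,b,c$ denote real parameters. The families are the following. Case 1 (Qin): $P=-y(ax+by+c)-(x^2+y^2-1)$, $Q=x(ax+by+c)$, $f=x^2+y^2-1$. Case 2 (Yablonskii): $P=-4abcx-(a+b)y+3(a+b)cx^2+4xy$, $Q=(a+b)abx-4abcy+\left(4abc^2-\tfrac32(a+b)^2+4ab\right)x^2+8(a+b)cxy+8y^2$, $f=(y+cx^2)^2+x^2(x-a)(x-b)$. Case 3 (Filiptsov): $P=6(1+a)x+2y-6(2+a)x^2+12xy$, $Q=15(1+a)y+3a(1+a)x^2-2(9+5a)xy+16y^2$, $f=3(1+a)(ax^2+y)^2+2y^2(2y-3(1+a)x)$. Case 4 (Chavarriga), $a\neq -10/3$: $P=5x+6x^2+4(1+a)xy+ay^2$, $Q=x+2y+4xy+(2+3a)y^2$, $f=x^2+x^3+x^2y+2axy^2+2axy^3+a^2y^4$. Case 5 (Chavarriga, Llibre and Sorolla): $P=2(1+2x-2ax^2+6xy)$, $Q=8-3a-14ax-2axy-8y^2$, $f=\tfrac14+x-x^2+ax^3+xy+x^2y^2$.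 Case 6 (Christopher, Llibre and Świrszcz, degree 5), $a\neq-4$, $a\neq -3$: $P=28x+2(16-a^2)(a+12)x^2+6(3a-4)xy-\frac{12}{a+4}y^2$, $Q=2(16-a^2)x+8y+(16-a^2)(a+12)xy+2(5a-12)y^2$, $f=x^2+(16-a^2)x^3+(a-2)x^2y-\frac{2}{a+4}xy^2-\frac14(4-a)(a+12)x^2y^2+\frac{8-a}{a+4}xy^3+\frac{1}{(a+4)^2}y^4+\frac{a+12}{a+4}xy^4-\frac{6}{(a+4)^2}y^5$. Case 7 (Christopher, Llibre and Świrszcz, degree 6): $P=28a(a-30)x+y+168a^2x^2+3xy$, $Q=16a(a-30)\left(14a(a-30)x+5y+84a^2x^2\right)+24a(17a-6)xy+6y^2$, $f=48a^3(a-30)^4x^2+24a^2(a-30)^3xy+3a(a-30)^2y^2+64a^3(a-30)^3(9a-4)x^3+24a^2(a-30)^2(9a-4)x^2y+18a(a-30)(a-2)xy^2-7y^3+576a^3(a-30)^2(a-2)^2x^4+144a^2(a-30)(a-2)^2x^3y+27a(a-2)^2x^2y^2-3456a^3(a-30)(a-2)^2(2a+3)x^5-432a^2(a-2)^2(2a+3)x^4y+3456a^3(a-2)^2(a+12)(2a+3)x^6$. Case 8 (Alberich-Carramiñana, Ferragut and Llibre), $a\neq0$, $a\neq2$: $P=-8x+\frac a2(a-16)y-(5a-64)x^2+\frac a8(a^2-256)xy$, $Q=-28y+\frac{24}{a}x^2-3(3a-32)xy+\frac a4(a^2-256)y^2$, $f=ay^2-4x^2y+\frac a2(a-12)xy^2-\frac{a^2}{4}(a-16)y^3+\frac4a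 x^4+(24-a)x^3y+\frac{a}{16}(a^2-256)x^2y^2-\frac{24}{a}x^5+(a+16)x^4y$. *)

theory Defs
  imports "HOL-Analysis.Analysis"
begin

definition solution :: "(real \<Rightarrow> real \<Rightarrow> real) \<Rightarrow> (real \<Rightarrow> real \<Rightarrow> real) \<Rightarrow> (real \<Rightarrow> real \<times> real) \<Rightarrow> bool"
  where "solution P Q \<gamma> \<longleftrightarrow>
    (\<forall>t. (\<gamma> has_vector_derivative
           (P (fst (\<gamma> t)) (snd (\<gamma> t)), Q (fst (\<gamma> t)) (snd (\<gamma> t)))) (at t))"

text \<open>Orbits are point sets, so two time parametrisations of the same orbit are not
  distinguished. Equilibria are excluded.\<close>

definition periodic_orbit :: "(real \<Rightarrow> real \<Rightarrow> real) \<Rightarrow> (real \<Rightarrow> real \<Rightarrow> real) \<Rightarrow> (real \<times> real) set \<Rightarrow> bool"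
  where "periodic_orbit P Q \<Gamma> \<longleftrightarrow>
    (\<exists>\<gamma> T. solution P Q \<gamma> \<and> T > 0 \<and> (\<forall>t. \<gamma> (t + T) = \<gamma> t) \<and>
       (\<exists>s t. \<gamma> s \<noteq> \<gamma> t) \<and> \<Gamma> = range \<gamma>)"

text \<open>Isolated: some neighbourhood of the orbit contains no other periodic orbit.\<close>

definition limit_cycle :: "(real \<Rightarrow> real \<Rightarrow> real) \<Rightarrow> (real \<Rightarrow> real \<Rightarrow> real) \<Rightarrow> (real \<times> real) set \<Rightarrow> bool"
  where "limit_cycle P Q \<Gamma> \<longleftrightarrow> periodic_orbit P Q \<Gamma> \<and>
    (\<exists>U. open U \<and> \<Gamma> \<subseteq> U \<and> (\<forall>\<Delta>. periodic_orbit P Q \<Delta> \<and> \<Delta> \<subseteq> U \<longrightarrow> \<Delta> = \<Gamma>))"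

definition curve :: "(real \<Rightarrow> real \<Rightarrow> real) \<Rightarrow> (real \<times> real) set"
  where "curve f = {(x, y). f x y = 0}"

text \<open>Bivariate real polynomials are represented by their polynomial functions. The zero
  polynomial satisfies the cofactor equation and vanishes on the whole plane, so it has to be
  excluded. A nonzero constant has an empty zero set and is harmless.\<close>

definition invariant_algebraic_curve ::
    "(real \<Rightarrow> real \<Rightarrow> real) \<Rightarrow> (real \<Rightarrow> real \<Rightarrow> real) \<Rightarrow> (real \<Rightarrow> real \<Rightarrow> real) \<Rightarrow> bool"
  where "invariant_algebraic_curve P Q f \<longleftrightarrow>
    real_polynomial_function (\<lambda>(x, y). f x y) \<and> \<not> (\<forall>x y. f x y = 0) \<and>
    (\<exists>k. real_polynomial_function (\<lambda>(x, y). k x y) \<and>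
      (\<forall>x y. deriv (\<lambda>s. f s y) x * P x y + deriv (\<lambda>s. f x s) y * Q x y = k x y * f x y))"

definition algebraic_limit_cycle :: "(real \<Rightarrow> real \<Rightarrow> real) \<Rightarrow> (real \<Rightarrow> real \<Rightarrow> real) \<Rightarrow> (real \<times> real) set \<Rightarrow> bool"
  where "algebraic_limit_cycle P Q \<Gamma> \<longleftrightarrow> limit_cycle P Q \<Gamma> \<and>
    (\<exists>f. invariant_algebraic_curve P Q f \<and> \<Gamma> \<subseteq> curve f)"

text \<open>\<open>quadratic_family P Q f\<close>: the system with right-hand side \<open>(P, Q)\<close> is a member of one of
  the eight families, and \<open>f\<close> is the polynomial listed with it.\<close>

inductive quadratic_family ::
    "(real \<Rightarrow> real \<Rightarrow> real) \<Rightarrow> (real \<Rightarrow> real \<Rightarrow> real) \<Rightarrow> (real \<Rightarrow> real \<Rightarrow> real) \<Rightarrow> bool"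
where
  Qin:
  "quadratic_family
    (\<lambda>x y. - y * (a*x + b*y + c) - (x^2 + y^2 - 1))
    (\<lambda>x y. x * (a*x + b*y + c))
    (\<lambda>x y. x^2 + y^2 - 1)"
| Yablonskii:
  "quadratic_family
    (\<lambda>x y. - 4*a*b*c*x - (a + b)*y + 3*(a + b)*c*x^2 + 4*x*y)
    (\<lambda>x y. (a + b)*a*b*x - 4*a*b*c*y
       + (4*a*b*c^2 - 3/2*(a + b)^2 + 4*a*b)*x^2 + 8*(a + b)*c*x*y + 8*y^2)
    (\<lambda>x y. (y + c*x^2)^2 + x^2*(x - a)*(x - b))"
| Filiptsov:
  "quadratic_family
    (\<lambda>x y. 6*(1 + a)*x + 2*y - 6*(2 + a)*x^2 + 12*x*y)
    (\<lambda>x y. 15*(1 + a)*y + 3*a*(1 + a)*x^2 - 2*(9 + 5*a)*x*y + 16*y^2)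
    (\<lambda>x y. 3*(1 + a)*(a*x^2 + y)^2 + 2*y^2*(2*y - 3*(1 + a)*x))"
| Chavarriga:
  "a \<noteq> - 10/3 \<Longrightarrow> quadratic_family
    (\<lambda>x y. 5*x + 6*x^2 + 4*(1 + a)*x*y + a*y^2)
    (\<lambda>x y. x + 2*y + 4*x*y + (2 + 3*a)*y^2)
    (\<lambda>x y. x^2 + x^3 + x^2*y + 2*a*x*y^2 + 2*a*x*y^3 + a^2*y^4)"
| Chavarriga_Llibre_Sorolla:
  "quadratic_family
    (\<lambda>x y. 2*(1 + 2*x - 2*a*x^2 + 6*x*y))
    (\<lambda>x y. 8 - 3*a - 14*a*x - 2*a*x*y - 8*y^2)
    (\<lambda>x y. 1/4 + x - x^2 + a*x^3 + x*y + x^2*y^2)"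
| Christopher_Llibre_Swirszcz_5:
  "\<lbrakk>a \<noteq> - 4; a \<noteq> - 3\<rbrakk> \<Longrightarrow> quadratic_family
    (\<lambda>x y. 28*x + 2*(16 - a^2)*(a + 12)*x^2 + 6*(3*a - 4)*x*y - 12/(a + 4)*y^2)
    (\<lambda>x y. 2*(16 - a^2)*x + 8*y + (16 - a^2)*(a + 12)*x*y + 2*(5*a - 12)*y^2)
    (\<lambda>x y. x^2 + (16 - a^2)*x^3 + (a - 2)*x^2*y - 2/(a + 4)*x*y^2
       - 1/4*(4 - a)*(a + 12)*x^2*y^2 + (8 - a)/(a + 4)*x*y^3
       + 1/(a + 4)^2*y^4 + (a + 12)/(a + 4)*x*y^4 - 6/(a + 4)^2*y^5)"
| Christopher_Llibre_Swirszcz_6: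
  "quadratic_family
    (\<lambda>x y. 28*a*(a - 30)*x + y + 168*a^2*x^2 + 3*x*y)
    (\<lambda>x y. 16*a*(a - 30)*(14*a*(a - 30)*x + 5*y + 84*a^2*x^2)
       + 24*a*(17*a - 6)*x*y + 6*y^2)
    (\<lambda>x y. 48*a^3*(a - 30)^4*x^2 + 24*a^2*(a - 30)^3*x*y + 3*a*(a - 30)^2*y^2
       + 64*a^3*(a - 30)^3*(9*a - 4)*x^3 + 24*a^2*(a - 30)^2*(9*a - 4)*x^2*y
       + 18*a*(a - 30)*(a - 2)*x*y^2 - 7*y^3
       + 576*a^3*(a - 30)^2*(a - 2)^2*x^4 + 144*a^2*(a - 30)*(a - 2)^2*x^3*y
       + 27*a*(a - 2)^2*x^2*y^2 - 3456*a^3*(a - 30)*(a - 2)^2*(2*a + 3)*x^5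
       - 432*a^2*(a - 2)^2*(2*a + 3)*x^4*y
       + 3456*a^3*(a - 2)^2*(a + 12)*(2*a + 3)*x^6)"
| Alberich_Ferragut_Llibre:
  "\<lbrakk>a \<noteq> 0; a \<noteq> 2\<rbrakk> \<Longrightarrow> quadratic_family
    (\<lambda>x y. - 8*x + a/2*(a - 16)*y - (5*a - 64)*x^2 + a/8*(a^2 - 256)*x*y)
    (\<lambda>x y. - 28*y + 24/a*x^2 - 3*(3*a - 32)*x*y + a/4*(a^2 - 256)*y^2)
    (\<lambda>x y. a*y^2 - 4*x^2*y + a/2*(a - 12)*x*y^2 - a^2/4*(a - 16)*y^3 + 4/a*x^4
       + (24 - a)*x^3*y + a/16*(a^2 - 256)*x^2*y^2 - 24/a*x^5 + (a + 16)*x^4*y)"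

lemma real_polynomial_function_fst_snd:
  "real_polynomial_function (\<lambda>z :: real \<times> real. fst z)"
  "real_polynomial_function (\<lambda>z :: real \<times> real. snd z)"
  by (auto intro: real_polynomial_function.intros(1) bounded_linear_fst bounded_linear_snd)

lemma invariant_algebraic_curveI:
  assumes "\<And>x y. ((\<lambda>s. f s y) has_real_derivative fx x y) (at x)"
    and "\<And>x y. ((\<lambda>s. f x s) has_real_derivative fy x y) (at y)"
    and "f u v \<noteq> 0 \<or> f u' v' \<noteq> 0"
    and "\<And>x y. fx x y * P x y + fy x y * Q x y = (k0 + k1 * x + k2 * y) * f x y"
    and "real_polynomial_function (\<lambda>(x, y). f x y)"
  shows "invariant_algebraic_curve P Q f"
  unfolding invariant_algebraic_curve_def
proof (intro conjI exI allI)
  show "real_polynomial_function (\<lambda>(x, y). k0 + k1 * x + k2 * y)"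
    unfolding case_prod_unfold
    by (intro real_polynomial_function.intros(2-4) real_polynomial_function_fst_snd)
qed (use assms in \<open>auto simp: DERIV_imp_deriv[OF assms(1)] DERIV_imp_deriv[OF assms(2)]\<close>)

text \<open>The listed polynomials do define invariant algebraic curves of their systems.\<close>

lemma quadratic_family_invariant:
  assumes "quadratic_family P Q f"
  shows "invariant_algebraic_curve P Q f"
  using assms
proof cases
  case (Qin a b c)
  show ?thesis unfolding Qin
    apply (rule invariant_algebraic_curveI[where u=0 and v=0 and ?k0.0=0 and ?k1.0="-2" and ?k2.0=0])
        apply (rule derivative_eq_intros refl)+
      apply simp
     apply (simp, algebra)
    unfolding case_prod_unfold
    by (intro real_polynomial_function.intros(2-4) real_polynomial_function_fst_snd
          real_polynomial_function_diff real_polynomial_function_power)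
next
  case (Yablonskii a b c)
  show ?thesis unfolding Yablonskii
    apply (rule invariant_algebraic_curveI[where u=0 and v=1 and
       ?k0.0="-8*a*b*c" and ?k1.0="12*c*(a+b)" and ?k2.0=16])
        apply (rule derivative_eq_intros refl)+
      apply simp
     apply (simp add: field_simps, algebra)
    unfolding case_prod_unfold
    by (intro real_polynomial_function.intros(2-4) real_polynomial_function_fst_snd
          real_polynomial_function_diff real_polynomial_function_power)
next
  case (Filiptsov a)
  show ?thesis unfolding Filiptsov
    apply (rule invariant_algebraic_curveI[where u=0 and v=1 and u'=0 and v'="-1" and
       ?k0.0="30*(1+a)" and ?k1.0="-24*(2+a)" and ?k2.0=48])
        apply (rule derivative_eq_intros refl)+
      apply simp
     apply (simp, algebra)
    unfolding case_prod_unfold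
    by (intro real_polynomial_function.intros(2-4) real_polynomial_function_fst_snd
          real_polynomial_function_diff real_polynomial_function_power)
next
  case (Chavarriga a)
  show ?thesis unfolding Chavarriga
    apply (rule invariant_algebraic_curveI[where u=1 and v=0 and
       ?k0.0=10 and ?k1.0=18 and ?k2.0="10+12*a"])
        apply (rule derivative_eq_intros refl)+
      apply simp
     apply (simp, algebra)
    unfolding case_prod_unfold
    by (intro real_polynomial_function.intros(2-4) real_polynomial_function_fst_snd
          real_polynomial_function_diff real_polynomial_function_power)
next
  case (Chavarriga_Llibre_Sorolla a)
  show ?thesis unfolding Chavarriga_Llibre_Sorolla
    apply (rule invariant_algebraic_curveI[where u=0 and v=0 and
       ?k0.0=8 and ?k1.0="-12*a" and ?k2.0=8])
        apply (rule derivative_eq_intros refl)+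
      apply simp
     apply (simp add: field_simps, algebra)
    unfolding case_prod_unfold
    by (intro real_polynomial_function.intros(2-4) real_polynomial_function_fst_snd
          real_polynomial_function_diff real_polynomial_function_power)
next
  case (Christopher_Llibre_Swirszcz_5 a)
  then have ne: "a + 4 \<noteq> 0" by simp
  show ?thesis unfolding Christopher_Llibre_Swirszcz_5
    apply (rule invariant_algebraic_curveI[where u=1 and v=0 and u'="-1" and v'=0 and
       ?k0.0=56 and ?k1.0="6*(16-a^2)*(a+12)" and ?k2.0="52*a-96"])
        apply (rule derivative_eq_intros refl)+
      apply simp
    subgoal using ne by (simp add: divide_simps, algebra)
    unfolding case_prod_unfold
    by (intro real_polynomial_function.intros(2-4) real_polynomial_function_fst_snd
          real_polynomial_function_diff real_polynomial_function_power)
next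
  case (Christopher_Llibre_Swirszcz_6 a)
  show ?thesis unfolding Christopher_Llibre_Swirszcz_6
    apply (rule invariant_algebraic_curveI[where u=0 and v=1 and u'=0 and v'="-1" and
       ?k0.0="168*a*(a-30)" and ?k1.0="1008*a^2" and ?k2.0=18])
        apply (rule derivative_eq_intros refl)+
      apply simp
     apply (simp, algebra)
    unfolding case_prod_unfold
    by (intro real_polynomial_function.intros(2-4) real_polynomial_function_fst_snd
          real_polynomial_function_diff real_polynomial_function_power)
next
  case (Alberich_Ferragut_Llibre a)
  then have ne: "a \<noteq> 0" by simp
  show ?thesis unfolding Alberich_Ferragut_Llibre
    apply (rule invariant_algebraic_curveI[where u=0 and v=1 and u'=0 and v'="-1" and
       ?k0.0="-56" and ?k1.0="304-26*a" and ?k2.0="3/4*a*(a^2-256)"])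
        apply (rule derivative_eq_intros refl)+
    using Alberich_Ferragut_Llibre apply simp
    subgoal using ne by (simp add: divide_simps, algebra)
    unfolding case_prod_unfold
    by (intro real_polynomial_function.intros(2-4) real_polynomial_function_fst_snd
          real_polynomial_function_diff real_polynomial_function_power)
qed

end

theory Submission
  imports Defs
begin

text \<open>Let \<open>k\<close> be the cofactor of \<open>f\<close>. On a periodic orbit off the curve, \<open>ln \<bar>f\<bar>\<close> is periodic with
  derivative \<open>k\<close>. If \<open>W' = c k W + N\<close> along solutions with \<open>N\<close> of one sign, then \<open>W exp (- c ln \<bar>f\<bar>)\<close> is
  periodic and monotone, so \<open>N\<close> vanishes on the orbit. In Cases 1, 4, 5, 6 and 8, \<open>P\<close> and \<open>Q\<close> are
  proportional on the line \<open>k = 0\<close>; a linear \<open>W\<close> then gives \<open>N\<close> proportional to \<open>k\<^sup>2\<close>. In Cases 2, 3 and 7,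
  \<open>P\<close> divides \<open>Q\<close> on this line, and a quadratic \<open>W\<close> gives, in Cases 2 and 7, a multiple of the square of
  an affine form. As no periodic orbit lies on a line, none exists off the curve. In Case 3, \<open>W\<close> is corrected by
  a multiple of \<open>z powr (4/3)\<close>, where \<open>z = 1 + 6 x\<close>, if \<open>z > 0\<close>; if \<open>z < 0\<close>, the only equilibrium that an orbit
  could wind around is a saddle. The method fails for Case 1 with \<open>a = 0\<close> and Case 2 with \<open>c = 0\<close>: these
  fields are reversible, and their periodic orbits off the curve fill annuli, so they are not isolated.

  On the curve, \<open>f = 0\<close> is quadratic in one variable with coefficients depending on another variable \<open>s\<close>: a
  coordinate, or a coordinate of the blow-up of the singular point at the origin. Along an orbit, \<open>s\<close> is
  extremal only where the quadratic has a double root, and the discriminant contributes at most three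
  such points. Minimum and maximum of \<open>s\<close> on two orbits are thus among three points, so the orbits meet and
  coincide.\<close>

subsection \<open>Scalar functions of time\<close>

text \<open>Origin of the test functions. If p P + q Q vanishes on the line k = 0, it is k times an
  affine form, which is expanded in W = p x + q y, 1 and k; the excluded values -10/3, -3 and 2 in
  Cases 4, 6 and 8 are those where W and k have parallel linear parts and the expansion fails. In
  Cases 2, 3 and 7, y enters P only through y z with z affine in x; eliminating y by means of k
  gives z' = m k z + D up to the sign of D, with D affine in x. A second function w, linear in y and
  quadratic in x, satisfies w' = c k w plus a multiple of D. The power of z with exponent c / m has
  the weight c too, and its remainder is again divisible by D. This exponent is 2 in Cases 2 and 7,
  where the two remainders combine to a multiple of the square of D; it is 4/3 in Case 3, whence the
  role of the sign of z.

  Polynomial fields need not have global solutions. Existence is needed only for the reversible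
  fields, where new periodic orbits must be produced next to a given one; truncating the field far
  from the orbit makes it bounded and globally Lipschitz there.\<close>

lemma antiderivative:
  fixes g :: "real \<Rightarrow> 'a::euclidean_space"
  assumes "continuous_on UNIV g"
  shows "\<exists>G. G 0 = 0 \<and> (\<forall>t. (G has_vector_derivative g t) (at t))"
proof -
  define G where "G t = (if t \<ge> 0 then integral {0..t} g else - integral {t..0} g)" for t
  have int: "g integrable_on {a..b}" for a b
    by (meson assms continuous_on_subset integrable_continuous_real subset_UNIV)
  have G_eq: "G t = integral {-N..t} g - integral {-N..0} g" if "-N \<le> t" "0 \<le> N" for N t
  proof (cases "t \<ge> 0")
    case True
    show ?thesis
      using Henstock_Kurzweil_Integration.integral_combine[of "-N" 0 t g] that True int
      by (simp add: G_def algebra_simps)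
  next
    case False
    show ?thesis
      using Henstock_Kurzweil_Integration.integral_combine[of "-N" t 0 g] that False int
      by (simp add: G_def algebra_simps)
  qed
  have "(G has_vector_derivative g t) (at t)" for t
  proof -
    define N where "N = \<bar>t\<bar> + 1"
    have "((\<lambda>u. integral {-N..u} g) has_vector_derivative g t) (at t within {-N..N})"
      by (rule integral_has_vector_derivative) (use assms continuous_on_subset N_def in auto)
    then have "((\<lambda>u. integral {-N..u} g) has_vector_derivative g t) (at t)"
      by (subst (asm) at_within_interior) (auto simp: N_def)
    then have "((\<lambda>u. integral {-N..u} g - integral {-N..0} g) has_vector_derivative g t) (at t)"
      by (auto intro!: derivative_eq_intros)
    then show ?thesis
    proof (rule has_vector_derivative_transform_within_open[where S = "{-N<..<N}"])
      fix u assume "u \<in> {-N<..<N}"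
      then have "- N \<le> u" "0 \<le> N" by auto
      then show "integral {-N..u} g - integral {-N..0} g = G u" by (rule G_eq[symmetric])
    qed (auto simp: N_def)
  qed
  moreover have "G 0 = 0" by (simp add: G_def)
  ultimately show ?thesis by blast
qed

lemma antiderivative_real:
  fixes g :: "real \<Rightarrow> real"
  assumes "continuous_on UNIV g"
  obtains G where "G 0 = 0" "\<And>t. (G has_real_derivative g t) (at t)"
  using antiderivative[OF assms] by (auto simp: has_real_derivative_iff_has_vector_derivative)

text \<open>\<open>h\<close> is nondecreasing and takes equal values at \<open>t - T/2\<close> and
  \<open>t + T/2\<close>, so it is constant in between.\<close>

lemma periodic_derivative_nonneg:
  fixes h :: "real \<Rightarrow> real"
  assumes d: "\<And>t. (h has_real_derivative n t) (at t)" and nn: "\<And>t. n t \<ge> 0"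
    and T: "T > 0" "\<And>t. h (t + T) = h t"
  shows "n t = 0"
proof -
  have mono: "h a \<le> h b" if "a \<le> b" for a b
    by (rule DERIV_nonneg_imp_nondecreasing[OF that]) (use d nn in blast)
  have eq: "h (t + T/2) = h (t - T/2)" using T(2)[of "t - T/2"] by (simp add: algebra_simps)
  have "h t = h s" if "\<bar>t - s\<bar> < T/2" for s
    using mono[of "t - T/2" t] mono[of t "t + T/2"] mono[of "t - T/2" s] mono[of s "t + T/2"] that eq T(1)
    by linarith
  then show ?thesis using DERIV_local_const[OF d[of t], of "T/2"] T(1) by simp
qed

lemma periodic_derivative_one_sign:
  fixes h :: "real \<Rightarrow> real"
  assumes d: "\<And>t. (h has_real_derivative n t) (at t)"
    and n: "(\<forall>t. n t \<ge> 0) \<or> (\<forall>t. n t \<le> 0)"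
    and T: "T > 0" "\<And>t. h (t + T) = h t"
  shows "n t = 0"
  using n
proof
  assume "\<forall>t. n t \<ge> 0"
  then show ?thesis using periodic_derivative_nonneg[OF d _ T] by blast
next
  assume "\<forall>t. n t \<le> 0"
  then have "- n t = 0"
    by (intro periodic_derivative_nonneg[where h = "\<lambda>t. - h t" and T = T])
      (auto intro!: derivative_eq_intros d simp: T)
  then show ?thesis by simp
qed

text \<open>After a zero \<open>h\<close> is positive, and it has to come back to zero within one
  period. Just before its first later zero it is negative, so by the intermediate value theorem
  there is a still earlier one. The offset \<open>r\<close> keeps the initial zero out of the
  compact set in which the first later zero is sought.\<close>

lemma periodic_no_zero_pos:
  fixes h :: "real \<Rightarrow> real"
  assumes d: "\<And>t. (h has_real_derivative n t) (at t)"
    and T: "T > 0" "\<And>t. h (t + T) = h t"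
    and cross: "\<And>t. h t = 0 \<Longrightarrow> n t > 0"
  shows "h t \<noteq> 0"
proof
  assume z: "h t = 0"
  have cont: "continuous_on S h" for S
    by (meson DERIV_continuous continuous_at_imp_continuous_on d)
  obtain e where e: "e > 0" "\<And>s. 0 < s \<Longrightarrow> s < e \<Longrightarrow> h t < h (t + s)"
    using DERIV_pos_inc_right[OF d cross[OF z]] by blast
  define r where "r = min (e/2) (T/2)"
  have r: "0 < r" "r < e" "r < T" using e T by (auto simp: r_def)
  define S where "S = {t + r..t + T} \<inter> {s. h s = 0}"
  have "S = {s \<in> {t + r..t + T}. h s = 0}" by (auto simp: S_def)
  then have "closed S" using continuous_closed_preimage_constant[OF cont, of "{t + r..t + T}" 0] by auto
  then have "compact S" by (simp add: S_def compact_Int_closed closed_Int_compact bounded_Int compact_eq_bounded_closed)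
  moreover have "t + T \<in> S" using z T r by (simp add: S_def)
  ultimately obtain s where s: "s \<in> S" "\<And>u. u \<in> S \<Longrightarrow> s \<le> u"
    using compact_attains_inf[of S] by blast
  have hs: "h s = 0" "t + r \<le> s" "s \<le> t + T" using s by (auto simp: S_def)
  have pos: "h (t + r) > 0" using e(2)[of r] r z by simp
  obtain e' where e': "e' > 0" "\<And>u. 0 < u \<Longrightarrow> u < e' \<Longrightarrow> h (s - u) < h s"
    using DERIV_pos_inc_left[OF d cross[OF hs(1)]] by blast
  have "t + r < s" using pos hs by (metis less_eq_real_def less_irrefl)
  define u where "u = min (e'/2) ((s - (t + r))/2)"
  have u: "0 < u" "u < e'" "t + r \<le> s - u" using e' \<open>t + r < s\<close> by (auto simp: u_def min_def field_simps)
  have "h (s - u) < 0" using e'(2) u hs by simp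
  then obtain v where "t + r \<le> v" "v \<le> s - u" "h v = 0"
    using IVT2'[of h "s - u" 0 "t + r"] pos u(3) cont by force
  then have "v \<in> S" using hs u by (auto simp: S_def)
  then show False using s(2) \<open>v \<le> s - u\<close> u by force
qed

lemma periodic_no_zero:
  fixes h :: "real \<Rightarrow> real"
  assumes d: "\<And>t. (h has_real_derivative n t) (at t)"
    and T: "T > 0" "\<And>t. h (t + T) = h t"
    and cross: "(\<forall>t. h t = 0 \<longrightarrow> n t > 0) \<or> (\<forall>t. h t = 0 \<longrightarrow> n t < 0)"
  shows "h t \<noteq> 0"
  using cross
proof
  assume "\<forall>t. h t = 0 \<longrightarrow> n t > 0"
  then show ?thesis using periodic_no_zero_pos[OF d T] by blast
next
  assume "\<forall>t. h t = 0 \<longrightarrow> n t < 0"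
  then have "- h t \<noteq> 0"
    by (intro periodic_no_zero_pos[where h = "\<lambda>t. - h t" and T = T and n = "\<lambda>t. - n t"])
      (auto intro!: derivative_eq_intros d simp: T)
  then show ?thesis by simp
qed

lemma nonzero_imp_one_sign:
  fixes h :: "real \<Rightarrow> real"
  assumes "continuous_on UNIV h" and nz: "\<And>t. h t \<noteq> 0"
  shows "(\<forall>t. h t > 0) \<or> (\<forall>t. h t < 0)"
proof (rule ccontr)
  assume "\<not> ?thesis"
  then obtain s t where "h s < 0" "h t > 0" using nz by (meson linorder_cases not_less)
  have "connected (range h)" by (rule connected_continuous_image[OF assms(1) connected_UNIV])
  then have "0 \<in> range h"
    using \<open>h s < 0\<close> \<open>h t > 0\<close> unfolding connected_iff_interval by (meson less_imp_le rangeI)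
  then show False using nz by auto
qed

text \<open>The integrating factor \<open>exp (- K)\<close> makes \<open>h\<close> constant. This is
  what separates orbits on an invariant curve from orbits that miss it.\<close>

lemma linear_ode_zero:
  fixes h :: "real \<Rightarrow> real"
  assumes d: "\<And>t. (h has_real_derivative k t * h t) (at t)"
    and k: "continuous_on UNIV k" and z: "h s = 0"
  shows "h t = 0"
proof -
  obtain K where K: "\<And>t. (K has_real_derivative k t) (at t)" using antiderivative_real[OF k] by metis
  have "\<forall>t. ((\<lambda>t. h t * exp (- K t)) has_real_derivative 0) (at t)"
    by (auto intro!: derivative_eq_intros d K)
  then have "h t * exp (- K t) = h s * exp (- K s)" by (rule DERIV_isconst_all)
  then show ?thesis using z by simp
qed

subsection \<open>Flows of Lipschitz fields\<close>

definition solves :: "('a::real_normed_vector \<Rightarrow> 'a) \<Rightarrow> (real \<Rightarrow> 'a) \<Rightarrow> bool"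
  where "solves V \<gamma> \<longleftrightarrow> (\<forall>t. (\<gamma> has_vector_derivative V (\<gamma> t)) (at t))"

lemma solves_shift: "solves V \<gamma> \<Longrightarrow> solves V (\<lambda>t. \<gamma> (t + s))"
  unfolding solves_def
proof
  fix t assume "\<forall>t. (\<gamma> has_vector_derivative V (\<gamma> t)) (at t)"
  then have "(\<gamma> has_vector_derivative V (\<gamma> (t + s))) (at (t + s))" by blast
  moreover have "((\<lambda>t. t + s) has_vector_derivative 1) (at t)"
    by (auto intro!: derivative_eq_intros)
  ultimately have "(\<gamma> \<circ> (\<lambda>t. t + s) has_vector_derivative 1 *\<^sub>R V (\<gamma> (t + s))) (at t)"
    by (intro vector_diff_chain_at)
  then show "((\<lambda>t. \<gamma> (t + s)) has_vector_derivative V (\<gamma> (t + s))) (at t)" by (simp add: o_def)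
qed

lemma solves_reverse: "solves V \<gamma> \<Longrightarrow> solves (\<lambda>z. - V z) (\<lambda>t. \<gamma> (- t))"
  unfolding solves_def
proof
  fix t assume "\<forall>t. (\<gamma> has_vector_derivative V (\<gamma> t)) (at t)"
  then have "(\<gamma> has_vector_derivative V (\<gamma> (-t))) (at (- t))" by blast
  moreover have "(uminus has_vector_derivative -1) (at t)"
    by (auto intro!: derivative_eq_intros)
  ultimately have "(\<gamma> \<circ> uminus has_vector_derivative (-1) *\<^sub>R V (\<gamma> (-t))) (at t)"
    by (intro vector_diff_chain_at)
  then show "((\<lambda>t. \<gamma> (- t)) has_vector_derivative - V (\<gamma> (- t))) (at t)" by (simp add: o_def)
qed

lemma solves_continuous: "solves V \<gamma> \<Longrightarrow> continuous_on S \<gamma>"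
  unfolding solves_def
  by (meson continuous_at_imp_continuous_on has_vector_derivative_continuous)

text \<open>The squared distance is used because it is differentiable even where the solutions meet;
  with the weight \<open>exp (- 2 * L * t)\<close> it is nonincreasing, by Cauchy-Schwarz and the
  Lipschitz bound.\<close>

lemma gronwall:
  fixes V :: "'a::euclidean_space \<Rightarrow> 'a"
  assumes lip: "\<And>z w. dist (V z) (V w) \<le> L * dist z w"
    and s: "solves V \<gamma>" "solves V \<delta>" and t: "t \<ge> 0"
  shows "dist (\<gamma> t) (\<delta> t) \<le> exp (L * t) * dist (\<gamma> 0) (\<delta> 0)"
proof -
  define u where "u t = \<gamma> t - \<delta> t" for t
  define g where "g t = exp (- 2 * L * t) * (u t \<bullet> u t)" for t
  have u: "(u has_vector_derivative V (\<gamma> t) - V (\<delta> t)) (at t)" for t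
    unfolding u_def using s by (auto intro!: derivative_eq_intros simp: solves_def)
  have ip: "((\<lambda>t. u t \<bullet> u t) has_real_derivative 2 * (u t \<bullet> (V (\<gamma> t) - V (\<delta> t)))) (at t)" for t
    using has_derivative_inner[OF u[unfolded has_vector_derivative_def] u[unfolded has_vector_derivative_def]]
    unfolding has_field_derivative_def
    by (rule back_subst[of "\<lambda>f. (_ has_derivative f) _"]) (auto simp: inner_commute algebra_simps)
  have "(g has_real_derivative exp (- 2 * L * t) * (2 * (u t \<bullet> (V (\<gamma> t) - V (\<delta> t))) - 2 * L * (u t \<bullet> u t))) (at t)" for t
  proof -
    have "((\<lambda>t. exp (- 2 * L * t)) has_real_derivative exp (- 2 * L * t) * (- 2 * L)) (at t)"
      by (auto intro!: derivative_eq_intros)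
    from DERIV_mult[OF this ip[of t]] show ?thesis unfolding g_def by (simp add: algebra_simps)
  qed
  moreover have "exp (- 2 * L * t) * (2 * (u t \<bullet> (V (\<gamma> t) - V (\<delta> t))) - 2 * L * (u t \<bullet> u t)) \<le> 0" for t
  proof -
    have "u t \<bullet> (V (\<gamma> t) - V (\<delta> t)) \<le> norm (u t) * norm (V (\<gamma> t) - V (\<delta> t))"
      by (rule norm_cauchy_schwarz)
    also have "\<dots> \<le> norm (u t) * (L * norm (u t))"
      using lip[of "\<gamma> t" "\<delta> t"] by (intro mult_left_mono) (simp_all add: dist_norm u_def)
    also have "\<dots> = L * (u t \<bullet> u t)" by (simp add: dot_square_norm power2_eq_square)
    finally have "2 * (u t \<bullet> (V (\<gamma> t) - V (\<delta> t))) - 2 * L * (u t \<bullet> u t) \<le> 0" by linarith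
    from mult_nonneg_nonpos[OF exp_ge_zero this] show ?thesis .
  qed
  ultimately have "\<exists>y. (g has_real_derivative y) (at t) \<and> y \<le> 0" for t by blast
  then have "g t \<le> g 0" using DERIV_nonpos_imp_nonincreasing[OF t, of g] by blast
  then have "u t \<bullet> u t \<le> exp (2 * L * t) * (u 0 \<bullet> u 0)"
    by (simp add: g_def exp_minus divide_simps mult.commute)
  then have "(norm (u t))\<^sup>2 \<le> (exp (L * t) * norm (u 0))\<^sup>2"
    by (simp add: dot_square_norm power_mult_distrib exp_double[symmetric] mult.assoc)
  then have "norm (u t) \<le> exp (L * t) * norm (u 0)" by (rule power2_le_imp_le) simp
  then show ?thesis by (simp add: u_def dist_norm)
qed

text \<open>The Gronwall bound runs forward from time 0. A shift moves the common point to time 0,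
  and earlier times are reached through the reversed field.\<close>

lemma solves_unique:
  fixes V :: "'a::euclidean_space \<Rightarrow> 'a"
  assumes lip: "\<And>z w. dist (V z) (V w) \<le> L * dist z w"
    and s: "solves V \<gamma>" "solves V \<delta>" and eq: "\<gamma> s = \<delta> s"
  shows "\<gamma> t = \<delta> t"
proof (cases "t \<ge> s")
  case True
  have "dist (\<gamma> (t - s + s)) (\<delta> (t - s + s)) \<le> exp (L * (t - s)) * dist (\<gamma> (0 + s)) (\<delta> (0 + s))"
    using True by (intro gronwall[OF lip solves_shift[OF s(1), of s] solves_shift[OF s(2), of s]]) auto
  then show ?thesis using eq by simp
next
  case False
  have "dist (\<gamma> (- (s - t + - s))) (\<delta> (- (s - t + - s)))
      \<le> exp (L * (s - t)) * dist (\<gamma> (- (0 + - s))) (\<delta> (- (0 + - s)))"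
    by (rule gronwall[of "\<lambda>z. - V z", OF _ solves_shift[OF solves_reverse[OF s(1)], of "-s"]
          solves_shift[OF solves_reverse[OF s(2)], of "-s"]])
      (use False lip in \<open>simp_all add: dist_minus\<close>)
  then show ?thesis using eq by simp
qed

text \<open>The bound depends on the absolute value of time so that the Picard iteration below can
  treat both time directions at once; negative times are reduced to positive ones by reflecting
  \<open>G\<close>.\<close>

lemma antiderivative_bound:
  fixes G :: "real \<Rightarrow> 'a::real_normed_vector"
  assumes G: "G 0 = 0" "\<And>t. (G has_vector_derivative g t) (at t)"
    and \<Phi>: "\<And>t. (\<Phi> has_real_derivative \<phi> t) (at t)" and b: "\<And>t. norm (g t) \<le> \<phi> \<bar>t\<bar>"
  shows "norm (G t) \<le> \<Phi> \<bar>t\<bar> - \<Phi> 0"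
proof -
  have c: "continuous_on S G" "continuous_on S \<Phi>" for S
    using G \<Phi> by (meson continuous_at_imp_continuous_on has_vector_derivative_continuous DERIV_continuous)+
  have pos: "norm (H s - H 0) \<le> \<Phi> s - \<Phi> 0"
    if H: "\<And>t. (H has_vector_derivative h t) (at t)" and n: "\<And>t. norm (h t) \<le> \<phi> \<bar>t\<bar>" and s: "s > 0"
    for H :: "real \<Rightarrow> 'a" and h s
  proof (rule differentiable_bound_general[OF s _ c(2)])
    show "continuous_on {0..s} H"
      using H by (meson continuous_at_imp_continuous_on has_vector_derivative_continuous)
    show "norm (h x) \<le> \<phi> x" if "0 < x" for x using n[of x] that by simp
  qed (use H \<Phi> in \<open>auto simp: has_real_derivative_iff_has_vector_derivative[symmetric]\<close>)
  have neg: "((\<lambda>t. G (- t)) has_vector_derivative - g (- t)) (at t)" for t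
  proof -
    have "(uminus has_vector_derivative -1) (at t)" by (auto intro!: derivative_eq_intros)
    then have "(G \<circ> uminus has_vector_derivative (-1) *\<^sub>R g (-t)) (at t)"
      using G(2) by (intro vector_diff_chain_at)
    then show ?thesis by (simp add: o_def)
  qed
  consider "t > 0" | "t = 0" | "t < 0" by linarith
  then show ?thesis
  proof cases
    case 1
    then show ?thesis using pos[OF G(2) b, of t] G(1) by simp
  next
    case 2
    then show ?thesis using G(1) by simp
  next
    case 3
    have "norm (- g (- t)) \<le> \<phi> \<bar>t\<bar>" for t using b[of "-t"] by simp
    then show ?thesis using pos[OF neg, of "-t"] G(1) 3 by simp
  qed
qed

text \<open>Picard iteration in the weight \<open>exp (-2 L \<bar>t\<bar>)\<close>, for which it contracts by 1/2 on the whole line.\<close>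

lemma lipschitz_bounded_flow_exists:
  fixes V :: "'a::euclidean_space \<Rightarrow> 'a"
  assumes L: "L > 0" and lip: "\<And>z w. dist (V z) (V w) \<le> L * dist z w" and bnd: "\<And>z. norm (V z) \<le> B"
  obtains \<delta> where "\<delta> 0 = p" "solves V \<delta>"
proof -
  have B: "B \<ge> 0" using bnd norm_ge_zero order_trans by blast
  define AD :: "(real \<Rightarrow> 'a) \<Rightarrow> real \<Rightarrow> 'a" where
    "AD g = (SOME G. G 0 = 0 \<and> (\<forall>t. (G has_vector_derivative g t) (at t)))" for g
  have AD: "AD g 0 = 0" "\<And>t. (AD g has_vector_derivative g t) (at t)" if "continuous_on UNIV g" for g
    using someI_ex[OF antiderivative[OF that]] unfolding AD_def by blast+
  \<comment> \<open>The unknown \<phi> is the displacement \<delta> - p divided by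
    \<open>exp (2 * L * \<bar>s\<bar>)\<close>. As \<open>V\<close> is bounded, displacements grow
    at most linearly, so \<phi> lies in the complete space of bounded continuous functions.\<close>
  define W where "W \<phi> s = V (p + exp (2 * L * \<bar>s\<bar>) *\<^sub>R \<phi> s)" for \<phi> s
  have "L-lipschitz_on UNIV V" using lip L by (intro lipschitz_onI) auto
  then have contV: "continuous_on UNIV V" by (rule lipschitz_on_continuous_on)
  have contW: "continuous_on UNIV (W \<phi>)" if "continuous_on UNIV \<phi>" for \<phi>
    unfolding W_def
    by (rule continuous_on_compose2[OF contV]) (auto intro!: continuous_intros that)
  define T where "T \<phi> t = exp (- 2 * L * \<bar>t\<bar>) *\<^sub>R AD (W \<phi>) t" for \<phi> t
  have Tbc: "T \<phi> \<in> bcontfun" if "continuous_on UNIV \<phi>" for \<phi>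
  proof (rule bcontfun_normI)
    have "continuous_on UNIV (AD (W \<phi>))"
      using AD(2)[OF contW[OF that]]
      by (meson continuous_at_imp_continuous_on has_vector_derivative_continuous)
    then show "continuous_on UNIV (T \<phi>)" unfolding T_def by (auto intro!: continuous_intros)
    fix t
    have "norm (AD (W \<phi>) t) \<le> B * \<bar>t\<bar> - B * 0"
      by (rule antiderivative_bound[OF AD[OF contW[OF that]], where \<phi> = "\<lambda>_. B"])
        (auto intro!: derivative_eq_intros simp: W_def bnd)
    moreover have "2 * L * \<bar>t\<bar> \<le> exp (2 * L * \<bar>t\<bar>)"
      using exp_ge_add_one_self[of "2 * L * \<bar>t\<bar>"] by linarith
    then have "B * \<bar>t\<bar> \<le> (B / (2 * L)) * exp (2 * L * \<bar>t\<bar>)"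
      using mult_left_mono[of "2 * L * \<bar>t\<bar>" _ "B / (2 * L)"] B L by simp
    ultimately have "norm (AD (W \<phi>) t) \<le> (B / (2 * L)) * exp (2 * L * \<bar>t\<bar>)" by simp
    then have "exp (- 2 * L * \<bar>t\<bar>) * norm (AD (W \<phi>) t)
        \<le> exp (- 2 * L * \<bar>t\<bar>) * ((B / (2 * L)) * exp (2 * L * \<bar>t\<bar>))"
      by (intro mult_left_mono) auto
    also have "\<dots> = B / (2 * L)" by (simp add: exp_minus)
    finally show "norm (T \<phi> t) \<le> B / (2 * L)" by (simp add: T_def)
  qed
  define F :: "(real \<Rightarrow>\<^sub>C 'a) \<Rightarrow> (real \<Rightarrow>\<^sub>C 'a)" where "F \<phi> = Bcontfun (T (apply_bcontfun \<phi>))" for \<phi>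
  have F: "apply_bcontfun (F \<phi>) t = T (apply_bcontfun \<phi>) t" for \<phi> t
    unfolding F_def by (simp add: Bcontfun_inverse Tbc continuous_on_apply_bcontfun)
  have "dist (F \<phi>) (F \<psi>) \<le> 1/2 * dist \<phi> \<psi>" for \<phi> \<psi>
  proof (rule dist_bound)
    fix t
    define d where "d = dist \<phi> \<psi>"
    have d: "norm (apply_bcontfun \<phi> s - apply_bcontfun \<psi> s) \<le> d" "d \<ge> 0" for s
      using dist_bounded[of \<phi> s \<psi>] by (auto simp: d_def dist_norm)
    have c: "continuous_on UNIV (W (apply_bcontfun \<phi>))" "continuous_on UNIV (W (apply_bcontfun \<psi>))"
      by (auto intro!: contW continuous_on_apply_bcontfun)
    define G where "G t = AD (W (apply_bcontfun \<phi>)) t - AD (W (apply_bcontfun \<psi>)) t" for t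
    \<comment> \<open>The contraction factor 1/2 comes from here: integrating L d exp(2 L s) gives
      d/2 times the same exponential, and the weight cancels it.\<close>
    have "norm (G t) \<le> d/2 * exp (2 * L * \<bar>t\<bar>) - d/2 * exp (2 * L * 0)"
    proof (rule antiderivative_bound[where \<phi> = "\<lambda>s. L * (exp (2 * L * s) * d)"])
      show "G 0 = 0" by (simp add: G_def AD c)
      show "(G has_vector_derivative W (apply_bcontfun \<phi>) t - W (apply_bcontfun \<psi>) t) (at t)" for t
        unfolding G_def by (auto intro!: derivative_intros AD c)
      show "((\<lambda>s. d/2 * exp (2 * L * s)) has_real_derivative L * (exp (2 * L * t) * d)) (at t)" for t
        by (auto intro!: derivative_eq_intros)
      fix s
      have "norm (W (apply_bcontfun \<phi>) s - W (apply_bcontfun \<psi>) s)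
          \<le> L * dist (p + exp (2 * L * \<bar>s\<bar>) *\<^sub>R apply_bcontfun \<phi> s) (p + exp (2 * L * \<bar>s\<bar>) *\<^sub>R apply_bcontfun \<psi> s)"
        unfolding W_def using lip[of "p + exp (2 * L * \<bar>s\<bar>) *\<^sub>R apply_bcontfun \<phi> s"] by (simp only: dist_norm)
      also have "\<dots> = L * (exp (2 * L * \<bar>s\<bar>) * norm (apply_bcontfun \<phi> s - apply_bcontfun \<psi> s))"
        by (simp add: dist_norm norm_scaleR flip: scaleR_diff_right)
      also have "\<dots> \<le> L * (exp (2 * L * \<bar>s\<bar>) * d)"
        using d L by (intro mult_left_mono) auto
      finally show "norm (W (apply_bcontfun \<phi>) s - W (apply_bcontfun \<psi>) s) \<le> L * (exp (2 * L * \<bar>s\<bar>) * d)" .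
    qed
    also have "\<dots> \<le> d/2 * exp (2 * L * \<bar>t\<bar>)" using d by simp
    finally have "exp (- 2 * L * \<bar>t\<bar>) * norm (G t) \<le> exp (- 2 * L * \<bar>t\<bar>) * (d/2 * exp (2 * L * \<bar>t\<bar>))"
      by (intro mult_left_mono) auto
    also have "\<dots> = d / 2" by (simp add: exp_minus)
    finally show "dist (apply_bcontfun (F \<phi>) t) (apply_bcontfun (F \<psi>) t) \<le> 1/2 * dist \<phi> \<psi>"
      by (simp add: F T_def G_def dist_norm d_def flip: scaleR_diff_right)
  qed
  then obtain \<phi> where \<phi>: "F \<phi> = \<phi>" using banach_fix_type[of "1/2" F] by auto
  define \<delta> where "\<delta> t = p + AD (W (apply_bcontfun \<phi>)) t" for t
  have c: "continuous_on UNIV (W (apply_bcontfun \<phi>))" by (auto intro!: contW continuous_on_apply_bcontfun)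
  have "W (apply_bcontfun \<phi>) t = V (\<delta> t)" for t
  proof -
    have "apply_bcontfun \<phi> t = exp (- 2 * L * \<bar>t\<bar>) *\<^sub>R AD (W (apply_bcontfun \<phi>)) t"
      using F[of \<phi> t] \<phi> by (simp add: T_def)
    then have "exp (2 * L * \<bar>t\<bar>) *\<^sub>R apply_bcontfun \<phi> t = AD (W (apply_bcontfun \<phi>)) t"
      by (metis exp_minus_inverse minus_mult_left scaleR_one scaleR_scaleR)
    then show ?thesis by (simp add: W_def \<delta>_def)
  qed
  moreover have "(\<delta> has_vector_derivative W (apply_bcontfun \<phi>) t) (at t)" for t
    unfolding \<delta>_def using AD(2)[OF c] by (auto intro!: derivative_eq_intros)
  ultimately have "solves V \<delta>" by (simp add: solves_def)
  moreover have "\<delta> 0 = p" by (simp add: \<delta>_def AD c)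
  ultimately show thesis using that by blast
qed

subsection \<open>Polynomial fields, made globally Lipschitz by clamping\<close>

text \<open>Coordinatewise truncation is 1-Lipschitz, is the identity on the ball of radius
  \<open>R\<close>, and for nonnegative \<open>R\<close> commutes with the reflections in the
  coordinate axes, as the reversible fields require.\<close>

definition clamp2 :: "real \<Rightarrow> real \<times> real \<Rightarrow> real \<times> real"
  where "clamp2 R z = (max (- R) (min R (fst z)), max (- R) (min R (snd z)))"

lemma clamp2_id: "norm z \<le> R \<Longrightarrow> clamp2 R z = z"
proof -
  assume "norm z \<le> R"
  then have "\<bar>fst z\<bar> \<le> R" "\<bar>snd z\<bar> \<le> R"
    using norm_fst_le[of "fst z" "snd z"] norm_snd_le[of "snd z" "fst z"] by auto
  then show ?thesis by (cases z) (auto simp: clamp2_def)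
qed

lemma dist_clamp2: "dist (clamp2 R z) (clamp2 R w) \<le> dist z w"
proof -
  have *: "\<bar>max (- R) (min R a) - max (- R) (min R b)\<bar> \<le> \<bar>a - b\<bar>" for a b by linarith
  have "(max (- R) (min R a) - max (- R) (min R b))\<^sup>2 \<le> (a - b)\<^sup>2" for a b
    using *[of a b] by (rule abs_le_square_iff[THEN iffD1])
  then show ?thesis
    unfolding clamp2_def dist_prod_def dist_real_def fst_conv snd_conv power2_abs
    by (intro real_sqrt_le_mono add_mono) blast+
qed

lemma norm_clamp2: "R \<ge> 0 \<Longrightarrow> norm (clamp2 R z) \<le> 2 * R"
proof -
  assume R: "R \<ge> 0"
  have "norm (clamp2 R z) \<le> norm (fst (clamp2 R z)) + norm (snd (clamp2 R z))"
    using norm_Pair_le[of "fst (clamp2 R z)" "snd (clamp2 R z)"] by simp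
  also have "\<dots> \<le> R + R" using R by (intro add_mono) (auto simp: clamp2_def)
  finally show ?thesis by simp
qed

text \<open>The bound and the Lipschitz constant are proved together because the Lipschitz constant
  of a product involves bounds for both factors.\<close>

lemma polynomial_clamp2_lipschitz:
  fixes f :: "real \<times> real \<Rightarrow> real"
  assumes "real_polynomial_function f" and R: "R \<ge> 0"
  shows "\<exists>B L. \<forall>z w. \<bar>f (clamp2 R z)\<bar> \<le> B \<and> \<bar>f (clamp2 R z) - f (clamp2 R w)\<bar> \<le> L * dist z w"
  using assms(1)
proof induction
  case (linear f)
  obtain K where K: "K \<ge> 0" "\<And>z. norm (f z) \<le> norm z * K" using bounded_linear.nonneg_bounded[OF linear] by blast
  have "\<bar>f (clamp2 R z)\<bar> \<le> 2 * R * K" for z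
    using K(2)[of "clamp2 R z"] mult_right_mono[OF norm_clamp2[OF R, of z] K(1)] by simp
  moreover have "\<bar>f (clamp2 R z) - f (clamp2 R w)\<bar> \<le> K * dist z w" for z w
    using K(2)[of "clamp2 R z - clamp2 R w"] mult_left_mono[OF dist_clamp2[of R z w] K(1)]
    by (simp add: dist_norm mult.commute flip: linear_diff[OF bounded_linear.linear[OF linear]])
  ultimately show ?case by blast
next
  case (const c)
  then show ?case by (intro exI[of _ "\<bar>c\<bar>"] exI[of _ 0]) simp
next
  case (add f g)
  then obtain B L B' L' where
    "\<And>z w. \<bar>f (clamp2 R z)\<bar> \<le> B" "\<And>z w. \<bar>f (clamp2 R z) - f (clamp2 R w)\<bar> \<le> L * dist z w"
    "\<And>z w. \<bar>g (clamp2 R z)\<bar> \<le> B'" "\<And>z w. \<bar>g (clamp2 R z) - g (clamp2 R w)\<bar> \<le> L' * dist z w" by blast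
  note * = this
  have "\<bar>f (clamp2 R z) + g (clamp2 R z)\<bar> \<le> B + B'" for z
    using *(1)[of z] *(3)[of z] by linarith
  moreover have "\<bar>f (clamp2 R z) + g (clamp2 R z) - (f (clamp2 R w) + g (clamp2 R w))\<bar> \<le> (L + L') * dist z w" for z w
    using *(2)[of z w] *(4)[of z w] unfolding distrib_right by linarith
  ultimately show ?case by blast
next
  case (mult f g)
  then obtain B L B' L' where
    *: "\<And>z w. \<bar>f (clamp2 R z)\<bar> \<le> B" "\<And>z w. \<bar>f (clamp2 R z) - f (clamp2 R w)\<bar> \<le> L * dist z w"
    "\<And>z w. \<bar>g (clamp2 R z)\<bar> \<le> B'" "\<And>z w. \<bar>g (clamp2 R z) - g (clamp2 R w)\<bar> \<le> L' * dist z w" by blast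
  have "\<bar>f (clamp2 R z) * g (clamp2 R z)\<bar> \<le> B * B'" for z
    unfolding abs_mult using *(1)[of z] by (intro mult_mono *) auto
  moreover have "\<bar>f (clamp2 R z) * g (clamp2 R z) - f (clamp2 R w) * g (clamp2 R w)\<bar> \<le> (B * L' + L * B') * dist z w" for z w
  proof -
    have "f (clamp2 R z) * g (clamp2 R z) - f (clamp2 R w) * g (clamp2 R w)
      = f (clamp2 R z) * (g (clamp2 R z) - g (clamp2 R w)) + (f (clamp2 R z) - f (clamp2 R w)) * g (clamp2 R w)"
      by (simp add: algebra_simps)
    also have "\<bar>\<dots>\<bar> \<le> \<bar>f (clamp2 R z)\<bar> * \<bar>g (clamp2 R z) - g (clamp2 R w)\<bar> + \<bar>f (clamp2 R z) - f (clamp2 R w)\<bar> * \<bar>g (clamp2 R w)\<bar>"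
      unfolding abs_mult[symmetric] by (rule abs_triangle_ineq)
    also have "\<dots> \<le> B * (L' * dist z w) + (L * dist z w) * B'"
    proof (rule add_mono)
      show "\<bar>f (clamp2 R z)\<bar> * \<bar>g (clamp2 R z) - g (clamp2 R w)\<bar> \<le> B * (L' * dist z w)"
        using *(1)[of z] by (intro mult_mono *) auto
      show "\<bar>f (clamp2 R z) - f (clamp2 R w)\<bar> * \<bar>g (clamp2 R w)\<bar> \<le> L * dist z w * B'"
        using *(2)[of z w] by (intro mult_mono *) auto
    qed
    finally show ?thesis by (simp add: algebra_simps)
  qed
  ultimately show ?case by blast
qed

lemma polynomial_field_clamp2:
  assumes "real_polynomial_function (\<lambda>(x, y). P x y)" "real_polynomial_function (\<lambda>(x, y). Q x y)"
    and R: "R \<ge> 0"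
  defines "V \<equiv> \<lambda>z. let (x, y) = clamp2 R z in (P x y, Q x y)"
  obtains L B where "L > 0" "\<And>z. norm (V z) \<le> B" "\<And>z w. dist (V z) (V w) \<le> L * dist z w"
proof -
  obtain B1 L1 where 1: "\<And>z. \<bar>(\<lambda>(x, y). P x y) (clamp2 R z)\<bar> \<le> B1"
    "\<And>z w. \<bar>(\<lambda>(x, y). P x y) (clamp2 R z) - (\<lambda>(x, y). P x y) (clamp2 R w)\<bar> \<le> L1 * dist z w"
    using polynomial_clamp2_lipschitz[OF assms(1) R] by blast
  obtain B2 L2 where 2: "\<And>z. \<bar>(\<lambda>(x, y). Q x y) (clamp2 R z)\<bar> \<le> B2"
    "\<And>z w. \<bar>(\<lambda>(x, y). Q x y) (clamp2 R z) - (\<lambda>(x, y). Q x y) (clamp2 R w)\<bar> \<le> L2 * dist z w"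
    using polynomial_clamp2_lipschitz[OF assms(2) R] by blast
  have V: "V z = ((\<lambda>(x, y). P x y) (clamp2 R z), (\<lambda>(x, y). Q x y) (clamp2 R z))" for z
    by (simp add: V_def case_prod_unfold Let_def)
  show thesis
  proof (rule that[of "\<bar>L1\<bar> + \<bar>L2\<bar> + 1" "B1 + B2"])
    show "norm (V z) \<le> B1 + B2" for z
      unfolding V
      by (rule order_trans[OF norm_Pair_le]) (use add_mono[OF 1(1)[of z] 2(1)[of z]] in simp)
    fix z w
    have "dist (V z) (V w) \<le> L1 * dist z w + L2 * dist z w"
      unfolding V dist_norm[of "(_, _)"] diff_Pair
      by (rule order_trans[OF norm_Pair_le])
        (use add_mono[OF 1(2)[of z w] 2(2)[of z w]] in simp)
    also have "\<dots> \<le> (\<bar>L1\<bar> + \<bar>L2\<bar> + 1) * dist z w"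
      by (simp add: mult_right_mono flip: distrib_right)
    finally show "dist (V z) (V w) \<le> (\<bar>L1\<bar> + \<bar>L2\<bar> + 1) * dist z w" .
  qed simp
qed

subsection \<open>Periodic solutions of polynomial fields\<close>

lemma periodic_nat:
  assumes "\<And>t::real. f (t + T) = f t"
  shows "f (t + real n * T) = f t"
proof (induction n)
  case (Suc n)
  have "f (t + real (Suc n) * T) = f ((t + real n * T) + T)" by (simp add: algebra_simps)
  then show ?case using Suc assms by simp
qed simp

lemma periodic_range:
  fixes T :: real
  assumes per: "\<And>t. f (t + T) = f t" and T: "T > 0"
  shows "range f = f ` {0..T}"
proof -
  have "f t \<in> f ` {0..T}" for t
  proof -
    define r where "r = t - of_int \<lfloor>t / T\<rfloor> * T"
    have "of_int \<lfloor>t / T\<rfloor> * T \<le> t" "t < (of_int \<lfloor>t / T\<rfloor> + 1) * T"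
      using T floor_divide_lower floor_divide_upper by auto
    then have r: "r \<in> {0..T}" by (simp add: r_def algebra_simps)
    have "f t = f r"
    proof (cases "\<lfloor>t / T\<rfloor> \<ge> 0")
      case True
      then have "t = r + real (nat \<lfloor>t / T\<rfloor>) * T" by (simp add: r_def)
      then show ?thesis using periodic_nat[of f T, OF per] by metis
    next
      case False
      then have "r = t + real (nat (- \<lfloor>t / T\<rfloor>)) * T" by (simp add: r_def)
      then show ?thesis using periodic_nat[of f T, OF per] by metis
    qed
    then show ?thesis using r by blast
  qed
  then show ?thesis by blast
qed

locale polynomial_field =
  fixes P Q :: "real \<Rightarrow> real \<Rightarrow> real"
  assumes poly: "real_polynomial_function (\<lambda>(x, y). P x y)" "real_polynomial_function (\<lambda>(x, y). Q x y)"
begin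

lemma cont_PQ:
  assumes "continuous_on S u" "continuous_on S v"
  shows "continuous_on S (\<lambda>t. P (u t) (v t))" "continuous_on S (\<lambda>t. Q (u t) (v t))"
proof -
  have "continuous_on S (\<lambda>t. (u t, v t))" by (intro continuous_on_Pair assms)
  note * = continuous_on_compose2[OF _ this subset_UNIV]
  have "continuous_on UNIV (\<lambda>(x, y). P x y)" "continuous_on UNIV (\<lambda>(x, y). Q x y)"
    using poly by (auto intro!: continuous_at_imp_continuous_on continuous_real_polymonial_function)
  from this[THEN *]
  show "continuous_on S (\<lambda>t. P (u t) (v t))" "continuous_on S (\<lambda>t. Q (u t) (v t))" by simp_all
qed

definition V :: "real \<Rightarrow> real \<times> real \<Rightarrow> real \<times> real"
  where "V R z = (let (x, y) = clamp2 R z in (P x y, Q x y))"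

lemma V_lipschitz:
  assumes "R \<ge> 0"
  obtains L B where "L > 0" "\<And>z. norm (V R z) \<le> B" "\<And>z w. dist (V R z) (V R w) \<le> L * dist z w"
  by (rule polynomial_field_clamp2[OF poly assms]) (rule that[unfolded V_def])

lemma solution_iff_solves:
  assumes "\<And>t. norm (\<gamma> t) \<le> R"
  shows "solution P Q \<gamma> \<longleftrightarrow> solves (V R) \<gamma>"
  unfolding solution_def solves_def V_def using clamp2_id[OF assms] by (simp add: case_prod_unfold Let_def)

text \<open>A polynomial field is only locally Lipschitz. Two bounded solutions stay in a common
  ball, where they solve the same truncated field.\<close>

lemma solution_unique:
  assumes s: "solution P Q \<gamma>" "solution P Q \<delta>" and b: "bounded (range \<gamma>)" "bounded (range \<delta>)"
    and eq: "\<gamma> s = \<delta> s"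
  shows "\<gamma> t = \<delta> t"
proof -
  obtain R1 where R1: "\<And>t. norm (\<gamma> t) \<le> R1" using b(1) unfolding bounded_iff by auto
  obtain R2 where R2: "\<And>t. norm (\<delta> t) \<le> R2" using b(2) unfolding bounded_iff by auto
  define R where "R = max (max R1 R2) 0"
  have n: "norm (\<gamma> t) \<le> R" "norm (\<delta> t) \<le> R" "R \<ge> 0" for t using R1[of t] R2[of t] by (auto simp: R_def)
  have s': "solves (V R) \<gamma>" "solves (V R) \<delta>" using s solution_iff_solves n by blast+
  obtain L B where L: "L > 0" "\<And>z. norm (V R z) \<le> B" "\<And>z w. dist (V R z) (V R w) \<le> L * dist z w"
    using V_lipschitz[OF n(3)] by blast
  show ?thesis by (rule solves_unique[OF L(3) s' eq])
qed

end

locale periodic_solution = polynomial_field +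
  fixes \<gamma> :: "real \<Rightarrow> real \<times> real" and T :: real
  assumes sol: "solution P Q \<gamma>" and T: "T > 0" and per: "\<And>t. \<gamma> (t + T) = \<gamma> t"
    and nonconst: "\<exists>s t. \<gamma> s \<noteq> \<gamma> t"
begin

definition x where "x t = fst (\<gamma> t)"
definition y where "y t = snd (\<gamma> t)"

lemma \<gamma>_eq: "\<gamma> t = (x t, y t)" by (simp add: x_def y_def)

lemma d\<gamma>: "(\<gamma> has_vector_derivative (P (x t) (y t), Q (x t) (y t))) (at t)"
  using sol by (simp add: solution_def x_def y_def)

lemma dx: "(x has_real_derivative P (x t) (y t)) (at t)"
  using bounded_linear.has_vector_derivative[OF bounded_linear_fst d\<gamma>]
  by (simp add: x_def[abs_def] has_real_derivative_iff_has_vector_derivative)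

lemma dy: "(y has_real_derivative Q (x t) (y t)) (at t)"
  using bounded_linear.has_vector_derivative[OF bounded_linear_snd d\<gamma>]
  by (simp add: y_def[abs_def] has_real_derivative_iff_has_vector_derivative)

lemma perx: "x (t + T) = x t" and pery: "y (t + T) = y t"
  by (simp_all add: x_def y_def per)

lemma cont\<gamma>: "continuous_on S \<gamma>" and contx: "continuous_on S x" and conty: "continuous_on S y"
  using d\<gamma> dx dy
  by (meson continuous_at_imp_continuous_on has_vector_derivative_continuous DERIV_continuous)+

lemma compact_range: "compact (range \<gamma>)"
  unfolding periodic_range[of \<gamma>, OF per T] by (intro compact_continuous_image cont\<gamma> compact_Icc)

lemma same_orbit:
  assumes "periodic_solution P Q \<delta> S" "\<gamma> s = \<delta> t"
  shows "range \<gamma> = range \<delta>"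
proof -
  interpret d: periodic_solution P Q \<delta> S by fact
  have shift: "solution P Q (\<lambda>u. \<delta> (u + (t - s)))"
    using d.sol solves_shift[of "\<lambda>z. (P (fst z) (snd z), Q (fst z) (snd z))" \<delta> "t - s"]
    by (simp add: solution_def solves_def)
  have "bounded (range (\<lambda>u. \<delta> (u + (t - s))))"
    by (rule bounded_subset[OF compact_imp_bounded[OF d.compact_range]]) auto
  then have eq: "\<gamma> u = \<delta> (u + (t - s))" for u
    using solution_unique[OF sol shift compact_imp_bounded[OF compact_range], of s u] assms(2) by simp
  have "\<delta> u = \<gamma> (u - (t - s))" for u using eq[of "u - (t - s)"] by simp
  then show ?thesis using eq by (metis (mono_tags) image_subset_iff rangeI subset_antisym)
qed

lemma no_equilibrium:
  assumes "P (x t) (y t) = 0" "Q (x t) (y t) = 0"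
  shows False
proof -
  have "solution P Q (\<lambda>_. \<gamma> t)"
    using assms by (simp add: solution_def x_def y_def flip: zero_prod_def)
  then have "\<gamma> s = \<gamma> t" for s
    using solution_unique[OF sol _ compact_imp_bounded[OF compact_range], of "\<lambda>_. \<gamma> t" t s] by simp
  then show False using nonconst by metis
qed

text \<open>For an antiderivative \<open>A\<close> of \<open>G\<close>, the function
  \<open>A (m t)\<close> is periodic with derivative \<open>(G (m t))\<^sup>2\<close>, so
  \<open>G\<close> vanishes along \<open>m\<close>.\<close>

lemma autonomous_const:
  fixes m :: "real \<Rightarrow> real"
  assumes m: "\<And>t. (m has_real_derivative G (m t)) (at t)" "\<And>t. m (t + T) = m t"
    and G: "continuous_on UNIV G"
  shows "m s = m t"
proof -
  obtain A where A: "\<And>t. (A has_real_derivative G t) (at t)" using antiderivative_real[OF G] by metis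
  have "G (m t) * G (m t) = 0" for t
    by (rule periodic_derivative_nonneg[where h = "\<lambda>t. A (m t)" and T = T])
      (use DERIV_chain2[OF A m(1)] m(2) T in auto)
  then have "\<forall>t. (m has_real_derivative 0) (at t)" using m(1) by (metis mult_eq_0_iff)
  then show ?thesis by (rule DERIV_isconst_all)
qed

text \<open>On a graph the first coordinate solves a scalar autonomous equation, and a periodic
  solution of such an equation is constant.\<close>

lemma not_graph:
  assumes "continuous_on UNIV g"
  shows "\<not> (\<forall>t. y t = g (x t))"
proof
  assume *: "\<forall>t. y t = g (x t)"
  have "x s = x t" for s t
    by (rule autonomous_const[where G = "\<lambda>u. P u (g u)"])
      (use dx * perx cont_PQ[OF continuous_on_id assms] in auto)
  then show False using nonconst * by (metis \<gamma>_eq)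
qed

lemma not_graph':
  assumes "continuous_on UNIV g"
  shows "\<not> (\<forall>t. x t = g (y t))"
proof
  assume *: "\<forall>t. x t = g (y t)"
  have "y s = y t" for s t
    by (rule autonomous_const[where G = "\<lambda>u. Q (g u) u"])
      (use dy * pery cont_PQ[OF assms continuous_on_id] in auto)
  then show False using nonconst * by (metis \<gamma>_eq)
qed

lemma not_line:
  assumes "\<alpha> \<noteq> 0 \<or> \<beta> \<noteq> 0"
  shows "\<not> (\<forall>t. \<alpha> * x t + \<beta> * y t + \<delta> = 0)"
proof
  assume *: "\<forall>t. \<alpha> * x t + \<beta> * y t + \<delta> = 0"
  show False
  proof (cases "\<beta> = 0")
    case True
    then have "x t = - \<delta> / \<alpha>" for t using * assms by (simp add: field_simps) (metis add.commute add_eq_0_iff)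
    then show False using not_graph'[of "\<lambda>_. - \<delta> / \<alpha>"] by simp
  next
    case False
    then have "y t = (- \<delta> - \<alpha> * x t) / \<beta>" for t
      using *[rule_format, of t] by (simp add: field_simps)
    then show False using not_graph[of "\<lambda>u. (- \<delta> - \<alpha> * u) / \<beta>"] False by (simp add: continuous_intros)
  qed
qed

lemma nonzero_or_zero:
  assumes "\<And>t. (h has_real_derivative k t * h t) (at t)" and "continuous_on UNIV k"
  obtains "\<And>t. h t = 0" | "\<And>t. h t \<noteq> 0"
  using linear_ode_zero[OF assms] by metis

lemma extrema:
  fixes s :: "real \<Rightarrow> real"
  assumes d: "\<And>t. (s has_real_derivative ds t) (at t)" and p: "\<And>t. s (t + T) = s t"
  obtains t1 t2 where "ds t1 = 0" "ds t2 = 0" "\<And>t. s t1 \<le> s t" "\<And>t. s t \<le> s t2"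
proof -
  have "continuous_on {0..T} s" using d by (meson DERIV_continuous continuous_at_imp_continuous_on)
  then have "compact (range s)" unfolding periodic_range[of s, OF p T] by (intro compact_continuous_image compact_Icc)
  then obtain t1 t2 where *: "\<And>t. s t1 \<le> s t" "\<And>t. s t \<le> s t2"
    using compact_attains_inf[of "range s"] compact_attains_sup[of "range s"] by auto
  then have "ds t1 = 0" "ds t2 = 0"
    using DERIV_local_min[OF d, of 1] DERIV_local_max[OF d, of 1] by auto
  then show thesis using that * by blast
qed

end

section \<open>Orbits determined by their critical values\<close>

lemma (in polynomial_field) periodic_orbitE:
  assumes "periodic_orbit P Q \<Gamma>"
  obtains \<gamma> T where "periodic_solution P Q \<gamma> T" "\<Gamma> = range \<gamma>"
proof -
  obtain \<gamma> T where *: "solution P Q \<gamma>" "T > 0" "\<forall>t. \<gamma> (t + T) = \<gamma> t" "\<exists>s t. \<gamma> s \<noteq> \<gamma> t" "\<Gamma> = range \<gamma>"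
    using assms unfolding periodic_orbit_def by blast
  then have "periodic_solution P Q \<gamma> T" by unfold_locales auto
  then show thesis using that *(5) by blast
qed

text \<open>\<open>R\<close> and \<open>h\<close> are chosen before the orbit: a critical value lies
  in a set common to all orbits on the curve, and \<open>h\<close> recovers the point from it.
  Differentiability of \<open>s\<close> is required only along these orbits, since a blow-up
  coordinate such as \<open>x / y^2\<close> is singular on an axis.\<close>

definition few_critical_points ::
    "(real \<Rightarrow> real \<Rightarrow> real) \<Rightarrow> (real \<Rightarrow> real \<Rightarrow> real) \<Rightarrow> (real \<Rightarrow> real \<Rightarrow> real) \<Rightarrow> bool"
  where "few_critical_points P Q f \<longleftrightarrow> (\<exists>(s :: real \<times> real \<Rightarrow> real) h R. finite R \<and> card R \<le> 3 \<and>
    (\<forall>\<gamma> T. periodic_solution P Q \<gamma> T \<longrightarrow> range \<gamma> \<subseteq> curve f \<longrightarrow>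
      (\<exists>ds. \<forall>t. ((\<lambda>t. s (\<gamma> t)) has_real_derivative ds t) (at t) \<and>
        (ds t = 0 \<longrightarrow> s (\<gamma> t) \<in> R \<and> \<gamma> t = h (s (\<gamma> t))))))"

lemma few_critical_pointsI:
  fixes s :: "real \<times> real \<Rightarrow> real"
  assumes "finite R" "card R \<le> 3"
    and "\<And>\<gamma> T. periodic_solution P Q \<gamma> T \<Longrightarrow> range \<gamma> \<subseteq> curve f \<Longrightarrow>
      \<exists>ds. \<forall>t. ((\<lambda>t. s (\<gamma> t)) has_real_derivative ds t) (at t) \<and>
        (ds t = 0 \<longrightarrow> s (\<gamma> t) \<in> R \<and> \<gamma> t = h (s (\<gamma> t)))"
  shows "few_critical_points P Q f"
  unfolding few_critical_points_def using assms
  by (intro exI[of _ s] exI[of _ h] exI[of _ R] conjI allI impI)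

text \<open>Each orbit attains a minimal and a maximal, hence two different critical values; as only three
  are available, two orbits share one, and with it a point.\<close>

lemma (in polynomial_field) unique_by_critical_points:
  assumes orb: "periodic_orbit P Q \<Gamma>" "\<Gamma> \<subseteq> curve f" "periodic_orbit P Q \<Delta>" "\<Delta> \<subseteq> curve f"
    and few: "few_critical_points P Q f"
  shows "\<Gamma> = \<Delta>"
proof -
  obtain s :: "real \<times> real \<Rightarrow> real" and h R where R: "finite R" "card R \<le> 3"
    and crit: "\<forall>\<gamma> T. periodic_solution P Q \<gamma> T \<longrightarrow> range \<gamma> \<subseteq> curve f \<longrightarrow>
      (\<exists>ds. \<forall>t. ((\<lambda>t. s (\<gamma> t)) has_real_derivative ds t) (at t) \<and>
        (ds t = 0 \<longrightarrow> s (\<gamma> t) \<in> R \<and> \<gamma> t = h (s (\<gamma> t))))"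
    using few unfolding few_critical_points_def by (elim exE conjE)
  have two: "\<exists>t1 t2. s (\<gamma> t1) \<in> R \<and> s (\<gamma> t2) \<in> R \<and> s (\<gamma> t1) < s (\<gamma> t2) \<and>
      \<gamma> t1 = h (s (\<gamma> t1)) \<and> \<gamma> t2 = h (s (\<gamma> t2))"
    if orbit: "periodic_solution P Q \<gamma> T" "range \<gamma> \<subseteq> curve f" for \<gamma> T
  proof -
    interpret periodic_solution P Q \<gamma> T by fact
    obtain ds where ds: "\<And>t. ((\<lambda>t. s (\<gamma> t)) has_real_derivative ds t) (at t)"
      "\<And>t. ds t = 0 \<Longrightarrow> s (\<gamma> t) \<in> R \<and> \<gamma> t = h (s (\<gamma> t))" using crit orbit by meson
    obtain t1 t2 where t: "ds t1 = 0" "ds t2 = 0" "\<And>t. s (\<gamma> t1) \<le> s (\<gamma> t)" "\<And>t. s (\<gamma> t) \<le> s (\<gamma> t2)"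
      using extrema[OF ds(1)] per by metis
    \<comment> \<open>If \<open>s\<close> were constant, every time would be critical with the same
      value, and \<open>h\<close> would return the same point throughout.\<close>
    have "s (\<gamma> t1) \<noteq> s (\<gamma> t2)"
    proof
      assume "s (\<gamma> t1) = s (\<gamma> t2)"
      then have c: "s (\<gamma> t) = s (\<gamma> t1)" for t using t(3,4)[of t] by simp
      then have "(\<lambda>t. s (\<gamma> t)) = (\<lambda>_. s (\<gamma> t1))" by auto
      then have "ds t = 0" for t using ds(1)[of t] DERIV_unique[OF _ DERIV_const] by metis
      then have "\<gamma> t = h (s (\<gamma> t1))" for t using ds(2)[of t] c[of t] by metis
      then show False using nonconst by metis
    qed
    then show ?thesis using t ds(2) by (metis order_le_imp_less_or_eq)
  qed
  obtain \<gamma> T where g: "periodic_solution P Q \<gamma> T" "\<Gamma> = range \<gamma>" using periodic_orbitE[OF orb(1)] .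
  obtain \<delta> S where d: "periodic_solution P Q \<delta> S" "\<Delta> = range \<delta>" using periodic_orbitE[OF orb(3)] .
  obtain t1 t2 where t: "s (\<gamma> t1) \<in> R" "s (\<gamma> t2) \<in> R" "s (\<gamma> t1) < s (\<gamma> t2)"
      "\<gamma> t1 = h (s (\<gamma> t1))" "\<gamma> t2 = h (s (\<gamma> t2))" using two[OF g(1)] orb g by metis
  obtain u1 u2 where u: "s (\<delta> u1) \<in> R" "s (\<delta> u2) \<in> R" "s (\<delta> u1) < s (\<delta> u2)"
      "\<delta> u1 = h (s (\<delta> u1))" "\<delta> u2 = h (s (\<delta> u2))" using two[OF d(1)] orb d by metis
  have "card {s (\<gamma> t1), s (\<gamma> t2), s (\<delta> u1), s (\<delta> u2)} \<le> 3"
    using card_mono[OF R(1), of "{s (\<gamma> t1), s (\<gamma> t2), s (\<delta> u1), s (\<delta> u2)}"] R(2) t u by auto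
  then have "s (\<gamma> t1) = s (\<delta> u1) \<or> s (\<gamma> t1) = s (\<delta> u2) \<or> s (\<gamma> t2) = s (\<delta> u1) \<or> s (\<gamma> t2) = s (\<delta> u2)"
    using t(3) u(3) by (auto simp: card_insert_if split: if_splits)
  then obtain v w where "\<gamma> v = \<delta> w" using t u by metis
  then show ?thesis using periodic_solution.same_orbit[OF g(1) d(1)] g d by blast
qed

subsection \<open>Reversible fields\<close>

text \<open>\<open>\<rho>\<close> is a reflection in the axis \<open>l = 0\<close>, spanned by \<open>e\<close>. Solutions starting on the axis close to
  an orbit meet the axis again, so by reversibility they are periodic.\<close>

lemma (in periodic_solution) reversible_not_isolated:
  fixes \<rho> :: "real \<times> real \<Rightarrow> real \<times> real" and l :: "real \<times> real \<Rightarrow> real"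
  assumes \<rho>: "bounded_linear \<rho>" and l: "bounded_linear l" "\<And>z. \<bar>l z\<bar> \<le> norm z"
    and e: "norm e = 1" "l e = 0" and fixed: "\<And>z. l z = 0 \<Longrightarrow> \<rho> z = z"
    and clamp: "\<And>R z. R \<ge> 0 \<Longrightarrow> clamp2 R (\<rho> z) = \<rho> (clamp2 R z)"
    and rev: "\<And>z. (P (fst (\<rho> z)) (snd (\<rho> z)), Q (fst (\<rho> z)) (snd (\<rho> z))) = - \<rho> (P (fst z) (snd z), Q (fst z) (snd z))"
    and axis: "l (\<gamma> t0) = 0"
  shows "\<not> limit_cycle P Q (range \<gamma>)"
proof
  assume "limit_cycle P Q (range \<gamma>)"
  then obtain U where U: "open U" "range \<gamma> \<subseteq> U" "\<forall>\<Delta>. periodic_orbit P Q \<Delta> \<and> \<Delta> \<subseteq> U \<longrightarrow> \<Delta> = range \<gamma>"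
    unfolding limit_cycle_def by blast
  define F where "F z = (P (fst z) (snd z), Q (fst z) (snd z))" for z
  define g where "g t = \<gamma> (t + t0)" for t
  have range_g: "range g = range \<gamma>"
  proof -
    have "\<gamma> t = g (t - t0)" for t by (simp add: g_def)
    then show ?thesis unfolding g_def by (metis (mono_tags) image_subset_iff rangeI subset_antisym)
  qed
  have g_per: "g (t + T) = g t" for t using per[of "t + t0"] by (simp add: g_def algebra_simps)
  have dg: "(g has_vector_derivative F (g t)) (at t)" for t
    using solves_shift[of F \<gamma> t0] sol by (simp add: solves_def solution_def F_def g_def[abs_def])
  have dlg: "((\<lambda>t. l (g t)) has_real_derivative l (F (g t))) (at t)" for t
    using bounded_linear.has_vector_derivative[OF l(1) dg]
    by (simp add: has_real_derivative_iff_has_vector_derivative)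
  \<comment> \<open>On the axis reversibility reads F = - \<rho> F. If F were tangent to the axis,
    \<rho> would fix it, so F = - F would vanish, but an orbit contains no equilibrium.\<close>
  have transversal: "l (F (g t)) \<noteq> 0" if "l (g t) = 0" for t
  proof
    assume "l (F (g t)) = 0"
    then have "F (g t) = - F (g t)"
      using rev[of "g t"] fixed[OF that] fixed[of "F (g t)"] by (simp add: F_def)
    then have "F (g t) = 0" by (simp add: F_def prod_eq_iff)
    then show False
      using no_equilibrium[of "t + t0"] by (simp add: F_def g_def x_def y_def zero_prod_def)
  qed
  have isolated: "\<forall>\<^sub>F t in at s. l (g t) \<noteq> 0" if "l (g s) = 0" for s
  proof -
    have "((\<lambda>t. (l (g t) - l (g s)) / (t - s)) \<longlongrightarrow> l (F (g s))) (at s)"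
      using dlg[of s] by (simp add: has_field_derivative_iff)
    then have "\<forall>\<^sub>F t in at s. (l (g t) - l (g s)) / (t - s) \<noteq> 0"
      by (rule tendsto_imp_eventually_ne[OF _ transversal[OF that]])
    then show ?thesis by eventually_elim (use that in auto)
  qed
  obtain M where M: "\<And>t. norm (g t) \<le> M"
    using compact_imp_bounded[OF compact_range] unfolding bounded_iff range_g[symmetric] by auto
  obtain \<epsilon>0 where \<epsilon>0: "\<epsilon>0 > 0" "{z. infdist z (range g) \<le> \<epsilon>0} \<subseteq> U"
    using compact_in_open_separated[of "range g" U] U compact_range range_g by auto
  define \<epsilon> where "\<epsilon> = min \<epsilon>0 1"
  define R where "R = max (M + 1) 0"
  have R0: "R \<ge> 0" by (simp add: R_def)
  have near: "z \<in> U" "norm z \<le> R" if "dist (g t) z \<le> \<epsilon>" for z t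
  proof -
    have "infdist z (range g) \<le> dist z (g t)" by (rule infdist_le) simp
    then show "z \<in> U" using that \<epsilon>0 by (auto simp: \<epsilon>_def dist_commute)
    have "norm z \<le> norm (g t) + dist (g t) z" by (metis add.commute dist_commute dist_norm norm_triangle_sub)
    then show "norm z \<le> R" using that M[of t] unfolding R_def \<epsilon>_def by linarith
  qed
  obtain L B where V: "L > 0" "\<And>z. norm (V R z) \<le> B" "\<And>z w. dist (V R z) (V R w) \<le> L * dist z w"
    using V_lipschitz[OF R0] by blast
  have VF: "V R z = F (clamp2 R z)" for z by (simp add: V_def F_def case_prod_unfold Let_def)
  have sg: "solves (V R) g"
  proof -
    have "clamp2 R (g t) = g t" for t
      using near(2)[of t "g t"] \<epsilon>0 by (intro clamp2_id) (simp add: \<epsilon>_def)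
    then show ?thesis unfolding solves_def VF using dg by simp
  qed
  \<comment> \<open>The return to the axis is taken after the full period, since
    \<open>g T = g 0\<close> lies on it. The crossing there is transversal, so it is a sign change
    of \<open>l\<close>, which survives a small perturbation. The new orbit will have a period near
    \<open>2 * T\<close>, hence closeness is needed up to time \<open>2 * T + 2\<close>.\<close>
  obtain t1 t2 where t12: "0 < t1" "t1 < t2" "t2 < T + 1" "l (g t1) * l (g t2) < 0"
  proof -
    have z: "l (g T) = 0" using g_per[of 0] axis by (simp add: g_def)
    consider "l (F (g T)) > 0" | "l (F (g T)) < 0" using transversal[OF z] by linarith
    then show thesis
    proof cases
      case 1
      obtain d1 d2 where d: "d1 > 0" "\<And>h. 0 < h \<Longrightarrow> h < d1 \<Longrightarrow> l (g (T - h)) < 0"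
        "d2 > 0" "\<And>h. 0 < h \<Longrightarrow> h < d2 \<Longrightarrow> l (g (T + h)) > 0"
        using DERIV_pos_inc_left[OF dlg 1] DERIV_pos_inc_right[OF dlg 1] z by metis
      define h where "h = min (min (d1/2) (d2/2)) (min (T/2) (1/2))"
      have h: "0 < h" "h < d1" "h < d2" "h < T" "h < 1" using d T by (auto simp: h_def)
      show thesis using that[of "T - h" "T + h"] h d by (simp add: mult_less_0_iff)
    next
      case 2
      obtain d1 d2 where d: "d1 > 0" "\<And>h. 0 < h \<Longrightarrow> h < d1 \<Longrightarrow> l (g (T - h)) > 0"
        "d2 > 0" "\<And>h. 0 < h \<Longrightarrow> h < d2 \<Longrightarrow> l (g (T + h)) < 0"
        using DERIV_neg_dec_left[OF dlg 2] DERIV_neg_dec_right[OF dlg 2] z by metis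
      define h where "h = min (min (d1/2) (d2/2)) (min (T/2) (1/2))"
      have h: "0 < h" "h < d1" "h < d2" "h < T" "h < 1" using d T by (auto simp: h_def)
      show thesis using that[of "T - h" "T + h"] h d by (simp add: mult_less_0_iff)
    qed
  qed
  define \<mu> where "\<mu> = min \<epsilon> (min \<bar>l (g t1)\<bar> \<bar>l (g t2)\<bar> / 2)"
  have \<mu>: "\<mu> > 0" "\<mu> \<le> \<epsilon>" "\<mu> < \<bar>l (g t1)\<bar>" "\<mu> < \<bar>l (g t2)\<bar>"
    using t12(4) \<epsilon>0 by (auto simp: \<mu>_def \<epsilon>_def min_def mult_less_0_iff)
  \<comment> \<open>Dividing by the Gronwall factor makes an initial distance below \<eta> stay
    below \<mu> on the whole interval, and \<mu> is smaller than the distance of \<open>g t1\<close>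
    and \<open>g t2\<close> from the axis as measured by \<open>l\<close>.\<close>
  define \<eta> where "\<eta> = \<mu> / exp (L * (2 * T + 2))"
  have \<eta>: "\<eta> > 0" using \<mu> by (simp add: \<eta>_def)
  \<comment> \<open>Otherwise the orbit would contain a whole segment of the axis, and the crossing
    times in one period would be infinite in number and accumulate. But a transversal crossing time
    is isolated.\<close>
  have "\<exists>h. 0 < h \<and> h < \<eta> \<and> g 0 + h *\<^sub>R e \<notin> range g"
  proof (rule ccontr)
    assume "\<not> ?thesis"
    then have all: "g 0 + h *\<^sub>R e \<in> range g" if "0 < h" "h < \<eta>" for h using that by blast
    define Z where "Z = {t \<in> {0..T}. l (g t) = 0}"
    have "(\<lambda>h. g 0 + h *\<^sub>R e) ` {0<..<\<eta>} \<subseteq> g ` Z"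
    proof
      fix z assume "z \<in> (\<lambda>h. g 0 + h *\<^sub>R e) ` {0<..<\<eta>}"
      then obtain h where h: "z = g 0 + h *\<^sub>R e" "0 < h" "h < \<eta>" by (elim imageE) auto
      then have "z \<in> g ` {0..T}" using all periodic_range[of g, OF g_per T] by metis
      moreover have "l z = 0"
        using h axis e(2) by (simp add: g_def linear_add linear_scale bounded_linear.linear[OF l(1)])
      ultimately show "z \<in> g ` Z" by (auto simp: Z_def)
    qed
    moreover have "inj_on (\<lambda>h. g 0 + h *\<^sub>R e) {0<..<\<eta>}" using e(1) by (auto simp: inj_on_def)
    then have "infinite ((\<lambda>h. g 0 + h *\<^sub>R e) ` {0<..<\<eta>})" using \<eta> by (simp add: finite_image_iff)
    ultimately have "infinite Z" by (meson finite_imageI finite_subset)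
    then obtain s where s: "s \<in> {0..T}" "s islimpt Z"
      using Heine_Borel_imp_Bolzano_Weierstrass[OF compact_Icc, of Z 0 T] by (metis (lifting) Z_def mem_Collect_eq subsetI)
    have "continuous_on {0..T} (\<lambda>t. l (g t))" using dlg by (meson DERIV_continuous continuous_at_imp_continuous_on)
    then have "closed Z" unfolding Z_def by (rule continuous_closed_preimage_constant) simp
    then have "l (g s) = 0" using s(2) closed_limpt by (auto simp: Z_def)
    from isolated[OF this] have "\<forall>\<^sub>F t in at s. t \<notin> Z" by eventually_elim (simp add: Z_def)
    then show False using s(2) by (simp add: islimpt_iff_eventually)
  qed
  then obtain h where h: "0 < h" "h < \<eta>" "g 0 + h *\<^sub>R e \<notin> range g" by blast
  obtain \<delta> where \<delta>: "\<delta> 0 = g 0 + h *\<^sub>R e" "solves (V R) \<delta>"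
    using lipschitz_bounded_flow_exists[OF V(1) V(3) V(2)] by blast
  have close: "dist (g t) (\<delta> t) \<le> \<mu>" if "0 \<le> t" "t \<le> 2 * T + 2" for t
  proof -
    have "dist (g t) (\<delta> t) \<le> exp (L * t) * dist (g 0) (\<delta> 0)" by (rule gronwall[OF V(3) sg \<delta>(2) that(1)])
    also have "\<dots> \<le> exp (L * (2 * T + 2)) * \<eta>"
      using that V(1) h e(1) by (intro mult_mono) (auto simp: \<delta>(1) dist_norm)
    finally show ?thesis by (simp add: \<eta>_def)
  qed
  have l_close: "\<bar>l (g t) - l (\<delta> t)\<bar> \<le> \<mu>" if "0 \<le> t" "t \<le> 2 * T + 2" for t
    using l(2)[of "g t - \<delta> t"] close[OF that]
    by (simp add: dist_norm linear_diff bounded_linear.linear[OF l(1)])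
  have sgn: "l (\<delta> t1) * l (\<delta> t2) < 0"
    using l_close[of t1] l_close[of t2] t12 \<mu> by (auto simp: mult_less_0_iff)
  have cont: "continuous_on {t1..t2} (\<lambda>t. l (\<delta> t))"
    using bounded_linear.continuous_on[OF l(1) solves_continuous[OF \<delta>(2)]] .
  obtain \<tau> where \<tau>: "t1 \<le> \<tau>" "\<tau> \<le> t2" "l (\<delta> \<tau>) = 0"
  proof -
    consider "l (\<delta> t1) < 0" "l (\<delta> t2) > 0" | "l (\<delta> t1) > 0" "l (\<delta> t2) < 0"
      using sgn by (auto simp: mult_less_0_iff)
    then show thesis
      using IVT'[of "\<lambda>t. l (\<delta> t)" t1 0 t2] IVT2'[of "\<lambda>t. l (\<delta> t)" t2 0 t1] cont t12 that by (cases) force+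
  qed
  \<comment> \<open>Both sides solve the same truncated field, and at \<open>t = 0\<close> they
    agree because \<rho> fixes the axis.\<close>
  have reflect: "\<rho> (\<delta> (s - t)) = \<delta> (s + t)" if "l (\<delta> s) = 0" for s t
  proof -
    have "solves (V R) (\<lambda>t. \<rho> (\<delta> (s - t)))"
    proof -
      have "((\<lambda>t. \<delta> (s - t)) has_vector_derivative - V R (\<delta> (s - t))) (at t)" for t
        using solves_shift[OF solves_reverse[OF \<delta>(2)], of "- s"] by (simp add: solves_def)
      from bounded_linear.has_vector_derivative[OF \<rho> this]
      have "((\<lambda>t. \<rho> (\<delta> (s - t))) has_vector_derivative \<rho> (- V R (\<delta> (s - t)))) (at t)" for t .
      moreover have "\<rho> (- V R z) = V R (\<rho> z)" for z
        using rev[of "clamp2 R z"] clamp[OF R0, of z]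
        by (simp add: VF linear_neg bounded_linear.linear[OF \<rho>]) (simp add: F_def)
      ultimately show ?thesis by (simp add: solves_def)
    qed
    from solves_unique[OF V(3) this solves_shift[OF \<delta>(2), of s], of 0 t]
    show ?thesis using fixed[OF that] by (simp add: add.commute)
  qed
  have ax0: "l (\<delta> 0) = 0"
    using axis e(2) by (simp add: \<delta>(1) g_def linear_add linear_scale bounded_linear.linear[OF l(1)])
  \<comment> \<open>The reflections of time about 0 and about \<tau> compose to the translation by
    \<open>2 * \<tau>\<close>.\<close>
  have \<delta>per: "\<delta> (t + 2 * \<tau>) = \<delta> t" for t
    using reflect[OF \<tau>(3), of "t + \<tau>"] reflect[OF ax0, of t] by (simp add: algebra_simps)
  have \<tau>0: "\<tau> > 0" using \<tau> t12 by simp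
  have "\<exists>s. dist (g s) (\<delta> t) \<le> \<epsilon>" for t
  proof -
    have "\<delta> t \<in> \<delta> ` {0..2 * \<tau>}" using periodic_range[of \<delta> "2 * \<tau>"] \<delta>per \<tau>0 by (metis mult_pos_pos rangeI zero_less_numeral)
    then obtain s where s: "0 \<le> s" "s \<le> 2 * \<tau>" "\<delta> t = \<delta> s" by auto
    then show ?thesis using close[of s] \<mu>(2) \<tau> t12 by (intro exI[of _ s]) auto
  qed
  then have \<delta>U: "\<delta> t \<in> U" "norm (\<delta> t) \<le> R" for t using near by blast+
  have "periodic_orbit P Q (range \<delta>)"
    unfolding periodic_orbit_def
  proof (intro exI conjI)
    show "solution P Q \<delta>" using solution_iff_solves[of \<delta> R] \<delta>U \<delta>(2) by blast
    show "\<delta> t1 \<noteq> \<delta> t2" using sgn by (auto simp: mult_less_0_iff)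
    show "2 * \<tau> > 0" "\<forall>t. \<delta> (t + 2 * \<tau>) = \<delta> t" using \<tau>0 \<delta>per by auto
  qed simp
  then have "range \<delta> = range g" using U(3) \<delta>U(1) range_g by (metis image_subsetI)
  then show False using h(3) \<delta>(1) by (metis rangeI)
qed

lemma (in periodic_solution) reversible_x_not_isolated:
  assumes "\<And>u v. P (- u) v = P u v" "\<And>u v. Q (- u) v = - Q u v" and "x t0 = 0"
  shows "\<not> limit_cycle P Q (range \<gamma>)"
proof (rule reversible_not_isolated[where \<rho> = "\<lambda>z. (- fst z, snd z)" and l = fst and e = "(0, 1)" and ?t0.0 = t0])
  show "bounded_linear (\<lambda>z::real \<times> real. (- fst z, snd z))"
    by (intro bounded_linear_Pair bounded_linear_minus bounded_linear_fst bounded_linear_snd)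
  show "\<bar>fst z\<bar> \<le> norm z" for z :: "real \<times> real" using norm_fst_le[of "fst z" "snd z"] by simp
  show "clamp2 R (- fst z, snd z) = (- fst (clamp2 R z), snd (clamp2 R z))" if "R \<ge> 0" for R and z :: "real \<times> real"
    using that by (auto simp: clamp2_def)
qed (use assms in \<open>auto simp: bounded_linear_fst x_def\<close>)

lemma (in periodic_solution) reversible_y_not_isolated:
  assumes "\<And>u v. P u (- v) = - P u v" "\<And>u v. Q u (- v) = Q u v" and "y t0 = 0"
  shows "\<not> limit_cycle P Q (range \<gamma>)"
proof (rule reversible_not_isolated[where \<rho> = "\<lambda>z. (fst z, - snd z)" and l = snd and e = "(1, 0)" and ?t0.0 = t0])
  show "bounded_linear (\<lambda>z::real \<times> real. (fst z, - snd z))"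
    by (intro bounded_linear_Pair bounded_linear_minus bounded_linear_fst bounded_linear_snd)
  show "\<bar>snd z\<bar> \<le> norm z" for z :: "real \<times> real" using norm_snd_le[of "snd z" "fst z"] by simp
  show "clamp2 R (fst z, - snd z) = (fst (clamp2 R z), - snd (clamp2 R z))" if "R \<ge> 0" for R and z :: "real \<times> real"
    using that by (auto simp: clamp2_def)
qed (use assms in \<open>auto simp: bounded_linear_snd y_def\<close>)

subsection \<open>Periodic orbits off the curve\<close>

context periodic_solution
begin

text \<open>\<open>K = ln \<bar>f\<bar>\<close> turns the cofactor equation into an integrating factor.\<close>

lemma log_cofactor:
  assumes f: "\<And>t. (f has_real_derivative k t * f t) (at t)" "\<And>t. f t \<noteq> 0" "\<And>t. f (t + T) = f t"
  obtains K where "\<And>t. (K has_real_derivative k t) (at t)" "\<And>t. K (t + T) = K t"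
proof
  fix t
  have "((\<lambda>t. (f t)\<^sup>2) has_real_derivative 2 * k t * (f t)\<^sup>2) (at t)"
    by (auto intro!: derivative_eq_intros f simp: power2_eq_square)
  from DERIV_ln_divide[THEN DERIV_chain2, OF _ this]
  have "((\<lambda>t. ln ((f t)\<^sup>2)) has_real_derivative 2 * k t) (at t)" using f(2)[of t] by simp
  from DERIV_cmult[OF this, of "1/2"]
  show "((\<lambda>t. 1/2 * ln ((f t)\<^sup>2)) has_real_derivative k t) (at t)" by simp
  show "1/2 * ln ((f (t + T))\<^sup>2) = 1/2 * ln ((f t)\<^sup>2)" by (simp add: f)
qed

lemma weighted_one_sign:
  assumes K: "\<And>t. (K has_real_derivative k t) (at t)" "\<And>t. K (t + T) = K t"
    and w: "\<And>t. (w has_real_derivative c * k t * w t + n t) (at t)" "\<And>t. w (t + T) = w t"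
    and n: "(\<forall>t. n t \<ge> 0) \<or> (\<forall>t. n t \<le> 0)"
  shows "n t = 0"
proof -
  have E: "((\<lambda>t. exp (- c * K t)) has_real_derivative - c * k t * exp (- c * K t)) (at t)" for t
    by (rule derivative_eq_intros K refl)+ simp
  have "((\<lambda>t. w t * exp (- c * K t)) has_real_derivative n t * exp (- c * K t)) (at t)" for t
    by (rule derivative_eq_intros w E refl)+ (simp add: algebra_simps)
  then have "n t * exp (- c * K t) = 0"
    by (rule periodic_derivative_one_sign[where T = T])
      (use n T K w in \<open>auto simp: mult_nonpos_nonneg\<close>)
  then show ?thesis by simp
qed

text \<open>The square must vanish along the orbit, which places the orbit on a line. Admitting
  \<open>p = q = 0\<close> with \<open>r\<close> nonzero covers the parameters for which the affine
  form degenerates to a constant.\<close>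

lemma no_orbit_square:
  assumes K: "\<And>t. (K has_real_derivative k t) (at t)" "\<And>t. K (t + T) = K t"
    and w: "\<And>t. (w has_real_derivative c * k t * w t + m * (p * x t + q * y t + r)\<^sup>2) (at t)" "\<And>t. w (t + T) = w t"
    and nz: "m \<noteq> 0" "p \<noteq> 0 \<or> q \<noteq> 0 \<or> r \<noteq> 0"
  shows False
proof -
  have "(\<forall>t. m * (p * x t + q * y t + r)\<^sup>2 \<ge> 0) \<or> (\<forall>t. m * (p * x t + q * y t + r)\<^sup>2 \<le> 0)"
    by (cases "m \<ge> 0") (auto simp: mult_nonpos_nonneg)
  from weighted_one_sign[OF K w this] have "p * x t + q * y t + r = 0" for t using nz(1) by simp
  then show False using not_line[of p q r] nz(2) by fastforce
qed

text \<open>With W = p x + q y the equation reads W' = c k W + e k + d k^2. The term e k is absorbed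
  by the shift W + e/c or, if c = 0, by subtracting e times the logarithm of |f|. What remains has
  one sign, so k vanishes on the orbit; then W' = 0 and the orbit lies on a line.\<close>

lemma no_orbit_linear_integral:
  fixes f k :: "real \<Rightarrow> real"
  assumes f: "\<And>t. (f has_real_derivative k t * f t) (at t)" "\<And>t. f t \<noteq> 0" "\<And>t. f (t + T) = f t"
    and w: "\<And>t. p * P (x t) (y t) + q * Q (x t) (y t) = k t * (c * (p * x t + q * y t) + e + d * k t)"
    and nz: "p \<noteq> 0 \<or> q \<noteq> 0" "d \<noteq> 0"
  shows False
proof -
  obtain K where K: "\<And>t. (K has_real_derivative k t) (at t)" "\<And>t. K (t + T) = K t"
    using log_cofactor[OF f] by blast
  define w where "w t = p * x t + q * y t" for t
  have dw: "(w has_real_derivative k t * (c * w t + e + d * k t)) (at t)" for t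
    unfolding w_def assms(4)[symmetric] by (auto intro!: derivative_eq_intros dx dy)
  have perw: "w (t + T) = w t" for t by (simp add: w_def perx pery)
  have sgn: "(\<forall>t. d * (k t)\<^sup>2 \<ge> 0) \<or> (\<forall>t. d * (k t)\<^sup>2 \<le> 0)"
    by (cases "d \<ge> 0") (auto simp: mult_nonpos_nonneg)
  have "d * (k t)\<^sup>2 = 0" for t
  proof (cases "c = 0")
    case True
    have "((\<lambda>t. w t - e * K t) has_real_derivative d * (k t)\<^sup>2) (at t)" for t
      by (rule derivative_eq_intros dw K refl)+ (use True in \<open>simp add: algebra_simps power2_eq_square\<close>)
    then show ?thesis by (rule periodic_derivative_one_sign[OF _ sgn T]) (simp add: K perw)
  next
    case False
    have "((\<lambda>t. w t + e / c) has_real_derivative c * k t * (w t + e / c) + d * (k t)\<^sup>2) (at t)" for t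
      by (rule derivative_eq_intros dw refl)+ (use False in \<open>simp add: field_simps power2_eq_square\<close>)
    from weighted_one_sign[OF K this _ sgn] perw show ?thesis by simp
  qed
  then have "\<forall>t. (w has_real_derivative 0) (at t)" using dw nz(2) by (metis mult_eq_0_iff power_eq_0_iff)
  then have "w t = w 0" for t using DERIV_isconst_all by blast
  then have "p * x t + q * y t + (- w 0) = 0" for t using w_def by (metis add.right_inverse)
  then show False using not_line[OF nz(1)] by blast
qed

end

section \<open>Cases with a linear test function\<close>

lemma Qin_off:
  assumes "periodic_solution (\<lambda>x y. - y * (a*x + b*y + c) - (x^2 + y^2 - 1)) (\<lambda>x y. x * (a*x + b*y + c)) \<gamma> T"
    "a \<noteq> 0" and nz: "\<And>t. (fst (\<gamma> t))^2 + (snd (\<gamma> t))^2 - 1 \<noteq> 0"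
  shows False
proof -
  interpret periodic_solution "\<lambda>x y. - y * (a*x + b*y + c) - (x^2 + y^2 - 1)" "\<lambda>x y. x * (a*x + b*y + c)" \<gamma> T by fact
  \<comment> \<open>Here k = - 2 x, and Q is already divisible by it, so W = y. The quotient - (a x
    + b y + c) / 2 contains k with the coefficient d = a/4, which vanishes exactly for a =
    0.\<close>
  show False
  proof (rule no_orbit_linear_integral[where f = "\<lambda>t. (x t)\<^sup>2 + (y t)\<^sup>2 - 1" and k = "\<lambda>t. - 2 * x t" and p = 0 and q = 1
      and c = "- b/2" and e = "- c/2" and d = "a/4"])
    show "((\<lambda>t. (x t)\<^sup>2 + (y t)\<^sup>2 - 1) has_real_derivative - 2 * x t * ((x t)\<^sup>2 + (y t)\<^sup>2 - 1)) (at t)" for t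
      by (rule derivative_eq_intros dx dy refl)+ (simp, algebra)
  qed (use assms in \<open>auto simp: per x_def y_def field_simps power2_eq_square\<close>)
qed

lemma Chavarriga_off:
  assumes "periodic_solution (\<lambda>x y. 5*x + 6*x^2 + 4*(1 + a)*x*y + a*y^2) (\<lambda>x y. x + 2*y + 4*x*y + (2 + 3*a)*y^2) \<gamma> T"
    "a \<noteq> - 10/3"
    and nz: "\<And>t. (\<lambda>(x, y). x^2 + x^3 + x^2*y + 2*a*x*y^2 + 2*a*x*y^3 + a^2*y^4) (\<gamma> t) \<noteq> 0"
  shows False
proof -
  interpret periodic_solution "\<lambda>x y. 5*x + 6*x^2 + 4*(1 + a)*x*y + a*y^2" "\<lambda>x y. x + 2*y + 4*x*y + (2 + 3*a)*y^2" \<gamma> T by fact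
  have a: "18*a + 60 \<noteq> 0" "9*a + 30 \<noteq> 0" using assms(2) by auto
  let ?f = "\<lambda>x y. x^2 + x^3 + x^2*y + 2*a*x*y^2 + 2*a*x*y^3 + a^2*y^4"
  \<comment> \<open>The combination - 3 P + 5 Q equals k (y - x); the constants \<open>c\<close>,
    \<open>e\<close>, \<open>d\<close> expand y - x in W, 1 and k. The denominators vanish where the
    linear parts of W and k are parallel, that is for a = -10/3.\<close>
  show False
  proof (rule no_orbit_linear_integral[where f = "\<lambda>t. ?f (x t) (y t)" and k = "\<lambda>t. 10 + 18 * x t + (10 + 12*a) * y t"
      and p = "-3" and q = 5 and c = "(3*a + 7)/(9*a + 30)" and e = "10/(18*a + 60)" and d = "- 1/(18*a + 60)"])
    show "((\<lambda>t. ?f (x t) (y t)) has_real_derivative (10 + 18 * x t + (10 + 12*a) * y t) * ?f (x t) (y t)) (at t)" for t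
      by (rule derivative_eq_intros dx dy refl)+ (simp, algebra)
    have L: "(3*a + 7)/(9*a + 30) * (-3 * u + 5 * v) + 10/(18*a + 60) + (- 1/(18*a + 60)) * (10 + 18 * u + (10 + 12*a) * v) = v - u" for u v
      using a by (simp add: divide_simps) algebra
    show "- 3 * (5 * x t + 6 * (x t)\<^sup>2 + 4 * (1 + a) * x t * y t + a * (y t)\<^sup>2) + 5 * (x t + 2 * y t + 4 * x t * y t + (2 + 3 * a) * (y t)\<^sup>2)
      = (10 + 18 * x t + (10 + 12*a) * y t) * ((3*a + 7)/(9*a + 30) * (-3 * x t + 5 * y t) + 10/(18*a + 60) + - 1/(18*a + 60) * (10 + 18 * x t + (10 + 12*a) * y t))" for t
      unfolding L by algebra
  qed (use assms a in \<open>auto simp: per x_def y_def case_prod_unfold\<close>)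
qed

lemma Chavarriga_Llibre_Sorolla_off:
  assumes "periodic_solution (\<lambda>x y. 2*(1 + 2*x - 2*a*x^2 + 6*x*y)) (\<lambda>x y. 8 - 3*a - 14*a*x - 2*a*x*y - 8*y^2) \<gamma> T"
    and nz: "\<And>t. (\<lambda>(x, y). 1/4 + x - x^2 + a*x^3 + x*y + x^2*y^2) (\<gamma> t) \<noteq> 0"
  shows False
proof -
  interpret periodic_solution "\<lambda>x y. 2*(1 + 2*x - 2*a*x^2 + 6*x*y)" "\<lambda>x y. 8 - 3*a - 14*a*x - 2*a*x*y - 8*y^2" \<gamma> T by fact
  let ?f = "\<lambda>x y. 1/4 + x - x^2 + a*x^3 + x*y + x^2*y^2"
  show False
  proof (rule no_orbit_linear_integral[where f = "\<lambda>t. ?f (x t) (y t)" and k = "\<lambda>t. 8 - 12*a*x t + 8 * y t"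
      and p = "3/2*a" and q = 1 and c = "- 1/3" and e = "5/3" and d = "- 1/12"])
    show "((\<lambda>t. ?f (x t) (y t)) has_real_derivative (8 - 12*a*x t + 8 * y t) * ?f (x t) (y t)) (at t)" for t
      by (rule derivative_eq_intros dx dy refl)+ (simp add: field_simps, algebra)
    show "3/2*a * (2*(1 + 2*x t - 2*a*(x t)^2 + 6*x t*y t)) + 1 * (8 - 3*a - 14*a*x t - 2*a*x t*y t - 8*(y t)^2)
      = (8 - 12*a*x t + 8 * y t) * (- 1/3 * (3/2*a * x t + 1 * y t) + 5/3 + - 1/12 * (8 - 12*a*x t + 8 * y t))" for t
      by (simp add: field_simps, algebra)
  qed (use assms in \<open>auto simp: per x_def y_def case_prod_unfold\<close>)
qed

lemma Christopher_Llibre_Swirszcz_5_off: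
  assumes "periodic_solution (\<lambda>x y. 28*x + 2*(16 - a^2)*(a + 12)*x^2 + 6*(3*a - 4)*x*y - 12/(a + 4)*y^2)
    (\<lambda>x y. 2*(16 - a^2)*x + 8*y + (16 - a^2)*(a + 12)*x*y + 2*(5*a - 12)*y^2) \<gamma> T"
    and a: "a \<noteq> - 4" "a \<noteq> - 3"
    and nz: "\<And>t. (\<lambda>(x, y). x^2 + (16 - a^2)*x^3 + (a - 2)*x^2*y - 2/(a + 4)*x*y^2
       - 1/4*(4 - a)*(a + 12)*x^2*y^2 + (8 - a)/(a + 4)*x*y^3
       + 1/(a + 4)^2*y^4 + (a + 12)/(a + 4)*x*y^4 - 6/(a + 4)^2*y^5) (\<gamma> t) \<noteq> 0"
  shows False
proof -
  let ?P = "\<lambda>x y. 28*x + 2*(16 - a^2)*(a + 12)*x^2 + 6*(3*a - 4)*x*y - 12/(a + 4)*y^2"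
  let ?Q = "\<lambda>x y. 2*(16 - a^2)*x + 8*y + (16 - a^2)*(a + 12)*x*y + 2*(5*a - 12)*y^2"
  interpret periodic_solution ?P ?Q \<gamma> T by fact
  have ne: "a + 4 \<noteq> 0" "a + 3 \<noteq> 0" using a by auto
  let ?f = "\<lambda>x y. x^2 + (16 - a^2)*x^3 + (a - 2)*x^2*y - 2/(a + 4)*x*y^2
       - 1/4*(4 - a)*(a + 12)*x^2*y^2 + (8 - a)/(a + 4)*x*y^3
       + 1/(a + 4)^2*y^4 + (a + 12)/(a + 4)*x*y^4 - 6/(a + 4)^2*y^5"
  let ?k = "\<lambda>x y. 56 + 6*(16 - a^2)*(a + 12)*x + (52*a - 96)*y"
  \<comment> \<open>The quotient of p P + q Q by k is 2 y / (a + 4) + (a - 4) x. The factor a + 3 in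
    the denominators reflects that for a = -3 the linear parts of W and k are parallel.\<close>
  show False
  proof (rule no_orbit_linear_integral[where f = "\<lambda>t. ?f (x t) (y t)" and k = "\<lambda>t. ?k (x t) (y t)"
      and p = "3*(a - 4)" and q = "14/(a + 4)" and c = "(4*a + 3)/(15*(a + 3))" and e = "56/(30*(a + 4)*(a + 3))" and d = "- 1/(30*(a + 4)*(a + 3))"])
    show "((\<lambda>t. ?f (x t) (y t)) has_real_derivative ?k (x t) (y t) * ?f (x t) (y t)) (at t)" for t
      apply (rule derivative_eq_intros dx dy refl)+
      using ne(1) by (simp add: divide_simps, algebra)
    have L: "(4*a + 3)/(15*(a + 3)) * (3*(a - 4) * u + 14/(a + 4) * v) + 56/(30*(a + 4)*(a + 3)) + (- 1/(30*(a + 4)*(a + 3))) * ?k u v = 2/(a + 4) * v + (a - 4)*u" for u v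
      using ne by (simp add: divide_simps) algebra
    show "3*(a - 4) * ?P (x t) (y t) + 14/(a + 4) * ?Q (x t) (y t)
      = ?k (x t) (y t) * ((4*a + 3)/(15*(a + 3)) * (3*(a - 4) * x t + 14/(a + 4) * y t) + 56/(30*(a + 4)*(a + 3)) + - 1/(30*(a + 4)*(a + 3)) * ?k (x t) (y t))" for t
      unfolding L using ne by (simp add: divide_simps) algebra
  qed (use assms ne in \<open>auto simp: per x_def y_def case_prod_unfold\<close>)
qed

lemma Alberich_Ferragut_Llibre_off:
  assumes "periodic_solution (\<lambda>x y. - 8*x + a/2*(a - 16)*y - (5*a - 64)*x^2 + a/8*(a^2 - 256)*x*y)
    (\<lambda>x y. - 28*y + 24/a*x^2 - 3*(3*a - 32)*x*y + a/4*(a^2 - 256)*y^2) \<gamma> T"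
    and a: "a \<noteq> 0" "a \<noteq> 2"
    and nz: "\<And>t. (\<lambda>(x, y). a*y^2 - 4*x^2*y + a/2*(a - 12)*x*y^2 - a^2/4*(a - 16)*y^3 + 4/a*x^4
       + (24 - a)*x^3*y + a/16*(a^2 - 256)*x^2*y^2 - 24/a*x^5 + (a + 16)*x^4*y) (\<gamma> t) \<noteq> 0"
  shows False
proof -
  let ?P = "\<lambda>x y. - 8*x + a/2*(a - 16)*y - (5*a - 64)*x^2 + a/8*(a^2 - 256)*x*y"
  let ?Q = "\<lambda>x y. - 28*y + 24/a*x^2 - 3*(3*a - 32)*x*y + a/4*(a^2 - 256)*y^2"
  interpret periodic_solution ?P ?Q \<gamma> T by fact
  have ne: "a - 2 \<noteq> 0" using a by auto
  let ?f = "\<lambda>x y. a*y^2 - 4*x^2*y + a/2*(a - 12)*x*y^2 - a^2/4*(a - 16)*y^3 + 4/a*x^4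
       + (24 - a)*x^3*y + a/16*(a^2 - 256)*x^2*y^2 - 24/a*x^5 + (a + 16)*x^4*y"
  let ?k = "\<lambda>x y. - 56 + (304 - 26*a)*x + 3/4*a*(a^2 - 256)*y"
  \<comment> \<open>The quotient of p P + q Q by k is 8 x / a + (a - 16) y. For a = 2 the linear
    parts of W and k are parallel, which shows as the factor a - 2 in the denominators.\<close>
  show False
  proof (rule no_orbit_linear_integral[where f = "\<lambda>t. ?f (x t) (y t)" and k = "\<lambda>t. ?k (x t) (y t)"
      and p = "56/a" and q = "3*(a - 16)" and c = "(4*a - 26)/(15*(a - 2))" and e = "56*4/(15*a*(a - 2))" and d = "4/(15*a*(a - 2))"])
    show "((\<lambda>t. ?f (x t) (y t)) has_real_derivative ?k (x t) (y t) * ?f (x t) (y t)) (at t)" for t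
      apply (rule derivative_eq_intros dx dy refl)+
      using a(1) by (simp add: divide_simps, algebra)
    have L: "(4*a - 26)/(15*(a - 2)) * (56/a * u + 3*(a - 16) * v) + 56*4/(15*a*(a - 2)) + 4/(15*a*(a - 2)) * ?k u v = 8/a * u + (a - 16) * v" for u v
      using a ne by (simp add: divide_simps) algebra
    show "56/a * ?P (x t) (y t) + 3*(a - 16) * ?Q (x t) (y t)
      = ?k (x t) (y t) * ((4*a - 26)/(15*(a - 2)) * (56/a * x t + 3*(a - 16) * y t) + 56*4/(15*a*(a - 2)) + 4/(15*a*(a - 2)) * ?k (x t) (y t))" for t
      unfolding L using a by (simp add: divide_simps) algebra
  qed (use assms ne in \<open>auto simp: per x_def y_def case_prod_unfold\<close>)
qed

section \<open>Cases with a quadratic test function\<close>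

lemma Yablonskii_off:
  assumes "periodic_solution
     (\<lambda>x y. - 4*a*b*c*x - (a + b)*y + 3*(a + b)*c*x^2 + 4*x*y)
     (\<lambda>x y. (a + b)*a*b*x - 4*a*b*c*y
       + (4*a*b*c^2 - 3/2*(a + b)^2 + 4*a*b)*x^2 + 8*(a + b)*c*x*y + 8*y^2) \<gamma> T"
    and c: "c \<noteq> 0"
    and nz: "\<And>t. (\<lambda>(x, y). (y + c*x^2)^2 + x^2*(x - a)*(x - b)) (\<gamma> t) \<noteq> 0"
  shows False
proof -
  let ?P = "\<lambda>x y. - 4*a*b*c*x - (a + b)*y + 3*(a + b)*c*x^2 + 4*x*y"
  let ?Q = "\<lambda>x y. (a + b)*a*b*x - 4*a*b*c*y + (4*a*b*c^2 - 3/2*(a + b)^2 + 4*a*b)*x^2 + 8*(a + b)*c*x*y + 8*y^2"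
  interpret periodic_solution ?P ?Q \<gamma> T by fact
  let ?f = "\<lambda>x y. (y + c*x^2)^2 + x^2*(x - a)*(x - b)"
  define k where "k t = - 8*a*b*c + 12*c*(a + b)*x t + 16*y t" for t
  have f: "((\<lambda>t. ?f (x t) (y t)) has_real_derivative k t * ?f (x t) (y t)) (at t)" for t
    unfolding k_def by (rule derivative_eq_intros dx dy refl)+ (simp add: field_simps, algebra)
  obtain K where K: "\<And>t. (K has_real_derivative k t) (at t)" "\<And>t. K (t + T) = K t"
    using log_cofactor[OF f] nz by (auto simp: per x_def y_def case_prod_unfold)
  \<comment> \<open>The field is symmetric in a and b; their sum and product keep the identities
    below small.\<close>
  define s where "s = a + b"
  define p where "p = a * b"
  have dx': "(x has_real_derivative - 4*p*c*x t - s*y t + 3 * s*c*(x t)\<^sup>2 + 4*x t*y t) (at t)" for t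
    using dx[of t] by (simp add: s_def p_def mult.assoc)
  have dy': "(y has_real_derivative s*p*x t - 4*p*c*y t + (4*p*c\<^sup>2 - 3/2 * s\<^sup>2 + 4*p)*(x t)\<^sup>2 + 8 * s*c*x t*y t + 8*(y t)\<^sup>2) (at t)" for t
    using dy[of t] by (simp add: s_def p_def mult.assoc)
  have k: "k t = - 8*p*c + 12*c * s*x t + 16*y t" for t by (simp add: k_def s_def p_def mult.assoc)
  show False
  proof (cases "s = 0")
    \<comment> \<open>For s = 0 the coefficient s/2 of the square used in the general case vanishes.
      Then \<open>x^2\<close> itself serves as test function, unless a = b = 0, where y' = 8 y^2 is
      of one sign.\<close>
    case True
    then have b: "b = - a" by (simp add: s_def)
    show False
    proof (cases "a = 0")
      case True
      then have "8 * (y t)\<^sup>2 = 0" for t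
        by (intro periodic_derivative_nonneg[OF _ _ T, of y]) (use dy pery b in auto)
      then show False using not_line[of 0 1 0] by simp
    next
      case False
      show False
      proof (rule no_orbit_square[where K = K and k = k and w = "\<lambda>t. (x t)\<^sup>2" and c = "1/2" and m = "4*a\<^sup>2*c" and p = 1 and q = 0 and r = 0])
        show "((\<lambda>t. (x t)\<^sup>2) has_real_derivative 1/2 * k t * (x t)\<^sup>2 + 4*a\<^sup>2*c * (1 * x t + 0 * y t + 0)\<^sup>2) (at t)" for t
          unfolding k_def by (rule derivative_eq_intros dx dy refl)+ (simp add: b field_simps power2_eq_square)
      qed (use K False c in \<open>simp_all add: perx\<close>)
    qed
  next
    case False
    \<comment> \<open>For z = x - s/4 one has z' = k z / 4 + D with D = \<alpha> z - \<beta>. The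
      bracket in \<open>W\<close> has weight 1/2 and remainder - (s/2) D, while z^2 has weight 1/2
      and remainder 2 z D; the coefficients \<beta> and s \<alpha> / 4 combine them to (s/2) D^2. As
      c and s are nonzero, \<alpha> and \<beta> do not vanish together.\<close>
    define \<alpha> where "\<alpha> = c * (3/4 * s\<^sup>2 - 2*p)"
    define \<beta> where "\<beta> = c * (p * s - 3/16 * s^3)"
    define W where "W u v = \<beta> * (c * v + (1 + c\<^sup>2)*u\<^sup>2 - s/2*(u - s/4) - s\<^sup>2/16) + s/4*\<alpha>*(u - s/4)\<^sup>2" for u v
    show False
    proof (rule no_orbit_square[where K = K and k = k and w = "\<lambda>t. W (x t) (y t)" and c = "1/2" and m = "s/2" and p = \<alpha> and q = 0
        and r = "- \<alpha> * s/4 - \<beta>"])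
      show "((\<lambda>t. W (x t) (y t)) has_real_derivative
          1/2 * k t * W (x t) (y t) + s/2 * (\<alpha> * x t + 0 * y t + (- \<alpha> * s/4 - \<beta>))\<^sup>2) (at t)" for t
        unfolding W_def k \<alpha>_def \<beta>_def
        by (rule derivative_eq_intros dx' dy' refl)+ (simp add: field_simps, algebra)
      show "\<alpha> \<noteq> 0 \<or> 0 \<noteq> (0::real) \<or> - \<alpha> * s/4 - \<beta> \<noteq> 0"
      proof (rule ccontr)
        assume "\<not> ?thesis"
        then have "\<alpha> = 0" "\<beta> = 0" by auto
        then have "8 * p = 3 * s\<^sup>2" "16 * (p * s) = 3 * s^3" using c by (auto simp: \<alpha>_def \<beta>_def)
        then have "s^3 = 0" by algebra
        then show False using False by simp
      qed
    qed (use K False in \<open>simp_all add: W_def perx pery\<close>)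
  qed
qed

text \<open>These are the parameters for which the coefficient a (a - 30) of the square in the
  general argument vanishes. For a = 0 the function y is monotone. For a = 30 both the line y = 0
  and the parabola \<open>y = 30240 x^2\<close> are invariant, and their cofactors differ by a
  multiple of x. Since x' = y on x = 0 and y has one sign, so has x, and the logarithm of the
  quotient of the two invariants is strictly monotone.\<close>

lemma Christopher_Llibre_Swirszcz_6_none:
  assumes "periodic_solution
    (\<lambda>x y. 28*a*(a - 30)*x + y + 168*a^2*x^2 + 3*x*y)
    (\<lambda>x y. 16*a*(a - 30)*(14*a*(a - 30)*x + 5*y + 84*a^2*x^2) + 24*a*(17*a - 6)*x*y + 6*y^2) \<gamma> T"
    and a: "a = 0 \<or> a = 30"
  shows False
proof -
  let ?P = "\<lambda>x y. 28*a*(a - 30)*x + y + 168*a^2*x^2 + 3*x*y"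
  let ?Q = "\<lambda>x y. 16*a*(a - 30)*(14*a*(a - 30)*x + 5*y + 84*a^2*x^2) + 24*a*(17*a - 6)*x*y + 6*y^2"
  interpret periodic_solution ?P ?Q \<gamma> T by fact
  show False
    using a
  proof
    assume "a = 0"
    then have "6 * (y t)\<^sup>2 = 0" for t
      by (intro periodic_derivative_nonneg[OF _ _ T, of y]) (use dy pery in auto)
    then show False using not_line[of 0 1 0] by simp
  next
    assume a: "a = 30"
    have dx': "(x has_real_derivative y t + 151200 * (x t)\<^sup>2 + 3 * x t * y t) (at t)" for t using dx[of t] a by simp
    have dy': "(y has_real_derivative (362880 * x t + 6 * y t) * y t) (at t)" for t
      using dy[of t] a by (simp add: algebra_simps power2_eq_square)
    define w where "w t = y t - 30240 * (x t)\<^sup>2" for t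
    have dw: "(w has_real_derivative (302400 * x t + 6 * y t) * w t) (at t)" for t
      unfolding w_def by (rule derivative_eq_intros dx' dy' refl)+ (simp, algebra)
    have cont: "continuous_on UNIV (\<lambda>t. 362880 * x t + 6 * y t)" "continuous_on UNIV (\<lambda>t. 302400 * x t + 6 * y t)"
      by (intro continuous_intros contx conty)+
    have y0: "y t \<noteq> 0" for t
      using not_line[of 0 1 0] by (cases rule: nonzero_or_zero[OF dy' cont(1)]) auto
    have w0: "w t \<noteq> 0" for t
    proof (cases rule: nonzero_or_zero[OF dw cont(2)])
      case 1
      then show ?thesis using not_graph[of "\<lambda>u. 30240 * u\<^sup>2"] by (simp add: w_def continuous_intros)
    qed
    have "x t \<noteq> 0" for t
    proof (rule periodic_no_zero[OF dx' T perx])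
      show "(\<forall>t. x t = 0 \<longrightarrow> 0 < y t + 151200 * (x t)\<^sup>2 + 3 * x t * y t) \<or> (\<forall>t. x t = 0 \<longrightarrow> y t + 151200 * (x t)\<^sup>2 + 3 * x t * y t < 0)"
        using nonzero_imp_one_sign[OF conty y0] by auto
    qed
    moreover have "- 60480 * x t = 0" for t
    proof -
      obtain K where K: "\<And>t. (K has_real_derivative 362880 * x t + 6 * y t) (at t)" "\<And>t. K (t + T) = K t"
        using log_cofactor[OF dy' y0 pery] by blast
      obtain M where M: "\<And>t. (M has_real_derivative 302400 * x t + 6 * y t) (at t)" "\<And>t. M (t + T) = M t"
        using log_cofactor[OF dw w0] by (auto simp: w_def perx pery)
      have "((\<lambda>t. M t - K t) has_real_derivative - 60480 * x t) (at t)" for t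
        by (rule derivative_eq_intros K M refl)+ simp
      then show ?thesis
        by (rule periodic_derivative_one_sign[OF _ _ T])
          (use nonzero_imp_one_sign[OF contx \<open>\<And>t. x t \<noteq> 0\<close>] in \<open>auto simp: K M less_imp_le\<close>)
    qed
    ultimately show False by simp
  qed
qed

lemma Christopher_Llibre_Swirszcz_6_off:
  assumes "periodic_solution
    (\<lambda>x y. 28*a*(a - 30)*x + y + 168*a^2*x^2 + 3*x*y)
    (\<lambda>x y. 16*a*(a - 30)*(14*a*(a - 30)*x + 5*y + 84*a^2*x^2) + 24*a*(17*a - 6)*x*y + 6*y^2) \<gamma> T"
    and nz: "\<And>t. (\<lambda>(x, y). 48*a^3*(a - 30)^4*x^2 + 24*a^2*(a - 30)^3*x*y + 3*a*(a - 30)^2*y^2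
       + 64*a^3*(a - 30)^3*(9*a - 4)*x^3 + 24*a^2*(a - 30)^2*(9*a - 4)*x^2*y
       + 18*a*(a - 30)*(a - 2)*x*y^2 - 7*y^3
       + 576*a^3*(a - 30)^2*(a - 2)^2*x^4 + 144*a^2*(a - 30)*(a - 2)^2*x^3*y
       + 27*a*(a - 2)^2*x^2*y^2 - 3456*a^3*(a - 30)*(a - 2)^2*(2*a + 3)*x^5
       - 432*a^2*(a - 2)^2*(2*a + 3)*x^4*y
       + 3456*a^3*(a - 2)^2*(a + 12)*(2*a + 3)*x^6) (\<gamma> t) \<noteq> 0"
  shows False
proof (cases "a = 0 \<or> a = 30")
  case True
  then show False using Christopher_Llibre_Swirszcz_6_none assms(1) by blast
next
  case False
  let ?P = "\<lambda>x y. 28*a*(a - 30)*x + y + 168*a^2*x^2 + 3*x*y"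
  let ?Q = "\<lambda>x y. 16*a*(a - 30)*(14*a*(a - 30)*x + 5*y + 84*a^2*x^2) + 24*a*(17*a - 6)*x*y + 6*y^2"
  interpret periodic_solution ?P ?Q \<gamma> T by fact
  let ?f = "\<lambda>x y. 48*a^3*(a - 30)^4*x^2 + 24*a^2*(a - 30)^3*x*y + 3*a*(a - 30)^2*y^2
       + 64*a^3*(a - 30)^3*(9*a - 4)*x^3 + 24*a^2*(a - 30)^2*(9*a - 4)*x^2*y
       + 18*a*(a - 30)*(a - 2)*x*y^2 - 7*y^3
       + 576*a^3*(a - 30)^2*(a - 2)^2*x^4 + 144*a^2*(a - 30)*(a - 2)^2*x^3*y
       + 27*a*(a - 2)^2*x^2*y^2 - 3456*a^3*(a - 30)*(a - 2)^2*(2*a + 3)*x^5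
       - 432*a^2*(a - 2)^2*(2*a + 3)*x^4*y
       + 3456*a^3*(a - 2)^2*(a + 12)*(2*a + 3)*x^6"
  define k where "k t = 168*a*(a - 30) + 1008*a^2*x t + 18*y t" for t
  have f: "((\<lambda>t. ?f (x t) (y t)) has_real_derivative k t * ?f (x t) (y t)) (at t)" for t
    unfolding k_def by (rule derivative_eq_intros dx dy refl)+ (simp, algebra)
  obtain K where K: "\<And>t. (K has_real_derivative k t) (at t)" "\<And>t. K (t + T) = K t"
    using log_cofactor[OF f] nz by (auto simp: per x_def y_def case_prod_unfold)
  define E where "E = a * (a - 30)"
  \<comment> \<open>For z = 1 + 3 x one has z' = k z / 6 - D with D = 56 a^2 z - \<beta>. The
    bracket in \<open>W\<close> has weight 1/3 and remainder - (32/3) E D, while z^2 has weight 1/3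
    and remainder - 2 z D; the combination below turns them into (32/3) E D^2.\<close>
  define \<beta> where "\<beta> = 28*a*(a + 30)"
  define W where "W u v = \<beta> * (v - 24*E*u - 24*a*(a + 12)*u\<^sup>2 + 32/3*E*(1 + 3*u) - 16/3*E) - 896/3*a\<^sup>2*E*(1 + 3*u)\<^sup>2" for u v
  show False
  proof (rule no_orbit_square[where K = K and k = k and w = "\<lambda>t. W (x t) (y t)" and c = "1/3" and m = "32/3*E" and p = "168*a\<^sup>2" and q = 0
      and r = "56*a\<^sup>2 - \<beta>"])
    show "((\<lambda>t. W (x t) (y t)) has_real_derivative
        1/3 * k t * W (x t) (y t) + 32/3*E * (168*a\<^sup>2 * x t + 0 * y t + (56*a\<^sup>2 - \<beta>))\<^sup>2) (at t)" for t
      unfolding W_def k_def \<beta>_def E_def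
      by (rule derivative_eq_intros dx dy refl)+ (simp add: field_simps, algebra)
  qed (use K False in \<open>simp_all add: W_def perx pery E_def\<close>)
qed

lemma Filiptsov_off:
  assumes "periodic_solution
    (\<lambda>x y. 6*(1 + a)*x + 2*y - 6*(2 + a)*x^2 + 12*x*y)
    (\<lambda>x y. 15*(1 + a)*y + 3*a*(1 + a)*x^2 - 2*(9 + 5*a)*x*y + 16*y^2) \<gamma> T"
    and nz: "\<And>t. (\<lambda>(x, y). 3*(1 + a)*(a*x^2 + y)^2 + 2*y^2*(2*y - 3*(1 + a)*x)) (\<gamma> t) \<noteq> 0"
  shows False
proof -
  let ?P = "\<lambda>x y. 6*(1 + a)*x + 2*y - 6*(2 + a)*x^2 + 12*x*y"
  let ?Q = "\<lambda>x y. 15*(1 + a)*y + 3*a*(1 + a)*x^2 - 2*(9 + 5*a)*x*y + 16*y^2"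
  interpret periodic_solution ?P ?Q \<gamma> T by fact
  let ?f = "\<lambda>x y. 3*(1 + a)*(a*x^2 + y)^2 + 2*y^2*(2*y - 3*(1 + a)*x)"
  define k where "k t = 30*(1 + a) - 24*(2 + a)*x t + 48*y t" for t
  have f: "((\<lambda>t. ?f (x t) (y t)) has_real_derivative k t * ?f (x t) (y t)) (at t)" for t
    unfolding k_def by (rule derivative_eq_intros dx dy refl)+ (simp, algebra)
  obtain K where K: "\<And>t. (K has_real_derivative k t) (at t)" "\<And>t. K (t + T) = K t"
    using log_cofactor[OF f] nz by (auto simp: per x_def y_def case_prod_unfold)
  \<comment> \<open>The terms of P with y are 2 y z. Expressing y through k leaves z' = k z / 4 - D
    with D affine in z.\<close>
  define z where "z t = 1 + 6 * x t" for t
  define \<beta> where "\<beta> = (a - 1) / 2"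
  define \<sigma> where "\<sigma> = 7 * a + 8"
  define D where "D t = \<beta> * z t + \<sigma>" for t
  have dz: "(z has_real_derivative 1/4 * k t * z t + - D t) (at t)" for t
    unfolding z_def D_def \<beta>_def \<sigma>_def k_def
    by (rule derivative_eq_intros dx refl)+ (simp add: field_simps, algebra)
  have perz: "z (t + T) = z t" for t by (simp add: z_def perx)
  have contz: "continuous_on UNIV z" unfolding z_def by (intro continuous_intros contx)
  have contk: "continuous_on UNIV k" unfolding k_def by (intro continuous_intros contx conty)
  have D_not_zero: False if "\<And>t. D t = 0"
  proof -
    have "6 * \<beta> * x t + 0 * y t + (\<beta> + \<sigma>) = 0" for t
      using that[of t] by (simp add: D_def z_def algebra_simps)
    then show False using not_line[of "6 * \<beta>" 0 "\<beta> + \<sigma>"] by (cases "\<beta> = 0") (auto simp: \<beta>_def \<sigma>_def)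
  qed
  \<comment> \<open>Here z itself is the test function, of weight 1/4. In the rest of the proof it
    remains to treat orbits that cross the line D = 0.\<close>
  have D_changes_sign: False if "(\<forall>t. D t \<ge> 0) \<or> (\<forall>t. D t \<le> 0)"
  proof -
    have "- D t = 0" for t by (rule weighted_one_sign[OF K dz perz]) (use that in auto)
    then show False using D_not_zero by simp
  qed
  have z_not_zero: False if "\<And>t. z t = 0"
    using not_line[of 6 0 1] that by (simp add: z_def algebra_simps)
  \<comment> \<open>On z = 0 the derivative of z is the constant - \<sigma>, so an orbit cannot
    cross this line and return; for \<sigma> = 0 the line is invariant.\<close>
  consider "a = - 1" | "a \<noteq> - 1" "\<And>t. z t > 0" | "a \<noteq> - 1" "\<And>t. z t < 0"
  proof -
    have "z t \<noteq> 0" for t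
    proof (cases "\<sigma> = 0")
      case True
      have dz': "(z has_real_derivative (1/4 * k t - \<beta>) * z t) (at t)" for t
        using dz[of t] True by (simp add: D_def algebra_simps)
      have "continuous_on UNIV (\<lambda>t. 1/4 * k t - \<beta>)" by (intro continuous_intros contk)
      then show ?thesis using z_not_zero by (cases rule: nonzero_or_zero[OF dz']) auto
    next
      case False
      show ?thesis
        by (rule periodic_no_zero[OF dz T perz]) (use False in \<open>auto simp: D_def\<close>)
    qed
    then show thesis using nonzero_imp_one_sign[OF contz] that by auto
  qed
  then show False
  proof cases
    \<comment> \<open>For a = -1 one has D = - 6 x. The line y = 0 is invariant and x' = 2 y on x =
      0, so x, and with it D, keeps its sign.\<close>
    case 1
    have dy': "(y has_real_derivative (16 * y t - 8 * x t) * y t) (at t)" for t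
      using dy[of t] 1 by (simp add: algebra_simps power2_eq_square)
    have "continuous_on UNIV (\<lambda>t. 16 * y t - 8 * x t)" by (intro continuous_intros contx conty)
    then have y0: "y t \<noteq> 0" for t
      using not_line[of 0 1 0] by (cases rule: nonzero_or_zero[OF dy']) auto
    have "x t \<noteq> 0" for t
    proof (rule periodic_no_zero[OF dx T perx])
      show "(\<forall>t. x t = 0 \<longrightarrow> 0 < ?P (x t) (y t)) \<or> (\<forall>t. x t = 0 \<longrightarrow> ?P (x t) (y t) < 0)"
        using nonzero_imp_one_sign[OF conty y0] by auto
    qed
    from nonzero_imp_one_sign[OF contx this] show False
      using D_changes_sign 1 by (auto simp: D_def z_def \<beta>_def \<sigma>_def less_imp_le)
  next
    case 2
    define z0 where "z0 = - \<sigma> / \<beta>"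
    show False
    proof (cases "\<beta> \<noteq> 0 \<and> z0 > 0")
      case False
      have "(\<forall>t. D t \<ge> 0) \<or> (\<forall>t. D t \<le> 0)"
      proof (cases "\<beta> = 0")
        case True
        then show ?thesis by (auto simp: D_def)
      next
        case \<beta>: False
        then have "D t = \<beta> * (z t - z0)" for t by (simp add: D_def z0_def field_simps)
        moreover have "z t - z0 \<ge> 0" for t using 2(2)[of t] False \<beta> by simp
        ultimately show ?thesis by (cases "\<beta> \<ge> 0") (auto simp: mult_nonpos_nonneg)
      qed
      then show False by (rule D_changes_sign)
    next
      case True
      \<comment> \<open>\<open>W\<close> below has weight 1/3 and z has weight 1/4, so the power of
        z comparable to \<open>W\<close> has exponent 4/3, that is z r with r the cube root of z.
        Its remainder is - (4/3) r D.\<close>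
      define r where "r t = z t powr (1/3)" for t
      define r0 where "r0 = z0 powr (1/3)"
      have r3: "r t ^ 3 = z t" "r t > 0" for t
        using 2(2)[of t] by (auto simp: r_def powr_power)
      have r03: "r0 ^ 3 = z0" "r0 > 0" using True by (auto simp: r0_def powr_power)
      \<comment> \<open>The remainder of the corrected function is D (z - 4 - q r). This q makes the
        second factor vanish at the zero \<open>z0\<close> of D, so that both factors change sign
        together.\<close>
      define q where "q = (z0 - 4) / r0"
      have dr4: "((\<lambda>t. z t * r t) has_real_derivative 4/3 * r t * (1/4 * k t * z t + - D t)) (at t)" for t
      proof -
        have "((\<lambda>t. z t powr (4/3)) has_real_derivative 4/3 * z t powr (4/3 - 1) * (1/4 * k t * z t + - D t)) (at t)"
          using DERIV_chain2[OF has_real_derivative_powr[OF 2(2)[of t], of "4/3"] dz[of t]] by simp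
        moreover have "z s powr (4/3) = z s * r s" for s
          using powr_add[of "z s" 1 "1/3"] 2(2)[of s] by (simp add: r_def)
        ultimately show ?thesis by (simp add: r_def)
      qed
      define W where "W u v = v + (1 + a)*(2*u\<^sup>2 - 5/2*u) - 1/18*(1 + a)*(1 + 6*u)\<^sup>2 + 4/9*(1 + a)*(1 + 6*u) - 5/36*(1 + a)" for u v
      have dW: "((\<lambda>t. W (x t) (y t)) has_real_derivative 1/3 * k t * W (x t) (y t) + (1 + a)/9 * D t * (z t - 4)) (at t)" for t
        unfolding W_def z_def D_def \<beta>_def \<sigma>_def k_def
        by (rule derivative_eq_intros dx dy refl)+ (simp add: field_simps, algebra)
      have dG: "((\<lambda>t. 9/(1 + a) * W (x t) (y t) + 3/4 * q * (z t * r t)) has_real_derivative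
          1/3 * k t * (9/(1 + a) * W (x t) (y t) + 3/4 * q * (z t * r t)) + D t * (z t - 4 - q * r t)) (at t)" for t
        by (rule derivative_eq_intros dW dr4 refl)+ (use 2(1) in \<open>simp add: field_simps\<close>)
      \<comment> \<open>In terms of r both factors are divisible by r - r0, and the cofactors are
        positive because r and r0 are.\<close>
      define N where "N t = (r t - r0)\<^sup>2 * (((r t)\<^sup>2 + r t * r0 + r0\<^sup>2) * (r t * r0 * (r t + r0) + 4)) / r0" for t
      have n: "D t * (z t - 4 - q * r t) = \<beta> * N t" for t
      proof -
        have "D t = \<beta> * (r t ^ 3 - r0 ^ 3)" using True by (simp add: r3 r03 D_def z0_def field_simps)
        moreover have "z t - 4 - q * r t = ((r t ^ 3 - 4) * r0 - (r0 ^ 3 - 4) * r t) / r0"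
          using r03 by (simp add: r3 q_def field_simps)
        moreover have "(r t ^ 3 - r0 ^ 3) * ((r t ^ 3 - 4) * r0 - (r0 ^ 3 - 4) * r t)
            = (r t - r0)\<^sup>2 * (((r t)\<^sup>2 + r t * r0 + r0\<^sup>2) * (r t * r0 * (r t + r0) + 4))"
          by algebra
        ultimately show ?thesis by (simp add: N_def mult.assoc)
      qed
      have pos: "((r t)\<^sup>2 + r t * r0 + r0\<^sup>2) * (r t * r0 * (r t + r0) + 4) > 0" for t
        using r3(2)[of t] r03(2) by (intro mult_pos_pos add_pos_pos) auto
      then have nn: "N t \<ge> 0" for t
        unfolding N_def using r03(2) mult_nonneg_nonneg[OF zero_le_power2 less_imp_le[OF pos]] by (simp add: divide_nonneg_pos)
      have "(\<forall>t. D t * (z t - 4 - q * r t) \<ge> 0) \<or> (\<forall>t. D t * (z t - 4 - q * r t) \<le> 0)"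
        unfolding n using nn by (cases "\<beta> \<ge> 0") (auto intro: mult_nonneg_nonneg mult_nonpos_nonneg)
      from weighted_one_sign[OF K dG _ this] have "D t * (z t - 4 - q * r t) = 0" for t
        by (simp add: W_def perx pery perz r_def)
      then have "N t = 0" for t using True by (simp add: n)
      then have "(r t - r0)\<^sup>2 = 0" for t
        using pos[of t] r03(2) unfolding N_def by (metis divide_eq_0_iff less_irrefl mult_eq_0_iff)
      then have "r t = r0" for t by simp
      then have "D t = 0" for t using r3(1)[of t] r03(1) True by (simp add: D_def z0_def field_simps)
      then show False by (rule D_not_zero)
    qed
  next
    case 3
    show False
    proof (cases "\<beta> * \<sigma> > 0")
      case False
      then have "(\<beta> \<ge> 0 \<and> \<sigma> \<le> 0) \<or> (\<beta> \<le> 0 \<and> \<sigma> \<ge> 0)"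
        by (auto simp: not_less mult_le_0_iff)
      then have "(\<forall>t. D t \<le> 0) \<or> (\<forall>t. D t \<ge> 0)"
        using less_imp_le[OF 3(2)] unfolding D_def
        by (elim disjE conjE) (simp_all add: add_nonpos_nonpos add_nonneg_nonneg mult_nonneg_nonpos mult_nonpos_nonpos)
      then show False using D_changes_sign by blast
    next
      case True
      txt \<open>Here the equilibrium on \<open>k = 0\<close> is a saddle. Of the four sectors cut out by \<open>D = 0\<close> and \<open>k = 0\<close>,
        two can only be left and two can only be entered, so an orbit stays in one sector and \<open>D\<close> keeps its sign.\<close>
      define u where "u t = 1/48 * k t" for t
      define \<kappa> where "\<kappa> t = - 2/3*((1 + a)*z t) + 8/3*a + 13/6" for t
      define \<rho> where "\<rho> t = - \<beta> + 48*(y t/3 + (1 + a)*((x t)\<^sup>2 - x t/2)) + 2*\<kappa> t*z t" for t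
      \<comment> \<open>Up to a multiple of D u only the terms with u^2 and D^2 remain. Since z < 0
        and \<kappa> has the sign of \<beta>, both have the sign opposite to \<beta>, so D u can
        cross zero in one direction only.\<close>
      have dDu: "((\<lambda>t. D t * u t) has_real_derivative \<rho> t * (D t * u t) + (12*\<beta>*z t*(u t)\<^sup>2 - \<kappa> t/6*(D t)\<^sup>2)) (at t)" for t
        unfolding D_def u_def \<rho>_def \<kappa>_def z_def \<beta>_def \<sigma>_def k_def
        by (rule derivative_eq_intros dx dy refl)+ (simp add: field_simps, algebra)
      \<comment> \<open>P and Q are combinations of D and u, so the lines D = 0 and u = 0 meet in an
        equilibrium.\<close>
      have nz: "D t \<noteq> 0 \<or> u t \<noteq> 0" for t
      proof (rule ccontr)
        assume "\<not> ?thesis"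
        then have 0: "D t = 0" "u t = 0" by auto
        have P: "?P (x t) (y t) = 2 * u t * z t - D t / 6"
          unfolding D_def u_def z_def \<beta>_def \<sigma>_def k_def by (simp add: field_simps, algebra)
        have Q: "?Q (x t) (y t) = u t * (\<rho> t + \<beta>) - \<kappa> t / 6 * D t + (2 + a)/2 * ?P (x t) (y t)"
          unfolding D_def u_def \<rho>_def \<kappa>_def z_def \<beta>_def \<sigma>_def k_def by (simp add: field_simps, algebra)
        show False using no_equilibrium[of t] P Q 0 by simp
      qed
      have Du: "D t * u t \<noteq> 0" for t
      proof (rule periodic_no_zero[OF dDu T])
        have "(\<beta> > 0 \<and> (\<forall>t. \<kappa> t > 0)) \<or> (\<beta> < 0 \<and> (\<forall>t. \<kappa> t < 0))"
        proof -
          have "a > 1 \<or> a < - 8/7" using True by (auto simp: \<beta>_def \<sigma>_def zero_less_mult_iff)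
          moreover have "\<kappa> t > 0" if "a > 1" for t
            using mult_pos_neg[of "1 + a" "z t"] 3(2)[of t] that unfolding \<kappa>_def by linarith
          moreover have "\<kappa> t < 0" if "a < - 8/7" for t
            using mult_neg_neg[of "1 + a" "z t"] 3(2)[of t] that unfolding \<kappa>_def by linarith
          ultimately show ?thesis by (auto simp: \<beta>_def)
        qed
        then show "(\<forall>t. D t * u t = 0 \<longrightarrow> 0 < \<rho> t * (D t * u t) + (12*\<beta>*z t*(u t)\<^sup>2 - \<kappa> t/6*(D t)\<^sup>2)) \<or>
          (\<forall>t. D t * u t = 0 \<longrightarrow> \<rho> t * (D t * u t) + (12*\<beta>*z t*(u t)\<^sup>2 - \<kappa> t/6*(D t)\<^sup>2) < 0)"
        proof (elim disjE conjE)
          assume s: "\<beta> > 0" "\<forall>t. \<kappa> t > 0"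
          have "\<rho> t * (D t * u t) + (12*\<beta>*z t*(u t)\<^sup>2 - \<kappa> t/6*(D t)\<^sup>2) < 0" if "D t * u t = 0" for t
            unfolding that mult_zero_right add_0_left using nz[of t] that s 3(2)[of t] by (auto simp: mult_pos_neg mult_neg_pos)
          then show ?thesis by blast
        next
          assume s: "\<beta> < 0" "\<forall>t. \<kappa> t < 0"
          have "\<rho> t * (D t * u t) + (12*\<beta>*z t*(u t)\<^sup>2 - \<kappa> t/6*(D t)\<^sup>2) > 0" if "D t * u t = 0" for t
            unfolding that mult_zero_right add_0_left using nz[of t] that s 3(2)[of t] by (auto simp: mult_neg_neg mult_neg_pos)
          then show ?thesis by blast
        qed
      qed (simp add: D_def u_def k_def z_def perx pery)
      have "continuous_on UNIV D" unfolding D_def by (intro continuous_intros contz)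
      then show False using nonzero_imp_one_sign[of D] Du D_changes_sign by (metis less_imp_le mult_zero_left)
    qed
  qed
qed

subsection \<open>Periodic orbits on the curve\<close>

text \<open>Only some coefficient has to be nonzero, so one bound serves all parameters, including
  those for which the discriminant drops in degree.\<close>

lemma cubic_roots:
  fixes q0 q1 q2 q3 :: real
  assumes "q0 \<noteq> 0 \<or> q1 \<noteq> 0 \<or> q2 \<noteq> 0 \<or> q3 \<noteq> 0"
  shows "finite {r. q0 + q1 * r + q2 * r^2 + q3 * r^3 = 0}" "card {r. q0 + q1 * r + q2 * r^2 + q3 * r^3 = 0} \<le> 3"
proof -
  let ?p = "[:q0, q1, q2, q3:]"
  have *: "{r. q0 + q1 * r + q2 * r^2 + q3 * r^3 = 0} = {r. poly ?p r = 0}"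
    by (simp add: algebra_simps power2_eq_square power3_eq_cube)
  have p: "?p \<noteq> 0" using assms by auto
  show "finite {r. q0 + q1 * r + q2 * r^2 + q3 * r^3 = 0}"
    unfolding * by (rule poly_roots_finite[OF p])
  have "degree ?p \<le> 3" by simp
  then show "card {r. q0 + q1 * r + q2 * r^2 + q3 * r^3 = 0} \<le> 3"
    unfolding * using card_poly_roots_bound[OF p] by linarith
qed

text \<open>Differentiating the curve equation along the orbit leaves \<open>gw t * dw t = 0\<close>
  where \<open>s\<close> is stationary. If \<open>dw t\<close> vanished as well, the point would be
  an equilibrium. So \<open>w\<close> is a double root of the equation at the critical value of
  \<open>s\<close>.\<close>

lemma (in periodic_solution) critical_fold:
  assumes g: "\<And>t. g t = 0" "\<And>t. (g has_real_derivative gs t * ds t + gw t * dw t) (at t)"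
    and s: "ds t = 0" and w: "dw t = 0 \<Longrightarrow> P (x t) (y t) = 0 \<and> Q (x t) (y t) = 0"
  shows "gw t = 0"
proof -
  have "g = (\<lambda>_. 0)" using g(1) by auto
  then have "gs t * ds t + gw t * dw t = 0" using g(2)[of t] DERIV_unique[OF _ DERIV_const] by metis
  then show ?thesis using s w no_equilibrium[of t] by auto
qed

lemma double_root:
  fixes x :: real
  assumes "c0 + c1 * x + c2 * x\<^sup>2 = 0" "c1 + 2 * c2 * x = 0"
  shows "c1\<^sup>2 = 4 * c0 * c2"
  using assms by algebra

lemma quadratic_family_polynomial:
  assumes "quadratic_family P Q f"
  shows "polynomial_field P Q"
  using assms
  by cases (auto simp: polynomial_field_def case_prod_unfold
      intro!: real_polynomial_function.intros(2-4) real_polynomial_function_fst_snd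
        real_polynomial_function_diff real_polynomial_function_power real_polynomial_function_minus)

lemma Qin_critical:
  shows "few_critical_points
    (\<lambda>x y. - y * (a*x + b*y + c) - (x^2 + y^2 - 1)) (\<lambda>x y. x * (a*x + b*y + c))
    (\<lambda>x y. x^2 + y^2 - 1)"
proof (rule few_critical_pointsI[where R = "{1, - 1}"
      and s = "\<lambda>z. snd z"
      and h = "\<lambda>r. (0, r)"], goal_cases)
  case (3 \<gamma> T)
  note cur = 3(2)
  let ?P = "\<lambda>x y. - y * (a*x + b*y + c) - (x^2 + y^2 - 1)"
  let ?Q = "\<lambda>x y. x * (a*x + b*y + c)"
  interpret periodic_solution ?P ?Q \<gamma> T by fact
  have f: "(x t)\<^sup>2 + (y t)\<^sup>2 - 1 = 0" for t using cur by (auto simp: curve_def \<gamma>_eq)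
  have "y t \<in> {1, - 1} \<and> x t = 0" if "?Q (x t) (y t) = 0" for t
  proof -
    \<comment> \<open>On the circle P = - y (a x + b y + c), so the other factor of Q vanishes only
      at equilibria.\<close>
    have "x t = 0" using that no_equilibrium[of t] f[of t] by auto
    then show ?thesis using f[of t] by (auto simp: power2_eq_1_iff)
  qed
  then show ?case
    using dy by (intro exI[of _ "\<lambda>t. ?Q (x t) (y t)"]) (auto simp: y_def[abs_def] x_def[abs_def] prod_eq_iff)
qed (auto simp: card_insert_if)

text \<open>f is a square in y + c x^2 plus x^2 (x - a) (x - b), so double roots in y have y = - c
  x^2. The root x = 0 is the equilibrium at the origin, which leaves x = a and x = b.\<close>

lemma Yablonskii_critical:
  shows "few_critical_points
    (\<lambda>x y. - 4*a*b*c*x - (a + b)*y + 3*(a + b)*c*x^2 + 4*x*y)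
     (\<lambda>x y. (a + b)*a*b*x - 4*a*b*c*y
       + (4*a*b*c^2 - 3/2*(a + b)^2 + 4*a*b)*x^2 + 8*(a + b)*c*x*y + 8*y^2)
    (\<lambda>x y. (y + c*x^2)^2 + x^2*(x - a)*(x - b))"
proof (rule few_critical_pointsI[where R = "{a, b}"
      and s = "\<lambda>z. fst z"
      and h = "\<lambda>r. (r, - c * r^2)"], goal_cases)
  case (3 \<gamma> T)
  note cur = 3(2)
  let ?P = "\<lambda>x y. - 4*a*b*c*x - (a + b)*y + 3*(a + b)*c*x^2 + 4*x*y"
  let ?Q = "\<lambda>x y. (a + b)*a*b*x - 4*a*b*c*y + (4*a*b*c^2 - 3/2*(a + b)^2 + 4*a*b)*x^2 + 8*(a + b)*c*x*y + 8*y^2"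
  interpret periodic_solution ?P ?Q \<gamma> T by fact
  let ?F = "\<lambda>x y. (y + c*x^2)^2 + x^2*(x - a)*(x - b)"
  have f: "?F (x t) (y t) = 0" for t using cur by (auto simp: curve_def \<gamma>_eq)
  have "x t \<in> {a, b} \<and> y t = - c * (x t)^2" if "?P (x t) (y t) = 0" for t
  proof -
    have "2 * (y t + c * (x t)^2) = 0"
    proof (rule critical_fold[where g = "\<lambda>t. ?F (x t) (y t)" and ds = "\<lambda>t. ?P (x t) (y t)" and dw = "\<lambda>t. ?Q (x t) (y t)" and t = t])
      show "((\<lambda>t. ?F (x t) (y t)) has_real_derivative
          (2 * (y t + c * (x t)^2) * (2 * c * x t) + 2 * x t*(x t - a)*(x t - b) + (x t)^2*(x t - b) + (x t)^2*(x t - a)) * ?P (x t) (y t)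
          + 2 * (y t + c * (x t)^2) * ?Q (x t) (y t)) (at t)" for t
        by (rule derivative_eq_intros dx dy refl)+ (simp add: algebra_simps)
    qed (use that f in auto)
    then have y: "y t = - c * (x t)^2" by simp
    then have "(x t)^2 * (x t - a) * (x t - b) = 0" using f[of t] by simp
    moreover have "x t \<noteq> 0" using y no_equilibrium[of t] by auto
    ultimately show ?thesis using y by auto
  qed
  then show ?case
    using dx by (intro exI[of _ "\<lambda>t. ?P (x t) (y t)"]) (auto simp: y_def[abs_def] x_def[abs_def] prod_eq_iff)
qed (auto simp: card_insert_if)

text \<open>Completing the square, f = (x y + 1/2)^2 + x (1 - x + a x^2). At x = 0 the value of f is
  1/4, so x never vanishes on the curve.\<close>

lemma Chavarriga_Llibre_Sorolla_critical:
  shows "few_critical_points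
    (\<lambda>x y. 2*(1 + 2*x - 2*a*x^2 + 6*x*y)) (\<lambda>x y. 8 - 3*a - 14*a*x - 2*a*x*y - 8*y^2)
    (\<lambda>x y. 1/4 + x - x^2 + a*x^3 + x*y + x^2*y^2)"
proof (rule few_critical_pointsI[where R = "{r. 1 + (- 1) * r + a * r^2 + 0 * r^3 = 0}"
      and s = "\<lambda>z. fst z"
      and h = "\<lambda>r. (r, - 1/(2 * r))"], goal_cases)
  case (3 \<gamma> T)
  note cur = 3(2)
  let ?P = "\<lambda>x y. 2*(1 + 2*x - 2*a*x^2 + 6*x*y)"
  let ?Q = "\<lambda>x y. 8 - 3*a - 14*a*x - 2*a*x*y - 8*y^2"
  interpret periodic_solution ?P ?Q \<gamma> T by fact
  let ?F = "\<lambda>x y. 1/4 + x - x^2 + a*x^3 + x*y + x^2*y^2"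
  have f: "?F (x t) (y t) = 0" for t using cur by (auto simp: curve_def \<gamma>_eq)
  have "x t \<in> {r. 1 + (- 1) * r + a * r^2 + 0 * r^3 = 0} \<and> y t = - 1/(2 * x t)" if "?P (x t) (y t) = 0" for t
  proof -
    have x0: "x t \<noteq> 0" using f[of t] by auto
    have "x t + 2 * (x t)^2 * y t = 0"
    proof (rule critical_fold[where g = "\<lambda>t. ?F (x t) (y t)" and ds = "\<lambda>t. ?P (x t) (y t)" and dw = "\<lambda>t. ?Q (x t) (y t)" and t = t])
      show "((\<lambda>t. ?F (x t) (y t)) has_real_derivative
          (1 - 2 * x t + 3 * a * (x t)^2 + y t + 2 * x t * (y t)^2) * ?P (x t) (y t)
          + (x t + 2 * (x t)^2 * y t) * ?Q (x t) (y t)) (at t)" for t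
        by (rule derivative_eq_intros dx dy refl)+ (simp add: algebra_simps)
    qed (use that f in auto)
    then have "x t * (2 * (x t * y t) + 1) = 0" by algebra
    then have *: "2 * (x t * y t) = - 1" using x0 by simp
    have "4 * ?F (x t) (y t) = 1 + 4 * x t - 4 * (x t)^2 + 4 * a * (x t)^3 + 2 * (2 * (x t * y t)) + (2 * (x t * y t))^2"
      by (simp add: power_mult_distrib)
    then have "4 * (x t * (1 - x t + a * (x t)^2)) = 0"
      unfolding f * by (simp add: algebra_simps power2_eq_square power3_eq_cube)
    then have "1 - x t + a * (x t)^2 = 0" using x0 by simp
    then show ?thesis using x0 * by (simp add: field_simps)
  qed
  then show ?case
    using dx by (intro exI[of _ "\<lambda>t. ?P (x t) (y t)"]) (auto simp: y_def[abs_def] x_def[abs_def] prod_eq_iff)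
qed (rule cubic_roots, simp)+

text \<open>The part of f of lowest weight, with x of weight 2 and y of weight 1, is (x + a y^2)^2;
  hence the blow-up s = x / y^2, after which f / y^4 is quadratic in y. An orbit on the curve meets
  y = 0 only at x = -1, where y' = -1, so it never meets it. For a = 0 the curve consists of
  lines.\<close>

lemma Chavarriga_critical:
  shows "few_critical_points
    (\<lambda>x y. 5*x + 6*x^2 + 4*(1 + a)*x*y + a*y^2) (\<lambda>x y. x + 2*y + 4*x*y + (2 + 3*a)*y^2)
    (\<lambda>x y. x^2 + x^3 + x^2*y + 2*a*x*y^2 + 2*a*x*y^3 + a^2*y^4)"
proof (rule few_critical_pointsI[where R = "{r. 4*a^2 + (4*a - 4*a^2) * r + (1 - 8*a) * r^2 + (- 4) * r^3 = 0}"
      and s = "\<lambda>z. fst z / (snd z)^2"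
      and h = "\<lambda>r. let v = - (r + 2*a)/(2*r^2) in (r * v^2, v)"], goal_cases)
  case (3 \<gamma> T)
  note cur = 3(2)
  let ?P = "\<lambda>x y. 5*x + 6*x^2 + 4*(1 + a)*x*y + a*y^2"
  let ?Q = "\<lambda>x y. x + 2*y + 4*x*y + (2 + 3*a)*y^2"
  interpret periodic_solution ?P ?Q \<gamma> T by fact
  let ?f = "\<lambda>x y. x^2 + x^3 + x^2*y + 2*a*x*y^2 + 2*a*x*y^3 + a^2*y^4"
  have f: "?f (x t) (y t) = 0" for t using cur by (auto simp: curve_def \<gamma>_eq)
  have y0: "y t \<noteq> 0" for t
  proof (rule periodic_no_zero[OF dy T pery])
    have "?Q (x t) (y t) < 0" if "y t = 0" for t
    proof -
      have "(x t)^2 * (1 + x t) = 0" using f[of t] that by (simp add: algebra_simps power2_eq_square power3_eq_cube)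
      moreover have "x t \<noteq> 0" using no_equilibrium[of t] that by auto
      ultimately show ?thesis using that by auto
    qed
    then show "(\<forall>t. y t = 0 \<longrightarrow> 0 < ?Q (x t) (y t)) \<or> (\<forall>t. y t = 0 \<longrightarrow> ?Q (x t) (y t) < 0)" by blast
  qed
  have a0: "a \<noteq> 0"
  proof
    assume a: "a = 0"
    have dx': "(x has_real_derivative (5 + 6 * x t + 4 * y t) * x t) (at t)" for t
      using dx[of t] by (simp add: a algebra_simps power2_eq_square)
    have "continuous_on UNIV (\<lambda>t. 5 + 6 * x t + 4 * y t)" by (intro continuous_intros contx conty)
    then have x0: "x t \<noteq> 0" for t
      using not_line[of 1 0 0] by (cases rule: nonzero_or_zero[OF dx']) auto
    have "(x t)^2 * (1 * x t + 1 * y t + 1) = 0" for t using f[of t] by (simp add: a algebra_simps power2_eq_square power3_eq_cube)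
    then show False using not_line[of 1 1 1] x0 by simp
  qed
  define s where "s t = x t / (y t)^2" for t
  define ds where "ds t = (?P (x t) (y t) * (y t)^2 - x t * (2 * y t * ?Q (x t) (y t))) / (y t)^4" for t
  have ds: "(s has_real_derivative ds t) (at t)" for t
    unfolding s_def ds_def
    by (rule derivative_eq_intros dx dy refl)+ (use y0 in \<open>simp_all add: field_simps power2_eq_square power4_eq_xxxx\<close>)
  have x_eq: "x t = s t * (y t)^2" for t using y0 by (simp add: s_def)
  let ?F = "\<lambda>s y. (s + a)^2 + s*(s + 2*a)*y + s^3*y^2"
  have F: "?F (s t) (y t) = 0" for t
  proof -
    have "(y t)^4 * ?F (s t) (y t) = 0" using f[of t] unfolding x_eq by algebra
    then show ?thesis using y0 by simp
  qed
  have "s t \<in> {r. 4*a^2 + (4*a - 4*a^2) * r + (1 - 8*a) * r^2 + (- 4) * r^3 = 0} \<and> y t = - (s t + 2*a)/(2*(s t)^2)"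
    if d0: "ds t = 0" for t
  proof -
    have *: "s t*(s t + 2*a) + 2*(s t)^3 * y t = 0"
    proof (rule critical_fold[where g = "\<lambda>t. ?F (s t) (y t)" and ds = ds and dw = "\<lambda>t. ?Q (x t) (y t)" and t = t])
      show "((\<lambda>t. ?F (s t) (y t)) has_real_derivative
          (2*(s t + a) + (2 * s t + 2*a) * y t + 3*(s t)^2*(y t)^2) * ds t + (s t*(s t + 2*a) + 2*(s t)^3 * y t) * ?Q (x t) (y t)) (at t)" for t
        by (rule derivative_eq_intros ds dy refl)+ (simp add: algebra_simps)
    qed (use d0 y0 F in \<open>auto simp: ds_def\<close>)
    have s0: "s t \<noteq> 0" using F[of t] a0 by auto
    have "s t * (s t + 2*a + 2*(s t)^2 * y t) = 0" using * by algebra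
    then have **: "s t + 2*a + 2*(s t)^2 * y t = 0" using s0 by simp
    have "s t * (4*a^2 + (4*a - 4*a^2) * s t + (1 - 8*a) * (s t)^2 + (- 4) * (s t)^3) = 0"
      using F[of t] ** by algebra
    then have "4*a^2 + (4*a - 4*a^2) * s t + (1 - 8*a) * (s t)^2 + (- 4) * (s t)^3 = 0"
      using s0 by (simp only: mult_eq_0_iff) blast
    moreover have "y t = - (s t + 2*a)/(2*(s t)^2)" using s0 ** by (simp add: field_simps)
    ultimately show ?thesis by blast
  qed
  then have "s t \<in> {r. 4*a^2 + (4*a - 4*a^2) * r + (1 - 8*a) * r^2 + (- 4) * r^3 = 0} \<and>
      \<gamma> t = (\<lambda>r. let v = - (r + 2*a)/(2*r^2) in (r * v^2, v)) (s t)" if "ds t = 0" for t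
    using that x_eq[of t] by (simp add: Let_def \<gamma>_eq)
  then show ?case using ds unfolding s_def x_def y_def by blast
qed (rule cubic_roots, simp)+

text \<open>Near the origin the curve follows the parabola y = - a x^2, hence s = y / x^2; then f /
  x^4 is quadratic in x. On x = 0 away from the origin the curve equation fixes y and gives x' = -
  (3/2) (1 + a), so the axis cannot be crossed twice. For a = 0 and a = -1 the curve consists of
  lines.\<close>

lemma Filiptsov_critical:
  shows "few_critical_points
    (\<lambda>x y. 6*(1 + a)*x + 2*y - 6*(2 + a)*x^2 + 12*x*y)
    (\<lambda>x y. 15*(1 + a)*y + 3*a*(1 + a)*x^2 - 2*(9 + 5*a)*x*y + 16*y^2)
    (\<lambda>x y. 3*(1 + a)*(a*x^2 + y)^2 + 2*y^2*(2*y - 3*(1 + a)*x))"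
proof (rule few_critical_pointsI[where R = "{r. 4*a^2 + (5*a - 3) * r + 4 * r^2 + 0 * r^3 = 0}"
      and s = "\<lambda>z. snd z / (fst z)^2"
      and h = "\<lambda>r. let u = 3*(1 + a)/(4*r) in (u, r * u^2)"], goal_cases)
  case (3 \<gamma> T)
  note cur = 3(2)
  let ?P = "\<lambda>x y. 6*(1 + a)*x + 2*y - 6*(2 + a)*x^2 + 12*x*y"
  let ?Q = "\<lambda>x y. 15*(1 + a)*y + 3*a*(1 + a)*x^2 - 2*(9 + 5*a)*x*y + 16*y^2"
  interpret periodic_solution ?P ?Q \<gamma> T by fact
  let ?f = "\<lambda>x y. 3*(1 + a)*(a*x^2 + y)^2 + 2*y^2*(2*y - 3*(1 + a)*x)"
  have f: "?f (x t) (y t) = 0" for t using cur by (auto simp: curve_def \<gamma>_eq)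
  have a1: "1 + a \<noteq> 0"
  proof
    assume "1 + a = 0"
    then have "y t = 0" for t using f[of t] by simp
    then show False using not_line[of 0 1 0] by simp
  qed
  have a0: "a \<noteq> 0"
  proof
    assume a: "a = 0"
    have dy': "(y has_real_derivative (15 + 16 * y t - 18 * x t) * y t) (at t)" for t
      using dy[of t] by (simp add: a algebra_simps power2_eq_square)
    have "continuous_on UNIV (\<lambda>t. 15 + 16 * y t - 18 * x t)" by (intro continuous_intros contx conty)
    then have y0: "y t \<noteq> 0" for t
      using not_line[of 0 1 0] by (cases rule: nonzero_or_zero[OF dy']) auto
    have "(y t)^2 * (- 6 * x t + 4 * y t + 3) = 0" for t using f[of t] by (simp add: a algebra_simps power2_eq_square)
    then show False using not_line[of "- 6" 4 3] y0 by simp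
  qed
  have x0: "x t \<noteq> 0" for t
  proof (rule periodic_no_zero[OF dx T perx])
    have "?P (x t) (y t) = - 3/2 * (1 + a)" if "x t = 0" for t
    proof -
      have "(y t)^2 * (3 * (1 + a) + 4 * y t) = 0" using f[of t] that by (simp add: algebra_simps power2_eq_square)
      moreover have "y t \<noteq> 0" using no_equilibrium[of t] that by auto
      ultimately have "3 * (1 + a) + 4 * y t = 0" by simp
      moreover have "?P (x t) (y t) = 2 * y t" using that by simp
      ultimately show ?thesis by linarith
    qed
    then show "(\<forall>t. x t = 0 \<longrightarrow> 0 < ?P (x t) (y t)) \<or> (\<forall>t. x t = 0 \<longrightarrow> ?P (x t) (y t) < 0)"
      using a1 by (cases "1 + a > 0") auto
  qed
  define s where "s t = y t / (x t)^2" for t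
  define ds where "ds t = (?Q (x t) (y t) * (x t)^2 - y t * (2 * x t * ?P (x t) (y t))) / (x t)^4" for t
  have ds: "(s has_real_derivative ds t) (at t)" for t
    unfolding s_def ds_def
    by (rule derivative_eq_intros dx dy refl)+ (use x0 in \<open>simp_all add: field_simps power2_eq_square power4_eq_xxxx\<close>)
  have y_eq: "y t = s t * (x t)^2" for t using x0 by (simp add: s_def)
  let ?F = "\<lambda>s x. 3*(1 + a)*(a + s)^2 - 6*(1 + a) * s^2*x + 4 * s^3*x^2"
  have F: "?F (s t) (x t) = 0" for t
  proof -
    have "(x t)^4 * ?F (s t) (x t) = 0" using f[of t] unfolding y_eq by algebra
    then show ?thesis using x0 by simp
  qed
  have "s t \<in> {r. 4*a^2 + (5*a - 3) * r + 4 * r^2 + 0 * r^3 = 0} \<and> x t = 3*(1 + a)/(4 * s t)"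
    if d0: "ds t = 0" for t
  proof -
    have *: "8*(s t)^3 * x t - 6*(1 + a)*(s t)^2 = 0"
    proof (rule critical_fold[where g = "\<lambda>t. ?F (s t) (x t)" and ds = ds and dw = "\<lambda>t. ?P (x t) (y t)" and t = t])
      show "((\<lambda>t. ?F (s t) (x t)) has_real_derivative
          (6*(1 + a)*(a + s t) - 12*(1 + a) * s t*x t + 12*(s t)^2*(x t)^2) * ds t + (8*(s t)^3 * x t - 6*(1 + a)*(s t)^2) * ?P (x t) (y t)) (at t)" for t
        by (rule derivative_eq_intros ds dx refl)+ (simp add: algebra_simps)
    qed (use d0 x0 F in \<open>auto simp: ds_def\<close>)
    have s0: "s t \<noteq> 0" using F[of t] a0 a1 by auto
    have "(s t)^2 * (4 * s t * x t - 3*(1 + a)) = 0" using * by algebra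
    then have **: "4 * s t * x t - 3*(1 + a) = 0" using s0 by simp
    have "(1 + a) * (4*a^2 + (5*a - 3) * s t + 4 * (s t)^2 + 0 * (s t)^3) = 0"
      using F[of t] ** by algebra
    then have "4*a^2 + (5*a - 3) * s t + 4 * (s t)^2 + 0 * (s t)^3 = 0"
      using a1 by (simp only: mult_eq_0_iff) blast
    moreover have "x t = 3*(1 + a)/(4 * s t)" using s0 ** by (simp add: field_simps)
    ultimately show ?thesis by blast
  qed
  then have "s t \<in> {r. 4*a^2 + (5*a - 3) * r + 4 * r^2 + 0 * r^3 = 0} \<and>
      \<gamma> t = (\<lambda>r. let u = 3*(1 + a)/(4*r) in (u, r * u^2)) (s t)" if "ds t = 0" for t
    using that y_eq[of t] by (simp add: Let_def \<gamma>_eq)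
  then show ?case using ds unfolding s_def x_def y_def by blast
qed (rule cubic_roots, simp)+

text \<open>The factor a + 4 in \<open>s\<close> normalises the leading part of the blown-up curve
  to (s - 1)^2. The discriminant is (s - 1)^2 (M^2 - 4 s R), whose second factor is divisible by s -
  1 once more, leaving a quadratic. The value s = 1 is not attained, as the equation would reduce to
  R(1) y^2 = 0 with R(1) = (a + 4)^2 / 4.\<close>

lemma Christopher_Llibre_Swirszcz_5_critical:
  assumes a: "a \<noteq> - 4"
  shows "few_critical_points
    (\<lambda>x y. 28*x + 2*(16 - a^2)*(a + 12)*x^2 + 6*(3*a - 4)*x*y - 12/(a + 4)*y^2)
    (\<lambda>x y. 2*(16 - a^2)*x + 8*y + (16 - a^2)*(a + 12)*x*y + 2*(5*a - 12)*y^2)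
    (\<lambda>x y. x^2 + (16 - a^2)*x^3 + (a - 2)*x^2*y - 2/(a + 4)*x*y^2
       - 1/4*(4 - a)*(a + 12)*x^2*y^2 + (8 - a)/(a + 4)*x*y^3
       + 1/(a + 4)^2*y^4 + (a + 12)/(a + 4)*x*y^4 - 6/(a + 4)^2*y^5)"
proof (rule few_critical_pointsI[where R = "{r. 9 + (2*a - 9) * r + (4 - a) * r^2 + 0 * r^3 = 0}"
      and s = "\<lambda>z. (a + 4) * fst z / (snd z)^2"
      and h = "\<lambda>r. let v = - ((r - 1)*((a - 2)*r + 6)) / (2*r*((4 - a)*r^2 - (4 - a)*(a + 12)/4*r + (a + 12))) in (r * v^2/(a + 4), v)"], goal_cases)
  case (3 \<gamma> T)
  note cur = 3(2)
  let ?P = "\<lambda>x y. 28*x + 2*(16 - a^2)*(a + 12)*x^2 + 6*(3*a - 4)*x*y - 12/(a + 4)*y^2"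
  let ?Q = "\<lambda>x y. 2*(16 - a^2)*x + 8*y + (16 - a^2)*(a + 12)*x*y + 2*(5*a - 12)*y^2"
  interpret periodic_solution ?P ?Q \<gamma> T by fact
  let ?f = "\<lambda>x y. x^2 + (16 - a^2)*x^3 + (a - 2)*x^2*y - 2/(a + 4)*x*y^2
       - 1/4*(4 - a)*(a + 12)*x^2*y^2 + (8 - a)/(a + 4)*x*y^3
       + 1/(a + 4)^2*y^4 + (a + 12)/(a + 4)*x*y^4 - 6/(a + 4)^2*y^5"
  have f: "?f (x t) (y t) = 0" for t using cur by (auto simp: curve_def \<gamma>_eq)
  have a4: "a + 4 \<noteq> 0" using a by simp
  have y0: "y t \<noteq> 0" for t
  proof (rule periodic_no_zero[OF dy T pery])
    have "?Q (x t) (y t) < 0" if "y t = 0" for t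
    proof -
      have "(x t)^2 * (1 + (16 - a^2) * x t) = 0" using f[of t] that by (simp add: algebra_simps power2_eq_square power3_eq_cube)
      moreover have "x t \<noteq> 0" using no_equilibrium[of t] that by auto
      ultimately have *: "(16 - a^2) * x t = - 1" by simp
      have "?Q (x t) (y t) = 2 * ((16 - a^2) * x t)" using that by simp
      then show ?thesis unfolding * by simp
    qed
    then show "(\<forall>t. y t = 0 \<longrightarrow> 0 < ?Q (x t) (y t)) \<or> (\<forall>t. y t = 0 \<longrightarrow> ?Q (x t) (y t) < 0)" by blast
  qed
  define s where "s t = (a + 4) * x t / (y t)^2" for t
  define ds where "ds t = (a + 4) * (?P (x t) (y t) * (y t)^2 - x t * (2 * y t * ?Q (x t) (y t))) / (y t)^4" for t
  have ds: "(s has_real_derivative ds t) (at t)" for t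
    unfolding s_def ds_def
    by (rule derivative_eq_intros dx dy refl)+ (use y0 in \<open>simp_all add: divide_simps power2_eq_square power4_eq_xxxx\<close>)
  have x_eq: "x t = s t * (y t)^2 / (a + 4)" for t using y0 a4 by (simp add: s_def)
  define M where "M r = (a - 2)*r + 6" for r
  define R where "R r = (4 - a)*r^2 - (4 - a)*(a + 12)/4*r + (a + 12)" for r
  let ?F = "\<lambda>s y. (s - 1)^2 + (s - 1)*M s*y + s*R s*y^2"
  have F: "?F (s t) (y t) = 0" for t
  proof -
    have "(y t)^4 * ?F (s t) (y t) = (a + 4)^2 * ?f (x t) (y t)" unfolding x_eq M_def R_def using a4 by (simp add: divide_simps) algebra
    then show ?thesis unfolding f using y0 by simp
  qed
  have "R 1 = (a + 4)^2/4" by (simp add: R_def field_simps power2_eq_square)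
  then have s1: "s t \<noteq> 1" for t using F[of t] a4 y0[of t] by auto
  have "s t \<in> {r. 9 + (2*a - 9) * r + (4 - a) * r^2 + 0 * r^3 = 0} \<and> y t = - ((s t - 1)*M (s t)) / (2 * s t*R (s t))"
    if d0: "ds t = 0" for t
  proof -
    have *: "(s t - 1)*M (s t) + 2*(s t*R (s t)) * y t = 0"
    proof (rule critical_fold[where g = "\<lambda>t. ?F (s t) (y t)" and ds = ds and dw = "\<lambda>t. ?Q (x t) (y t)" and t = t])
      show "((\<lambda>t. ?F (s t) (y t)) has_real_derivative
          (2*(s t - 1) + (M (s t) + (s t - 1)*(a - 2)) * y t + (R (s t) + s t*(2*(4 - a) * s t - (4 - a)*(a + 12)/4)) * (y t)^2) * ds t
          + ((s t - 1)*M (s t) + 2*(s t*R (s t)) * y t) * ?Q (x t) (y t)) (at t)" for t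
        unfolding M_def R_def
        by (rule derivative_eq_intros ds dy refl)+ (simp add: field_simps power2_eq_square)
    qed (use d0 y0 a4 F in \<open>auto simp: ds_def\<close>)
    have "((s t - 1)*M (s t))^2 = 4 * (s t - 1)^2 * (s t*R (s t))"
      by (rule double_root[OF F *])
    then have "(s t - 1)^2 * ((M (s t))^2 - 4 * (s t*R (s t))) = 0" by algebra
    then have "(M (s t))^2 - 4 * (s t*R (s t)) = 0" using s1[of t] by simp
    moreover have "(M (s t))^2 - 4 * (s t*R (s t)) = - 4 * (s t - 1) * (9 + (2*a - 9) * s t + (4 - a) * (s t)^2 + 0 * (s t)^3)"
      unfolding M_def R_def by (simp add: field_simps, algebra)
    ultimately have "9 + (2*a - 9) * s t + (4 - a) * (s t)^2 + 0 * (s t)^3 = 0" using s1[of t] by auto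
    moreover have "s t * R (s t) \<noteq> 0" using F[of t] * s1[of t] by auto
    then have "y t = - ((s t - 1)*M (s t)) / (2 * s t*R (s t))" using * by (simp add: field_simps)
    ultimately show ?thesis by blast
  qed
  then have "s t \<in> {r. 9 + (2*a - 9) * r + (4 - a) * r^2 + 0 * r^3 = 0} \<and>
      \<gamma> t = (\<lambda>r. let v = - ((r - 1)*M r) / (2*r*R r) in (r * v^2/(a + 4), v)) (s t)" if "ds t = 0" for t
    using that x_eq[of t] by (simp add: Let_def \<gamma>_eq)
  then show ?case using ds unfolding s_def x_def y_def M_def R_def by blast
qed (rule cubic_roots, simp)+

text \<open>After the blow-up s = y / x^2 the discriminant contains the square of a s - 2. That
  factor does not vanish on an orbit, because R(2/a) = a/4; what is left is the cubic a M^2 - 4 R,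
  multiplied by a to clear denominators. On x = 0 the curve equation gives x' = 2, so this axis is
  not met.\<close>

lemma Alberich_Ferragut_Llibre_critical:
  assumes a: "a \<noteq> 0"
  shows "few_critical_points
    (\<lambda>x y. - 8*x + a/2*(a - 16)*y - (5*a - 64)*x^2 + a/8*(a^2 - 256)*x*y)
    (\<lambda>x y. - 28*y + 24/a*x^2 - 3*(3*a - 32)*x*y + a/4*(a^2 - 256)*y^2)
    (\<lambda>x y. a*y^2 - 4*x^2*y + a/2*(a - 12)*x*y^2 - a^2/4*(a - 16)*y^3 + 4/a*x^4
       + (24 - a)*x^3*y + a/16*(a^2 - 256)*x^2*y^2 - 24/a*x^5 + (a + 16)*x^4*y)"
proof (rule few_critical_pointsI[where R = "{r. 144 + (12*a*(a - 12) - 4*a*(a + 16)) * r + (a^2*(a - 12)^2/4 - a^2*(a^2 - 256)/4) * r^2 + a^3*(a - 16) * r^3 = 0}"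
      and s = "\<lambda>z. snd z / (fst z)^2"
      and h = "\<lambda>r. let u = - ((a*r - 2)*(1/2*(a - 12)*r + 12/a)) / (2*(- (a^2/4)*(a - 16)*r^3 + a/16*(a^2 - 256)*r^2 + (a + 16)*r)) in (u, r * u^2)"], goal_cases)
  case (3 \<gamma> T)
  note cur = 3(2)
  let ?P = "\<lambda>x y. - 8*x + a/2*(a - 16)*y - (5*a - 64)*x^2 + a/8*(a^2 - 256)*x*y"
  let ?Q = "\<lambda>x y. - 28*y + 24/a*x^2 - 3*(3*a - 32)*x*y + a/4*(a^2 - 256)*y^2"
  interpret periodic_solution ?P ?Q \<gamma> T by fact
  let ?f = "\<lambda>x y. a*y^2 - 4*x^2*y + a/2*(a - 12)*x*y^2 - a^2/4*(a - 16)*y^3 + 4/a*x^4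
       + (24 - a)*x^3*y + a/16*(a^2 - 256)*x^2*y^2 - 24/a*x^5 + (a + 16)*x^4*y"
  have f: "?f (x t) (y t) = 0" for t using cur by (auto simp: curve_def \<gamma>_eq)
  have x0: "x t \<noteq> 0" for t
  proof (rule periodic_no_zero[OF dx T perx])
    have "?P (x t) (y t) > 0" if "x t = 0" for t
    proof -
      have "a * (y t)^2 * (4 - a*(a - 16)*y t) = 4 * ?f (x t) (y t)" using that by (simp add: field_simps power2_eq_square power3_eq_cube)
      then have "a * (y t)^2 * (4 - a*(a - 16)*y t) = 0" unfolding f by simp
      moreover have "y t \<noteq> 0" using no_equilibrium[of t] that by auto
      ultimately have "a*(a - 16)*y t = 4" using a by simp
      then show ?thesis using that by (simp add: field_simps)
    qed
    then show "(\<forall>t. x t = 0 \<longrightarrow> 0 < ?P (x t) (y t)) \<or> (\<forall>t. x t = 0 \<longrightarrow> ?P (x t) (y t) < 0)" by blast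
  qed
  define s where "s t = y t / (x t)^2" for t
  define ds where "ds t = (?Q (x t) (y t) * (x t)^2 - y t * (2 * x t * ?P (x t) (y t))) / (x t)^4" for t
  have ds: "(s has_real_derivative ds t) (at t)" for t
    unfolding s_def ds_def
    by (rule derivative_eq_intros dx dy refl)+ (use x0 a in \<open>simp_all add: divide_simps power2_eq_square power4_eq_xxxx\<close>)
  have y_eq: "y t = s t * (x t)^2" for t using x0 by (simp add: s_def)
  define M where "M r = 1/2*(a - 12)*r + 12/a" for r
  define R where "R r = - (a^2/4)*(a - 16)*r^3 + a/16*(a^2 - 256)*r^2 + (a + 16)*r" for r
  let ?F = "\<lambda>s x. 1/a * (a * s - 2)^2 + (a * s - 2)*M s*x + R s*x^2"
  have F: "?F (s t) (x t) = 0" for t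
  proof -
    have "(x t)^4 * ?F (s t) (x t) = ?f (x t) (y t)" unfolding y_eq M_def R_def using a by (simp add: divide_simps) algebra
    then show ?thesis unfolding f using x0 by simp
  qed
  have s2: "a * s t - 2 \<noteq> 0" for t
  proof
    assume *: "a * s t - 2 = 0"
    then have "s t = 2/a" using a by (simp add: field_simps)
    moreover have "R (2/a) = a/4" using a unfolding R_def by (simp add: divide_simps) algebra
    ultimately have "R (s t) = a/4" by simp
    then show False using F[of t] x0[of t] a * by simp
  qed
  have "s t \<in> {r. 144 + (12*a*(a - 12) - 4*a*(a + 16)) * r + (a^2*(a - 12)^2/4 - a^2*(a^2 - 256)/4) * r^2 + a^3*(a - 16) * r^3 = 0}
      \<and> x t = - ((a * s t - 2)*M (s t)) / (2*R (s t))"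
    if d0: "ds t = 0" for t
  proof -
    have *: "(a * s t - 2)*M (s t) + 2*R (s t) * x t = 0"
    proof (rule critical_fold[where g = "\<lambda>t. ?F (s t) (x t)" and ds = ds and dw = "\<lambda>t. ?P (x t) (y t)" and t = t])
      fix t
      have dM: "((\<lambda>t. M (s t)) has_real_derivative 1/2*(a - 12) * ds t) (at t)"
        unfolding M_def by (rule derivative_eq_intros ds refl)+ simp
      have dR: "((\<lambda>t. R (s t)) has_real_derivative
          (- (a^2/4)*(a - 16)*3*(s t)^2 + a/16*(a^2 - 256)*2 * s t + (a + 16)) * ds t) (at t)"
        unfolding R_def by (rule derivative_eq_intros ds refl)+ (simp add: algebra_simps)
      show "((\<lambda>t. ?F (s t) (x t)) has_real_derivative
          (2*(1/a)*a*(a * s t - 2) + (a*M (s t) + (a * s t - 2)*(1/2*(a - 12))) * x t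
            + (- (a^2/4)*(a - 16)*3*(s t)^2 + a/16*(a^2 - 256)*2 * s t + (a + 16)) * (x t)^2) * ds t
          + ((a * s t - 2)*M (s t) + 2*R (s t) * x t) * ?P (x t) (y t)) (at t)"
        by (rule derivative_eq_intros ds dx dM dR refl)+ (simp only: algebra_simps mult_zero_left power_Suc power_0 numeral_2_eq_2 diff_Suc_Suc, simp add: algebra_simps)
    qed (use d0 x0 F in \<open>auto simp: ds_def\<close>)
    have "((a * s t - 2)*M (s t))^2 = 4 * (1/a * (a * s t - 2)^2) * R (s t)"
      by (rule double_root[OF F *])
    then have "a * ((a * s t - 2)*M (s t))^2 = 4 * (a * s t - 2)^2 * R (s t)" using a by simp
    then have "(a * s t - 2)^2 * ((M (s t))^2 * a - 4 * R (s t)) = 0" by algebra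
    then have "(M (s t))^2 * a - 4 * R (s t) = 0" using s2[of t] by simp
    moreover have "144 + (12*a*(a - 12) - 4*a*(a + 16)) * s t + (a^2*(a - 12)^2/4 - a^2*(a^2 - 256)/4) * (s t)^2 + a^3*(a - 16) * (s t)^3
        = a * ((M (s t))^2 * a - 4 * R (s t))"
      unfolding M_def R_def using a by (simp add: divide_simps) algebra
    ultimately have "144 + (12*a*(a - 12) - 4*a*(a + 16)) * s t + (a^2*(a - 12)^2/4 - a^2*(a^2 - 256)/4) * (s t)^2 + a^3*(a - 16) * (s t)^3 = 0"
      by simp
    moreover have "R (s t) \<noteq> 0" using F[of t] * s2[of t] a by auto
    then have "x t = - ((a * s t - 2)*M (s t)) / (2*R (s t))" using * by (simp add: field_simps)
    ultimately show ?thesis by blast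
  qed
  then have "s t \<in> {r. 144 + (12*a*(a - 12) - 4*a*(a + 16)) * r + (a^2*(a - 12)^2/4 - a^2*(a^2 - 256)/4) * r^2 + a^3*(a - 16) * r^3 = 0} \<and>
      \<gamma> t = (\<lambda>r. let u = - ((a*r - 2)*M r) / (2*R r) in (u, r * u^2)) (s t)" if "ds t = 0" for t
    using that y_eq[of t] by (simp add: Let_def \<gamma>_eq)
  then show ?case using ds unfolding s_def x_def y_def M_def R_def by blast
qed (rule cubic_roots, simp)+

text \<open>The quadratic part of f is 3 a (a - 30)^2 (y + 4 a (a - 30) x)^2, so the curve has a
  double tangent at the origin, and the blow-up follows that tangent. The discriminant contains the
  square of G; the remaining factor 3 a M^2 - R gives the cubic.\<close>

lemma Christopher_Llibre_Swirszcz_6_critical: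
  shows "few_critical_points
    (\<lambda>x y. 28*a*(a - 30)*x + y + 168*a^2*x^2 + 3*x*y)
    (\<lambda>x y. 16*a*(a - 30)*(14*a*(a - 30)*x + 5*y + 84*a^2*x^2) + 24*a*(17*a - 6)*x*y + 6*y^2)
    (\<lambda>x y. 48*a^3*(a - 30)^4*x^2 + 24*a^2*(a - 30)^3*x*y + 3*a*(a - 30)^2*y^2
       + 64*a^3*(a - 30)^3*(9*a - 4)*x^3 + 24*a^2*(a - 30)^2*(9*a - 4)*x^2*y
       + 18*a*(a - 30)*(a - 2)*x*y^2 - 7*y^3
       + 576*a^3*(a - 30)^2*(a - 2)^2*x^4 + 144*a^2*(a - 30)*(a - 2)^2*x^3*y
       + 27*a*(a - 2)^2*x^2*y^2 - 3456*a^3*(a - 30)*(a - 2)^2*(2*a + 3)*x^5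
       - 432*a^2*(a - 2)^2*(2*a + 3)*x^4*y
       + 3456*a^3*(a - 2)^2*(a + 12)*(2*a + 3)*x^6)"
proof (rule few_critical_pointsI[where R = "{r. - 36288*a^3*(a - 2)^2*(2*a + 3) + (- 2016*a^2*(a - 2)*(2*a + 3)) * r + 84*a*(3*a + 1) * r^2 + 7 * r^3 = 0}"
      and s = "\<lambda>z. (snd z + 4*a*(a - 30) * fst z) / (fst z)^2"
      and h = "\<lambda>r. let u = - (6*a*(a - 30)*(r + 12*a*(a - 2))*((3*a + 8)*r - 24*a*(a - 2)*(2*a + 3))) / (2*(3456*a^3*(a - 2)^2*(a + 12)*(2*a + 3) - 432*a^2*(a - 2)^2*(2*a + 3)*r + 27*a*(a - 2)^2*r^2 - 7*r^3)) in (u, r * u^2 - 4*a*(a - 30)*u)"], goal_cases)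
  case (3 \<gamma> T)
  note cur = 3(2)
  let ?P = "\<lambda>x y. 28*a*(a - 30)*x + y + 168*a^2*x^2 + 3*x*y"
  let ?Q = "\<lambda>x y. 16*a*(a - 30)*(14*a*(a - 30)*x + 5*y + 84*a^2*x^2) + 24*a*(17*a - 6)*x*y + 6*y^2"
  interpret periodic_solution ?P ?Q \<gamma> T by fact
  let ?f = "\<lambda>x y. 48*a^3*(a - 30)^4*x^2 + 24*a^2*(a - 30)^3*x*y + 3*a*(a - 30)^2*y^2
       + 64*a^3*(a - 30)^3*(9*a - 4)*x^3 + 24*a^2*(a - 30)^2*(9*a - 4)*x^2*y
       + 18*a*(a - 30)*(a - 2)*x*y^2 - 7*y^3
       + 576*a^3*(a - 30)^2*(a - 2)^2*x^4 + 144*a^2*(a - 30)*(a - 2)^2*x^3*y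
       + 27*a*(a - 2)^2*x^2*y^2 - 3456*a^3*(a - 30)*(a - 2)^2*(2*a + 3)*x^5
       - 432*a^2*(a - 2)^2*(2*a + 3)*x^4*y
       + 3456*a^3*(a - 2)^2*(a + 12)*(2*a + 3)*x^6"
  have f: "?f (x t) (y t) = 0" for t using cur by (auto simp: curve_def \<gamma>_eq)
  have a0: "a \<noteq> 0" "a \<noteq> 30" using Christopher_Llibre_Swirszcz_6_none[OF 3(1)] by auto
  then have a30: "a - 30 \<noteq> 0" by simp
  \<comment> \<open>For a = 2 the curve splits into two lines, one of them invariant with the
    explicit cofactor below.\<close>
  have a2: "a \<noteq> 2"
  proof
    assume a: "a = 2"
    have dv: "((\<lambda>t. y t - 224 * x t) has_real_derivative (2016 * x t + 6 * y t - 4704) * (y t - 224 * x t)) (at t)" for t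
      by (rule derivative_eq_intros dx dy refl)+ (simp add: a, algebra)
    have "continuous_on UNIV (\<lambda>t. 2016 * x t + 6 * y t - 4704)" by (intro continuous_intros contx conty)
    then have v0: "y t - 224 * x t \<noteq> 0" for t
      using not_line[of "- 224" 1 0] by (cases rule: nonzero_or_zero[OF dv]) auto
    have "(y t - 224 * x t)^2 * (- 3136 * x t + (- 7) * y t + 4704) = 0" for t
    proof -
      have "?f (x t) (y t) = (y t - 224 * x t)^2 * (- 3136 * x t + (- 7) * y t + 4704)" by (simp add: a, algebra)
      then show ?thesis using f[of t] by simp
    qed
    then show False using not_line[of "- 3136" "- 7" 4704] v0 by simp
  qed
  have x0: "x t \<noteq> 0" for t
  proof (rule periodic_no_zero[OF dx T perx])
    have "?P (x t) (y t) = 3/7 * a * (a - 30)^2" if "x t = 0" for t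
    proof -
      have "(y t)^2 * (3 * a * (a - 30)^2 - 7 * y t) = 0"
        using f[of t] that by (simp add: algebra_simps power2_eq_square power3_eq_cube)
      moreover have "y t \<noteq> 0" using no_equilibrium[of t] that by auto
      ultimately have "3 * a * (a - 30)^2 - 7 * y t = 0" by simp
      moreover have "?P (x t) (y t) = y t" using that by simp
      ultimately show ?thesis by linarith
    qed
    moreover have "3/7 * a * (a - 30)^2 > 0 \<or> 3/7 * a * (a - 30)^2 < 0"
      using a0 a30 by (cases "a > 0") (auto simp: mult_less_0_iff zero_less_mult_iff)
    ultimately show "(\<forall>t. x t = 0 \<longrightarrow> 0 < ?P (x t) (y t)) \<or> (\<forall>t. x t = 0 \<longrightarrow> ?P (x t) (y t) < 0)" by metis
  qed
  define s where "s t = (y t + 4*a*(a - 30) * x t) / (x t)^2" for t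
  define ds where "ds t = ((?Q (x t) (y t) + 4*a*(a - 30) * ?P (x t) (y t)) * (x t)^2
      - (y t + 4*a*(a - 30) * x t) * (2 * x t * ?P (x t) (y t))) / (x t)^4" for t
  have ds: "(s has_real_derivative ds t) (at t)" for t
    unfolding s_def ds_def
    by (rule derivative_eq_intros dx dy refl)+ (use x0 in \<open>simp_all add: power2_eq_square power4_eq_xxxx mult_ac\<close>)
  have y_eq: "y t = s t * (x t)^2 - 4*a*(a - 30) * x t" for t using x0 by (simp add: s_def)
  define G where "G r = r + 12*a*(a - 2)" for r
  define M where "M r = (3*a + 8)*r - 24*a*(a - 2)*(2*a + 3)" for r
  define R where "R r = 3456*a^3*(a - 2)^2*(a + 12)*(2*a + 3) - 432*a^2*(a - 2)^2*(2*a + 3)*r + 27*a*(a - 2)^2*r^2 - 7*r^3" for r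
  let ?F = "\<lambda>s x. 3*a*(a - 30)^2*(G s)^2 + 6*a*(a - 30)*G s*M s*x + R s*x^2"
  have F: "?F (s t) (x t) = 0" for t
  proof -
    have "(x t)^4 * ?F (s t) (x t) = ?f (x t) (y t)" unfolding y_eq G_def M_def R_def by algebra
    then show ?thesis unfolding f using x0 by simp
  qed
  \<comment> \<open>Where G vanishes the curve equation forces R = 0, but at that root R is a
    multiple of a^3 (a - 2)^2 (a + 2)^2. For a = -2 the zero set of G is an invariant parabola, a
    graph over the x-axis, which carries no periodic orbit.\<close>
  have G0: "G (s t) \<noteq> 0" for t
  proof (cases "a = - 2")
    case True
    have dv: "((\<lambda>t. y t + 256 * x t + 96 * (x t)^2) has_real_derivative (1344 * x t + 6 * y t + 5376) * (y t + 256 * x t + 96 * (x t)^2)) (at t)" for t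
      by (rule derivative_eq_intros dx dy refl)+ (simp add: True, algebra)
    have "continuous_on UNIV (\<lambda>t. 1344 * x t + 6 * y t + 5376)" by (intro continuous_intros contx conty)
    moreover have "\<not> (\<forall>t. y t + 256 * x t + 96 * (x t)^2 = 0)"
    proof
      assume "\<forall>t. y t + 256 * x t + 96 * (x t)^2 = 0"
      then have "\<forall>t. y t = - 256 * x t - 96 * (x t)^2" by (metis add_diff_cancel_left' diff_0 minus_mult_left diff_diff_eq2 add.commute diff_add_eq)
      then show False using not_graph[of "\<lambda>u. - 256 * u - 96 * u^2"] by (simp add: continuous_intros)
    qed
    ultimately have "y t + 256 * x t + 96 * (x t)^2 \<noteq> 0"
      using linear_ode_zero[OF dv] by blast
    moreover have "y t + 256 * x t + 96 * (x t)^2 = (x t)^2 * G (s t)" unfolding y_eq by (simp add: True G_def algebra_simps)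
    ultimately show ?thesis by auto
  next
    case False
    show ?thesis
    proof
      assume G: "G (s t) = 0"
      then have "s t = - 12*a*(a - 2)" by (simp add: G_def)
      moreover have "R (- 12*a*(a - 2)) = 432*49*a^3*(a - 2)^2*(a + 2)^2" unfolding R_def by algebra
      ultimately have "R (s t) = 432*49*a^3*(a - 2)^2*(a + 2)^2" by simp
      moreover have "R (s t) = 0" using F[of t] G x0[of t] by simp
      ultimately show False using a0 a2 False by (simp add: add_eq_0_iff)
    qed
  qed
  have "s t \<in> {r. - 36288*a^3*(a - 2)^2*(2*a + 3) + (- 2016*a^2*(a - 2)*(2*a + 3)) * r + 84*a*(3*a + 1) * r^2 + 7 * r^3 = 0}
      \<and> x t = - (6*a*(a - 30)*G (s t)*M (s t)) / (2*R (s t))"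
    if d0: "ds t = 0" for t
  proof -
    have *: "6*a*(a - 30)*G (s t)*M (s t) + 2*R (s t) * x t = 0"
    proof (rule critical_fold[where g = "\<lambda>t. ?F (s t) (x t)" and ds = ds and dw = "\<lambda>t. ?P (x t) (y t)" and t = t])
      fix t
      have dG: "((\<lambda>t. G (s t)) has_real_derivative ds t) (at t)"
        unfolding G_def by (rule derivative_eq_intros ds refl)+ simp
      have dM: "((\<lambda>t. M (s t)) has_real_derivative (3*a + 8) * ds t) (at t)"
        unfolding M_def by (rule derivative_eq_intros ds refl)+ simp
      have dR: "((\<lambda>t. R (s t)) has_real_derivative
          (- 432*a^2*(a - 2)^2*(2*a + 3) + 54*a*(a - 2)^2 * s t - 21*(s t)^2) * ds t) (at t)"
        unfolding R_def by (rule derivative_eq_intros ds refl)+ (simp add: algebra_simps)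
      show "((\<lambda>t. ?F (s t) (x t)) has_real_derivative
          (6*a*(a - 30)^2*G (s t) + 6*a*(a - 30)*(M (s t) + G (s t)*(3*a + 8)) * x t
            + (- 432*a^2*(a - 2)^2*(2*a + 3) + 54*a*(a - 2)^2 * s t - 21*(s t)^2) * (x t)^2) * ds t
          + (6*a*(a - 30)*G (s t)*M (s t) + 2*R (s t) * x t) * ?P (x t) (y t)) (at t)"
        by (rule derivative_eq_intros dx dG dM dR refl)+ (simp add: algebra_simps)
    qed (use d0 x0 F in \<open>auto simp: ds_def\<close>)
    have "(6*a*(a - 30)*G (s t)*M (s t))^2 = 4 * (3*a*(a - 30)^2*(G (s t))^2) * R (s t)"
      by (rule double_root[OF F *])
    then have "(12*a*(a - 30)^2*(G (s t))^2) * (3*a*(M (s t))^2 - R (s t)) = 0" by algebra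
    then have "3*a*(M (s t))^2 - R (s t) = 0" using G0[of t] a0 a30 by simp
    then have "- 36288*a^3*(a - 2)^2*(2*a + 3) + (- 2016*a^2*(a - 2)*(2*a + 3)) * s t + 84*a*(3*a + 1) * (s t)^2 + 7 * (s t)^3 = 0"
      unfolding M_def R_def by algebra
    moreover have "R (s t) \<noteq> 0" using F[of t] * G0[of t] a0 a30 by auto
    then have "x t = - (6*a*(a - 30)*G (s t)*M (s t)) / (2*R (s t))" using * by (simp add: field_simps)
    ultimately show ?thesis by blast
  qed
  then have "s t \<in> {r. - 36288*a^3*(a - 2)^2*(2*a + 3) + (- 2016*a^2*(a - 2)*(2*a + 3)) * r + 84*a*(3*a + 1) * r^2 + 7 * r^3 = 0} \<and>
      \<gamma> t = (\<lambda>r. let u = - (6*a*(a - 30)*G r*M r) / (2*R r) in (u, r * u^2 - 4*a*(a - 30)*u)) (s t)" if "ds t = 0" for t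
    using that y_eq[of t] by (simp add: Let_def \<gamma>_eq)
  then show ?case using ds unfolding s_def x_def y_def G_def M_def R_def by blast
qed (rule cubic_roots, simp)+

subsection \<open>Limit cycles of the eight families\<close>

text \<open>The cofactor equation is stated with partial derivatives, whereas the chain rule along
  the orbit needs the total derivative D of f. Since f is a polynomial, D exists, and its values on
  the unit vectors are those partial derivatives; so f' = k f along the orbit.\<close>

lemma (in periodic_solution) invariant_curve_dichotomy:
  assumes "invariant_algebraic_curve P Q f"
  shows "(\<forall>t. f (x t) (y t) = 0) \<or> (\<forall>t. f (x t) (y t) \<noteq> 0)"
proof -
  obtain k where f: "real_polynomial_function (\<lambda>(x, y). f x y)" and k: "real_polynomial_function (\<lambda>(x, y). k x y)"
    and cof: "\<And>u v. deriv (\<lambda>s. f s v) u * P u v + deriv (\<lambda>s. f u s) v * Q u v = k u v * f u v"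
    using assms unfolding invariant_algebraic_curve_def by blast
  have df: "((\<lambda>t. f (x t) (y t)) has_real_derivative k (x t) (y t) * f (x t) (y t)) (at t)" for t
  proof -
    have "(\<lambda>(x, y). f x y) differentiable (at (x t, y t))" by (rule differentiable_at_real_polynomial_function[OF f])
    then obtain D where D: "((\<lambda>(x, y). f x y) has_derivative D) (at (x t, y t))" unfolding differentiable_def by blast
    then interpret D: bounded_linear D by (rule has_derivative_bounded_linear)
    have "((\<lambda>s. (s, y t)) has_derivative (\<lambda>h. (h, 0))) (at (x t))"
      by (auto intro!: derivative_eq_intros)
    from has_derivative_compose[OF this, of "\<lambda>(x, y). f x y" D] D
    have "((\<lambda>s. f s (y t)) has_derivative (\<lambda>h. D (h, 0))) (at (x t))" by simp
    moreover have "(\<lambda>h. D (h, 0)) = (*) (D (1, 0))"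
    proof
      fix h
      show "D (h, 0) = D (1, 0) * h" using D.scaleR[of h "(1, 0)"] by (simp only: mult.commute real_scaleR_def scaleR_Pair mult_zero_right mult_1_right mult_1_left mult_zero_left)
    qed
    ultimately have dx1: "deriv (\<lambda>s. f s (y t)) (x t) = D (1, 0)"
      by (intro DERIV_imp_deriv) (simp only: has_field_derivative_def)
    have "((\<lambda>s. (x t, s)) has_derivative (\<lambda>h. (0, h))) (at (y t))"
      by (auto intro!: derivative_eq_intros)
    from has_derivative_compose[OF this, of "\<lambda>(x, y). f x y" D] D
    have "((\<lambda>s. f (x t) s) has_derivative (\<lambda>h. D (0, h))) (at (y t))" by simp
    moreover have "(\<lambda>h. D (0, h)) = (*) (D (0, 1))"
    proof
      fix h
      show "D (0, h) = D (0, 1) * h" using D.scaleR[of h "(0, 1)"] by (simp only: mult.commute real_scaleR_def scaleR_Pair mult_zero_right mult_1_right mult_1_left mult_zero_left)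
    qed
    ultimately have dy1: "deriv (\<lambda>s. f (x t) s) (y t) = D (0, 1)"
      by (intro DERIV_imp_deriv) (simp only: has_field_derivative_def)
    have "((\<lambda>t. (x t, y t)) has_derivative (\<lambda>h. (P (x t) (y t) * h, Q (x t) (y t) * h))) (at t)"
      using dx dy by (auto intro!: has_derivative_Pair simp: has_field_derivative_def)
    from has_derivative_compose[OF this D]
    have "((\<lambda>t. f (x t) (y t)) has_derivative (\<lambda>h. D (P (x t) (y t) * h, Q (x t) (y t) * h))) (at t)" by simp
    moreover have "(\<lambda>h. D (P (x t) (y t) * h, Q (x t) (y t) * h)) = (*) (k (x t) (y t) * f (x t) (y t))"
    proof
      fix h
      have "D (P (x t) (y t) * h, Q (x t) (y t) * h) = (P (x t) (y t) * h) * D (1, 0) + (Q (x t) (y t) * h) * D (0, 1)"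
        using D.add[of "(P (x t) (y t) * h, 0)" "(0, Q (x t) (y t) * h)"]
          D.scaleR[of "P (x t) (y t) * h" "(1, 0)"] D.scaleR[of "Q (x t) (y t) * h" "(0, 1)"] by simp
      also have "\<dots> = (D (1, 0) * P (x t) (y t) + D (0, 1) * Q (x t) (y t)) * h" by (simp add: algebra_simps)
      finally show "D (P (x t) (y t) * h, Q (x t) (y t) * h) = k (x t) (y t) * f (x t) (y t) * h"
        unfolding dx1[symmetric] dy1[symmetric] cof .
    qed
    ultimately show ?thesis by (simp only: has_field_derivative_def)
  qed
  have "continuous_on UNIV (\<lambda>t. k (x t) (y t))"
  proof -
    have "continuous_on UNIV (\<lambda>(x, y). k x y)"
      by (intro continuous_at_imp_continuous_on ballI continuous_real_polymonial_function k)
    from continuous_on_compose2[OF this continuous_on_Pair[OF contx conty] subset_UNIV] show ?thesis by simp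
  qed
  then show ?thesis using linear_ode_zero[OF df] by blast
qed

text \<open>The hypothesis \<open>off\<close> may use that the orbit is a limit cycle: for the
  reversible subfamilies, orbits off the curve are ruled out only as limit cycles.\<close>

lemma limit_cycles_on_curve:
  assumes "polynomial_field P Q" and inv: "invariant_algebraic_curve P Q f"
    and off: "\<And>\<gamma> T. periodic_solution P Q \<gamma> T \<Longrightarrow> limit_cycle P Q (range \<gamma>) \<Longrightarrow>
      (\<And>t. (\<lambda>(x, y). f x y) (\<gamma> t) \<noteq> 0) \<Longrightarrow> False"
    and few: "few_critical_points P Q f"
  shows "(\<forall>\<Gamma> \<Delta>. limit_cycle P Q \<Gamma> \<longrightarrow> limit_cycle P Q \<Delta> \<longrightarrow> \<Gamma> = \<Delta>) \<and>
    (\<forall>\<Gamma>. limit_cycle P Q \<Gamma> \<longrightarrow> algebraic_limit_cycle P Q \<Gamma> \<and> \<Gamma> \<subseteq> curve f)"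
proof -
  interpret polynomial_field P Q by fact
  have on: "\<Gamma> \<subseteq> curve f" if lc: "limit_cycle P Q \<Gamma>" for \<Gamma>
  proof -
    obtain \<gamma> T where g: "periodic_solution P Q \<gamma> T" "\<Gamma> = range \<gamma>"
      using periodic_orbitE lc unfolding limit_cycle_def by metis
    interpret periodic_solution P Q \<gamma> T by fact
    have "\<not> (\<forall>t. f (x t) (y t) \<noteq> 0)" using off[OF g(1)] lc g(2) by (auto simp: \<gamma>_eq)
    then have "\<forall>t. f (x t) (y t) = 0" using invariant_curve_dichotomy[OF inv] by blast
    then show ?thesis by (auto simp: g(2) curve_def \<gamma>_eq)
  qed
  have "\<Gamma> = \<Delta>" if "limit_cycle P Q \<Gamma>" "limit_cycle P Q \<Delta>" for \<Gamma> \<Delta>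
  proof (rule unique_by_critical_points[OF _ _ _ _ few])
    show "periodic_orbit P Q \<Gamma>" "periodic_orbit P Q \<Delta>" using that by (auto simp: limit_cycle_def)
    show "\<Gamma> \<subseteq> curve f" "\<Delta> \<subseteq> curve f" using on that by blast+
  qed
  then show ?thesis using on inv unfolding algebraic_limit_cycle_def by blast
qed

text \<open>This supplies the point on the axis of reflection. In both reversible subfamilies the
  cofactor is a multiple of the coordinate that vanishes on the axis; if it kept its sign along the
  orbit, the logarithm of |f| would be monotone and periodic.\<close>

lemma (in periodic_solution) cofactor_coordinate_zero:
  assumes f: "\<And>t. (f has_real_derivative c * w t * f t) (at t)" "\<And>t. f t \<noteq> 0" "\<And>t. f (t + T) = f t"
    and c: "c \<noteq> 0" and w: "continuous_on UNIV w"
  obtains t where "w t = 0"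
proof (rule ccontr)
  assume "\<not> thesis"
  then have nz: "w t \<noteq> 0" for t using that by blast
  obtain K where K: "\<And>t. (K has_real_derivative c * w t) (at t)" "\<And>t. K (t + T) = K t"
    using log_cofactor[OF f] by blast
  have "(\<forall>t. c * w t \<ge> 0) \<or> (\<forall>t. c * w t \<le> 0)"
    using nonzero_imp_one_sign[OF w nz] by (cases "c > 0") (auto simp: mult_le_0_iff zero_le_mult_iff less_imp_le)
  then have "c * w 0 = 0" by (rule periodic_derivative_one_sign[OF K(1) _ T K(2)])
  then show False using c nz by simp
qed

text \<open>For a = 0 the reflection of x reverses the field, and the cofactor is - 2 x. The term
  \<open>0*x\<close> is kept so that the field is literally the member of the family with a =
  0.\<close>

lemma Qin_center:
  assumes "periodic_solution (\<lambda>x y. - y * (0*x + b*y + c) - (x^2 + y^2 - 1)) (\<lambda>x y. x * (0*x + b*y + c)) \<gamma> T"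
    and nz: "\<And>t. (fst (\<gamma> t))^2 + (snd (\<gamma> t))^2 - 1 \<noteq> 0"
  shows "\<not> limit_cycle (\<lambda>x y. - y * (0*x + b*y + c) - (x^2 + y^2 - 1)) (\<lambda>x y. x * (0*x + b*y + c)) (range \<gamma>)"
proof -
  interpret periodic_solution "\<lambda>x y. - y * (0*x + b*y + c) - (x^2 + y^2 - 1)" "\<lambda>x y. x * (0*x + b*y + c)" \<gamma> T by fact
  have f: "((\<lambda>t. (x t)\<^sup>2 + (y t)\<^sup>2 - 1) has_real_derivative - 2 * x t * ((x t)\<^sup>2 + (y t)\<^sup>2 - 1)) (at t)" for t
    by (rule derivative_eq_intros dx dy refl)+ (simp, algebra)
  obtain t0 where t0: "x t0 = 0"
    using cofactor_coordinate_zero[OF f _ _ _ contx] nz by (auto simp: per x_def y_def)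
  show ?thesis by (rule reversible_x_not_isolated[OF _ _ t0]) auto
qed

text \<open>For c = 0 the reflection of y reverses the field, and the cofactor is 16 y.\<close>

lemma Yablonskii_center:
  assumes "periodic_solution
     (\<lambda>x y. - 4*a*b*0*x - (a + b)*y + 3*(a + b)*0*x^2 + 4*x*y)
     (\<lambda>x y. (a + b)*a*b*x - 4*a*b*0*y
       + (4*a*b*0^2 - 3/2*(a + b)^2 + 4*a*b)*x^2 + 8*(a + b)*0*x*y + 8*y^2) \<gamma> T"
    and nz: "\<And>t. (\<lambda>(x, y). (y + 0*x^2)^2 + x^2*(x - a)*(x - b)) (\<gamma> t) \<noteq> 0"
  shows "\<not> limit_cycle
     (\<lambda>x y. - 4*a*b*0*x - (a + b)*y + 3*(a + b)*0*x^2 + 4*x*y)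
     (\<lambda>x y. (a + b)*a*b*x - 4*a*b*0*y
       + (4*a*b*0^2 - 3/2*(a + b)^2 + 4*a*b)*x^2 + 8*(a + b)*0*x*y + 8*y^2) (range \<gamma>)"
proof -
  let ?P = "\<lambda>x y. - 4*a*b*0*x - (a + b)*y + 3*(a + b)*0*x^2 + 4*x*y"
  let ?Q = "\<lambda>x y. (a + b)*a*b*x - 4*a*b*0*y + (4*a*b*0^2 - 3/2*(a + b)^2 + 4*a*b)*x^2 + 8*(a + b)*0*x*y + 8*y^2"
  interpret periodic_solution ?P ?Q \<gamma> T by fact
  let ?f = "\<lambda>x y. (y + 0*x^2)^2 + x^2*(x - a)*(x - b)"
  have f: "((\<lambda>t. ?f (x t) (y t)) has_real_derivative 16 * y t * ?f (x t) (y t)) (at t)" for t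
    by (rule derivative_eq_intros dx dy refl)+ (simp add: field_simps, algebra)
  obtain t0 where t0: "y t0 = 0"
    using cofactor_coordinate_zero[OF f _ _ _ conty] nz by (auto simp: per x_def y_def case_prod_unfold)
  show ?thesis by (rule reversible_y_not_isolated[OF _ _ t0]) auto
qed

theorem theorem1p2:
  fixes P Q f :: "real \<Rightarrow> real \<Rightarrow> real"
  assumes "quadratic_family P Q f"
  shows "(\<forall>\<Gamma> \<Delta>. limit_cycle P Q \<Gamma> \<longrightarrow> limit_cycle P Q \<Delta> \<longrightarrow> \<Gamma> = \<Delta>) \<and>
    (\<forall>\<Gamma>. limit_cycle P Q \<Gamma> \<longrightarrow> algebraic_limit_cycle P Q \<Gamma> \<and> \<Gamma> \<subseteq> curve f)"
proof -
  note base = limit_cycles_on_curve[OF quadratic_family_polynomial[OF assms] quadratic_family_invariant[OF assms]]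
  show ?thesis
    using assms
  proof cases
    case (Qin a b c)
    have few: "few_critical_points P Q f" unfolding Qin by (rule Qin_critical)
    show ?thesis
    proof (rule base[OF _ few])
      fix \<gamma> T
      assume 1: "periodic_solution P Q \<gamma> T" "limit_cycle P Q (range \<gamma>)" "\<And>t. (\<lambda>(x, y). f x y) (\<gamma> t) \<noteq> 0"
      show False
      proof (cases "a = 0")
        case True
        show False using 1 Qin_center[of b c \<gamma> T] unfolding Qin True by (simp only: case_prod_unfold) blast
      next
        case False
        show False using 1 Qin_off[of a b c \<gamma> T] False unfolding Qin by (simp only: case_prod_unfold) blast
      qed
    qed
  next
    case (Yablonskii a b c)
    have few: "few_critical_points P Q f" unfolding Yablonskii by (rule Yablonskii_critical)
    show ?thesis
    proof (rule base[OF _ few])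
      fix \<gamma> T
      assume 1: "periodic_solution P Q \<gamma> T" "limit_cycle P Q (range \<gamma>)" "\<And>t. (\<lambda>(x, y). f x y) (\<gamma> t) \<noteq> 0"
      show False
      proof (cases "c = 0")
        case True
        show False using 1 Yablonskii_center[of a b \<gamma> T] unfolding Yablonskii True by blast
      next
        case False
        show False by (rule Yablonskii_off[OF 1(1)[unfolded Yablonskii] False 1(3)[unfolded Yablonskii]])
      qed
    qed
  next
    case (Filiptsov a)
    have few: "few_critical_points P Q f" unfolding Filiptsov by (rule Filiptsov_critical)
    show ?thesis
    proof (rule base[OF _ few])
      fix \<gamma> T
      assume 1: "periodic_solution P Q \<gamma> T" and 2: "\<And>t. (\<lambda>(x, y). f x y) (\<gamma> t) \<noteq> 0"
      show False
        by (rule Filiptsov_off[OF 1[unfolded Filiptsov] 2[unfolded Filiptsov]])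
    qed
  next
    case (Chavarriga a)
    have few: "few_critical_points P Q f" unfolding Chavarriga(1-3) by (rule Chavarriga_critical)
    show ?thesis
    proof (rule base[OF _ few])
      fix \<gamma> T
      assume 1: "periodic_solution P Q \<gamma> T" and 2: "\<And>t. (\<lambda>(x, y). f x y) (\<gamma> t) \<noteq> 0"
      show False
        by (rule Chavarriga_off[OF 1[unfolded Chavarriga(1-3)] Chavarriga(4) 2[unfolded Chavarriga(1-3)]])
    qed
  next
    case (Chavarriga_Llibre_Sorolla a)
    have few: "few_critical_points P Q f" unfolding Chavarriga_Llibre_Sorolla by (rule Chavarriga_Llibre_Sorolla_critical)
    show ?thesis
    proof (rule base[OF _ few])
      fix \<gamma> T
      assume 1: "periodic_solution P Q \<gamma> T" and 2: "\<And>t. (\<lambda>(x, y). f x y) (\<gamma> t) \<noteq> 0"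
      show False
        by (rule Chavarriga_Llibre_Sorolla_off[OF 1[unfolded Chavarriga_Llibre_Sorolla] 2[unfolded Chavarriga_Llibre_Sorolla]])
    qed
  next
    case (Christopher_Llibre_Swirszcz_5 a)
    have few: "few_critical_points P Q f" unfolding Christopher_Llibre_Swirszcz_5(1-3) by (rule Christopher_Llibre_Swirszcz_5_critical[OF Christopher_Llibre_Swirszcz_5(4)])
    show ?thesis
    proof (rule base[OF _ few])
      fix \<gamma> T
      assume 1: "periodic_solution P Q \<gamma> T" and 2: "\<And>t. (\<lambda>(x, y). f x y) (\<gamma> t) \<noteq> 0"
      show False
        by (rule Christopher_Llibre_Swirszcz_5_off[OF 1[unfolded Christopher_Llibre_Swirszcz_5(1-3)] Christopher_Llibre_Swirszcz_5(4,5) 2[unfolded Christopher_Llibre_Swirszcz_5(1-3)]])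
    qed
  next
    case (Christopher_Llibre_Swirszcz_6 a)
    have few: "few_critical_points P Q f" unfolding Christopher_Llibre_Swirszcz_6 by (rule Christopher_Llibre_Swirszcz_6_critical)
    show ?thesis
    proof (rule base[OF _ few])
      fix \<gamma> T
      assume 1: "periodic_solution P Q \<gamma> T" and 2: "\<And>t. (\<lambda>(x, y). f x y) (\<gamma> t) \<noteq> 0"
      show False
        by (rule Christopher_Llibre_Swirszcz_6_off[OF 1[unfolded Christopher_Llibre_Swirszcz_6] 2[unfolded Christopher_Llibre_Swirszcz_6]])
    qed
  next
    case (Alberich_Ferragut_Llibre a)
    have few: "few_critical_points P Q f" unfolding Alberich_Ferragut_Llibre(1-3) by (rule Alberich_Ferragut_Llibre_critical[OF Alberich_Ferragut_Llibre(4)])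
    show ?thesis
    proof (rule base[OF _ few])
      fix \<gamma> T
      assume 1: "periodic_solution P Q \<gamma> T" and 2: "\<And>t. (\<lambda>(x, y). f x y) (\<gamma> t) \<noteq> 0"
      show False
        by (rule Alberich_Ferragut_Llibre_off[OF 1[unfolded Alberich_Ferragut_Llibre(1-3)] Alberich_Ferragut_Llibre(4,5) 2[unfolded Alberich_Ferragut_Llibre(1-3)]])
    qed
  qed
qed

end
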